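(* Let $1\le d<n$ and let $A\in\mathrm{Mat}_{d+1,n-d}(\mathbb R)$ be the matrix defining the $d$-dimensional affine subspace $\mathcal A=\mathcal L_A\subset U_a^+\cong\mathbb R^n$. Suppose that the Diophantine exponent satisfies $\omega(A)<n$. Then for almost every $u\in\mathcal A$ (with respect to Lebesgue measure on $\mathcal A$), every weak-$*$ limit point, as $T\to\infty$, of the family of measures $$\frac1T\int_0^T \delta_{a_tux_0}\,dt$$ is a probability measure on $X$.
   Context: $G=\mathrm{SL}_{n+1}(\mathbb R)$, $\Gamma=\mathrm{SL}_{n+1}(\mathbb Z)$, $X=G/\Gamma$, $x_0=e\Gamma\in X$, and $a_t=\mathrm{diag}(e^{\frac{n}{n+1}t},e^{-\frac1{n+1}t},\dots,e^{-\frac1{n+1}t})\in G$. $U_a^+$ is the group of matrices $\begin{pmatrix}1&x\\0&I_n\end{pmatrix}$ with $x\in\mathbb R^n$ a row vector; it is identified with $\mathbb R^n$. $\delta_y$ is the Dirac mass at $y$; weak-$*$ convergence is tested against $C_c(X)$. For $A\in\mathrm{Mat}_{d+1,n-d}(\mathbb R)$ put $\mathcal L_A=\{(\mathbf x,\widetilde{\mathbf x}A):\mathbf x\in\mathbb R^d\}\subset\mathbb R^n$ with $\widetilde{\mathbf x}=(1,\mathbf x)\in\mathbb R^{d+1}$ (row vectors). Every $d$-dimensional affine subspace of $\mathbb R^n$ is of this form for a unique $A$ after a permutation of coordinates making its projection to the first $d$ coordinates bijective. $\omega(A)$ is the supremum of all $\omega>0$ such that $\|A\mathbf q+\mathbf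 p\|\le\|\mathbf q\|^{-\omega}$ has infinitely many integer solutions $(\mathbf q,\mathbf p)\in\mathbb Z^{n-d}\times\mathbb Z^{d+1}$ with $\mathbf q\ne0$. *)

theory Defs
  imports "HOL-Probability.Probability"
begin

section \<open>The space of lattices\<close>

text \<open>Here \<open>'n\<close> indexes the coordinates of \<open>\<real>\<^sup>n\<close>, so \<open>(n+1) \<times> (n+1)\<close> matrices are indexed by
  \<open>'n option\<close>, with \<open>None\<close> as the first row and column.\<close>

definition SL :: "(real^'k^'k) set" where
  "SL = {g. det g = 1}"

definition SL_int :: "(real^'k^'k) set" where
  "SL_int = {g \<in> SL. \<forall>i j. g $ i $ j \<in> \<int>}"

definition act :: "real^'k^'k \<Rightarrow> (real^'k^'k) set \<Rightarrow> (real^'k^'k) set" where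
  "act g x = (\<lambda>h. g ** h) ` x"

definition base_point :: "(real^'k^'k) set" where
  "base_point = act (mat 1) SL_int"

definition quotient_topology :: "'a topology \<Rightarrow> ('a \<Rightarrow> 'b) \<Rightarrow> 'b topology" where
  "quotient_topology Y q =
     topology (\<lambda>U. U \<subseteq> q ` topspace Y \<and> openin Y {y \<in> topspace Y. q y \<in> U})"

text \<open>The points of \<open>G / \<Gamma>\<close> are the left cosets \<open>g \<Gamma>\<close>.\<close>

definition lattice_space :: "(real^'k^'k) set topology" where
  "lattice_space = quotient_topology (top_of_set SL) (\<lambda>g. act g SL_int)"

lemma istopology_quotient:
  "istopology (\<lambda>U. U \<subseteq> q ` topspace Y \<and> openin Y {y \<in> topspace Y. q y \<in> U})"
  unfolding istopology_def
proof (intro conjI allI impI)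
  fix S T
  assume S: "S \<subseteq> q ` topspace Y \<and> openin Y {y \<in> topspace Y. q y \<in> S}"
    and T: "T \<subseteq> q ` topspace Y \<and> openin Y {y \<in> topspace Y. q y \<in> T}"
  show "S \<inter> T \<subseteq> q ` topspace Y" using S by blast
  have "{y \<in> topspace Y. q y \<in> S \<inter> T}
      = {y \<in> topspace Y. q y \<in> S} \<inter> {y \<in> topspace Y. q y \<in> T}" by blast
  then show "openin Y {y \<in> topspace Y. q y \<in> S \<inter> T}" using S T by (simp add: openin_Int)
next
  fix K
  assume K: "\<forall>S\<in>K. S \<subseteq> q ` topspace Y \<and> openin Y {y \<in> topspace Y. q y \<in> S}"
  then show "\<Union>K \<subseteq> q ` topspace Y" by blast
  have "{y \<in> topspace Y. q y \<in> \<Union>K} = (\<Union>S\<in>K. {y \<in> topspace Y. q y \<in> S})" by blast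
  then show "openin Y {y \<in> topspace Y. q y \<in> \<Union>K}" using K by (metis (no_types, lifting) openin_Union imageE)
qed

lemma openin_quotient_topology:
  "openin (quotient_topology Y q) U \<longleftrightarrow>
     U \<subseteq> q ` topspace Y \<and> openin Y {y \<in> topspace Y. q y \<in> U}"
  unfolding quotient_topology_def using istopology_quotient[of q Y]
  by (simp add: topology_inverse')

lemma topspace_quotient_topology: "topspace (quotient_topology Y q) = q ` topspace Y"
proof -
  have "{y \<in> topspace Y. q y \<in> q ` topspace Y} = topspace Y" by blast
  then have "openin (quotient_topology Y q) (q ` topspace Y)"
    by (simp add: openin_quotient_topology)
  then show ?thesis
    by (metis openin_quotient_topology openin_subset openin_topspace subset_antisym)
qed

lemma quotient_map_quotient_topology: "quotient_map Y (quotient_topology Y q) q"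
  unfolding quotient_map_def
  by (simp add: topspace_quotient_topology openin_quotient_topology)

definition diag_flow :: "real \<Rightarrow> real^('n::finite option)^('n option)" where
  "diag_flow t = (\<chi> i j. if i \<noteq> j then 0
     else if i = None then exp (real CARD('n) / (real CARD('n) + 1) * t)
     else exp (- (1 / (real CARD('n) + 1)) * t))"

text \<open>The identification of \<open>\<real>\<^sup>n\<close> with the group of matrices with first row \<open>(1, x)\<close>.\<close>

definition horo :: "real^'n::finite \<Rightarrow> real^('n option)^('n option)" where
  "horo x = (\<chi> i j. if i = j then 1
     else case (i, j) of (None, Some k) \<Rightarrow> x $ k | _ \<Rightarrow> 0)"


section \<open>Affine subspaces and the Diophantine exponent\<close>

text \<open>The coordinates of \<open>\<real>\<^sup>n\<close> are indexed by \<open>'d + 'm\<close>, the first \<open>d\<close> by \<open>'d\<close> and the other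
  \<open>n - d\<close> by \<open>'m\<close>. Index types are non-empty, so \<open>1 \<le> d < n\<close>. The \<open>d + 1\<close> rows of \<open>A\<close> are
  indexed by \<open>'d option\<close>, with \<open>None\<close> as the first one.\<close>

definition tilde :: "real^'d::finite \<Rightarrow> real^('d option)" where
  "tilde x = (\<chi> i. case i of None \<Rightarrow> 1 | Some k \<Rightarrow> x $ k)"

definition affine_param :: "real^'m::finite^('d::finite option) \<Rightarrow> real^'d::finite \<Rightarrow> real^('d + 'm)" where
  "affine_param A x = (\<chi> k. case k of Inl i \<Rightarrow> x $ i | Inr j \<Rightarrow> (tilde x v* A) $ j)"

definition affine_subspace :: "real^'m::finite^('d::finite option) \<Rightarrow> (real^('d + 'm)) set" where
  "affine_subspace A = range (affine_param A)"

text \<open>The parametrization is an injective affine map, so it carries Lebesgue measure on \<open>\<real>\<^sup>d\<close> to a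
  positive constant multiple of the \<open>d\<close>-dimensional Lebesgue measure on the subspace.\<close>

definition lebesgue_affine :: "real^'m::finite^('d::finite option) \<Rightarrow> (real^('d + 'm)) measure" where
  "lebesgue_affine A = distr lborel (restrict_space borel (affine_subspace A)) (affine_param A)"

definition int_vec :: "int^'k \<Rightarrow> real^'k" where
  "int_vec v = (\<chi> i. of_int (v $ i))"

text \<open>The exponent does not depend on the choice of norms; the Euclidean ones are used. Its value
  can be \<open>\<infinity>\<close>.\<close>

definition dioph_exponent :: "real^'m::finite^('d::finite option) \<Rightarrow> ereal" where
  "dioph_exponent A = Sup {ereal \<omega> | \<omega>. \<omega> > 0 \<and>
     infinite {(q :: int^'m, p :: int^('d option)). q \<noteq> 0 \<and>
       norm (A *v int_vec q + int_vec p) \<le> norm (int_vec q) powr (- \<omega>)}}"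


section \<open>Weak-\<open>*\<close> limit points\<close>

definition borel_on :: "'a topology \<Rightarrow> 'a measure" where
  "borel_on X = sigma (topspace X) {U. openin X U}"

definition compactly_supported :: "'a topology \<Rightarrow> ('a \<Rightarrow> real) set" where
  "compactly_supported X = {f. continuous_map X euclideanreal f \<and>
     compactin X (X closure_of {x \<in> topspace X. f x \<noteq> 0})}"

text \<open>On the second countable, locally compact Hausdorff spaces considered here, these are exactly
  the Radon measures.\<close>

definition locally_finite_measures :: "'a topology \<Rightarrow> 'a measure set" where
  "locally_finite_measures X =
     {\<mu>. sets \<mu> = sets (borel_on X) \<and> (\<forall>K. compactin X K \<longrightarrow> emeasure \<mu> K < \<infinity>)}"

text \<open>The coarsest topology for which \<open>\<mu> \<mapsto> \<integral>f d\<mu>\<close> is continuous for every \<open>f \<in> C\<^sub>c(X)\<close>.\<close>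

definition weak_star_topology :: "'a topology \<Rightarrow> 'a measure topology" where
  "weak_star_topology X = pullback_topology (locally_finite_measures X)
     (\<lambda>\<mu>. \<lambda>f\<in>compactly_supported X. \<integral>x. f x \<partial>\<mu>)
     (product_topology (\<lambda>_. euclideanreal) (compactly_supported X))"

definition limit_point_of :: "'b topology \<Rightarrow> ('a \<Rightarrow> 'b) \<Rightarrow> 'b \<Rightarrow> 'a filter \<Rightarrow> bool" where
  "limit_point_of Y f l F \<longleftrightarrow> l \<in> topspace Y \<and>
     (\<forall>U. openin Y U \<and> l \<in> U \<longrightarrow> (\<exists>\<^sub>F t in F. f t \<in> U))"

text \<open>\<open>1/T \<integral>\<^sub>0\<^sup>T \<delta>\<^bsub>\<phi>(t)\<^esub> dt\<close>; \<^const>\<open>return\<close> is the Dirac mass and \<^const>\<open>bind\<close> integrates a family of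
  measures.\<close>

definition orbit_average :: "'a topology \<Rightarrow> (real \<Rightarrow> 'a) \<Rightarrow> real \<Rightarrow> 'a measure" where
  "orbit_average X \<phi> T =
     uniform_measure lborel {0..T} \<bind> (\<lambda>t. return (borel_on X) (\<phi> t))"

lemma space_borel_on [simp]: "space (borel_on X) = topspace X"
  and sets_borel_on: "sets (borel_on X) = sigma_sets (topspace X) {U. openin X U}"
proof -
  have *: "{U. openin X U} \<subseteq> Pow (topspace X)"
    using openin_subset by blast
  show "space (borel_on X) = topspace X"
    unfolding borel_on_def using * by (rule space_measure_of)
  show "sets (borel_on X) = sigma_sets (topspace X) {U. openin X U}"
    unfolding borel_on_def using * by (rule sets_measure_of)
qed

lemma emeasure_orbit_average:
  assumes \<phi>: "\<phi> \<in> borel \<rightarrow>\<^sub>M borel_on X" and T: "T > 0" and E: "E \<in> sets (borel_on X)"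
  shows "emeasure (orbit_average X \<phi> T) E
    = (\<integral>\<^sup>+t\<in>{0..T}. emeasure (return (borel_on X) (\<phi> t)) E \<partial>lborel) / ennreal T"
proof -
  let ?u = "uniform_measure lborel {0..T}"
  have m: "(\<lambda>t. return (borel_on X) (\<phi> t)) \<in> ?u \<rightarrow>\<^sub>M subprob_algebra (borel_on X)"
    using measurable_compose[OF \<phi> return_measurable]
    by (simp add: measurable_cong_sets[of ?u borel])
  have me: "(\<lambda>t. emeasure (return (borel_on X) (\<phi> t)) E) \<in> borel_measurable lborel"
    using measurable_emeasure_kernel[OF m E] by (auto simp: measurable_def)
  have "emeasure (orbit_average X \<phi> T) E
      = (\<integral>\<^sup>+t. emeasure (return (borel_on X) (\<phi> t)) E \<partial>?u)"
    unfolding orbit_average_def by (rule emeasure_bind[OF _ m E]) simp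
  also have "\<dots> = (\<integral>\<^sup>+t\<in>{0..T}. emeasure (return (borel_on X) (\<phi> t)) E \<partial>lborel)
      / emeasure lborel {0..T}"
    by (rule nn_integral_uniform_measure[OF me]) simp
  finally show ?thesis using T by simp
qed

lemma det_diag_flow: "det (diag_flow t :: real^('n::finite option)^('n option)) = 1"
proof -
  let ?n = "real CARD('n)"
  have "det (diag_flow t :: real^('n option)^('n option))
      = (\<Prod>i\<in>UNIV. (diag_flow t :: real^('n option)^('n option)) $ i $ i)"
    by (rule det_diagonal) (simp add: diag_flow_def)
  also have "\<dots> = exp (?n / (?n + 1) * t) * exp (- (1 / (?n + 1)) * t) ^ CARD('n)"
    by (simp add: diag_flow_def UNIV_option_conv prod.reindex)
  also have "\<dots> = 1"
    by (simp add: exp_of_nat_mult[symmetric] mult_exp_exp)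
  finally show ?thesis .
qed

lemma det_horo: "det (horo x :: real^('n::finite option)^('n option)) = 1"
proof -
  let ?h = "horo x :: real^('n option)^('n option)"
  let ?f = "\<lambda>p. of_int (sign p) * (\<Prod>i\<in>UNIV. ?h $ i $ p i)"
  have z: "?f p = 0" if p: "p permutes UNIV" and "p \<noteq> id" for p
  proof -
    have "\<exists>k. p (Some k) \<noteq> Some k"
    proof (rule ccontr)
      assume "\<nexists>k. p (Some k) \<noteq> Some k"
      then have S: "p (Some k) = Some k" for k by simp
      have "p None = None"
        by (metis S not_Some_eq p permutes_univ)
      then have "p i = i" for i using S by (cases i) auto
      then show False using \<open>p \<noteq> id\<close> by auto
    qed
    then obtain k where "p (Some k) \<noteq> Some k" by blast
    then have "?h $ Some k $ p (Some k) = 0" by (simp add: horo_def)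
    then have "(\<Prod>i\<in>UNIV. ?h $ i $ p i) = 0" by (intro prod_zero) auto
    then show ?thesis by simp
  qed
  have "det ?h = sum ?f {p. p permutes UNIV}" by (simp add: det_def)
  also have "\<dots> = sum ?f {id}"
    by (rule sum.mono_neutral_right) (use z in \<open>auto simp: permutes_id\<close>)
  also have "\<dots> = 1" by (simp add: horo_def)
  finally show ?thesis .
qed

lemma continuous_orbit:
  "continuous_map euclideanreal lattice_space
     (\<lambda>t. act (diag_flow t ** horo x) (base_point :: (real^('n::finite option)^('n option)) set))"
proof -
  let ?g = "\<lambda>t. diag_flow t ** horo x :: real^('n option)^('n option)"
  have base: "act g base_point = act g SL_int" for g :: "real^('n option)^('n option)"
    by (simp add: base_point_def act_def)
  have c: "continuous_on UNIV (\<lambda>t. ?g t $ i $ j)" for i j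
  proof -
    have "continuous_on UNIV (\<lambda>t. (diag_flow t :: real^('n option)^('n option)) $ i $ k)" for k
      by (cases "i = k"; cases "i = None") (auto simp: diag_flow_def intro!: continuous_intros)
    then show ?thesis
      by (simp add: matrix_matrix_mult_def continuous_on_sum continuous_on_mult_right)
  qed
  have "continuous_on UNIV ?g"
  proof -
    have "continuous_on UNIV (\<lambda>t. \<chi> i j. ?g t $ i $ j)"
      by (intro continuous_on_vec_lambda c)
    then show ?thesis by (simp add: vec_lambda_eta)
  qed
  then have 1: "continuous_map euclideanreal (top_of_set SL) ?g"
    by (auto simp: continuous_map_in_subtopology SL_def det_mul det_diag_flow det_horo)
  have 2: "continuous_map (top_of_set SL) lattice_space
      (\<lambda>g. act g (SL_int :: (real^('n option)^('n option)) set))"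
    unfolding lattice_space_def
    by (rule quotient_imp_continuous_map[OF quotient_map_quotient_topology])
  show ?thesis
    using continuous_map_compose[OF 1 2] by (simp add: base o_def)
qed

lemma measurable_borel_on:
  assumes "continuous_map euclidean X f"
  shows "f \<in> borel \<rightarrow>\<^sub>M borel_on X"
  unfolding borel_on_def
proof (rule measurable_measure_of)
  show "{U. openin X U} \<subseteq> Pow (topspace X)" using openin_subset by blast
  show "f \<in> space borel \<rightarrow> topspace X" using assms by (auto simp: continuous_map_def)
  fix U assume "U \<in> {U. openin X U}"
  then have "openin euclidean {x \<in> topspace euclidean. f x \<in> U}"
    using assms by (auto simp only: continuous_map_def)
  then have "open {x. f x \<in> U}" by (simp add: open_openin[symmetric])
  then show "f -` U \<inter> space borel \<in> sets borel" by (simp add: vimage_def)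
qed

end

(*
A vector z = (p, q) of Z^(n+1), split as (p', q2) with p' in Z^(d+1) and q2 in Z^(n-d), is moved by
a_t u_y to (e^(nt/(n+1)) <(1,y), L z>, e^(-t/(n+1)) q), where L z = A q2 + p'. Since omega(A) < n,
|L z| >= c |q2|^(-w) for some w < n, and cutting boxes into cells on which L separates points bounds
the number of z with |q2| <= X, |L z| <= rho by a constant times X^w rho + X^(n-d) rho^(d+1).
Weighting each z by the measure of the slab of those y for which it becomes short gives first moment
bounds over unit cubes: outside a set of y of measure 2^(-kR), no short vector at time t has an
exceptionally small linear part, and the lattice at time t - R has no vector shorter than 2^(-kR).
The latter lattice then has covering radius much smaller than 2^(R/(n+1)), so its points in large boxes
are counted by volume, and in a cube of side 2^(-t+R) the mean number of vectors of norm at most 1 at time t is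
bounded by an absolute constant. As a vector of norm e has 1/e multiples of norm at most 1, the
proportion of y in such a cube with a vector of norm e at time t is O(e). Along times spaced by R this
conditional bound gives an exponential moment of the number of visits to the cusp; with R = i and
time horizon i^2 the errors are summable in i, and Borel-Cantelli shows that almost every orbit
spends a proportion O(e) of its time in the cusp. Test functions in C_c that equal 1 on large
compact sets transfer this to every weak-* limit point.
*)
theory Submission
  imports Defs "HOL-Real_Asymp.Real_Asymp"
begin

section \<open>Tilings and lattice points\<close>

text \<open>A first moment over unit cubes bounds the time in the cusp only in mean; a statement for
  almost every orbit needs bounds conditional on the past, that is, on small cubes. There the mean
  can be large for two reasons, and each is rare by a first moment over the unit cube. The slab of a
  vector with linear part of size rho has measure about X^(-n) / rho, so the two terms of the count
  contribute X^(w-n) and (rho / X)^d. The first is a negative power of X because w < n; the second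
  is small once rho is below X by a power of 2^R. Every dyadic range of rho may cost the same, hence
  a factor linear in the time. It is harmless: the times up to i^2 lose only a polynomial in i
  against 2^(-k i), whereas with R fixed the errors would not sum. In a small cube the remaining
  vectors have rho above the covering radius, their number is about rho^(d+1) times a factor
  independent of rho, and the dyadic sum is geometric, so no such loss occurs.\<close>

lemma int_vec_nth [simp]: "int_vec z $ i = of_int (z $ i)"
  by (simp add: int_vec_def)

lemma int_vec_0 [simp]: "int_vec 0 = 0"
  by (simp add: vec_eq_iff)

lemma nn_integral_lborel_translate:
  fixes f :: "'a::euclidean_space \<Rightarrow> ennreal"
  assumes [measurable]: "f \<in> borel_measurable borel"
  shows "(\<integral>\<^sup>+x. f (c + x) \<partial>lborel) = (\<integral>\<^sup>+x. f x \<partial>lborel)"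
  by (subst (2) lborel_distr_plus[of c, symmetric]) (simp add: nn_integral_distr)

text \<open>Unimodularity is expressed by a fundamental domain of volume 1 instead of a determinant;
  for the lattices \<open>renorm\<close> below the domain is an explicit box.\<close>

locale tiling =
  fixes lam :: "int^'k::finite \<Rightarrow> real^'k" and F :: "(real^'k) set"
  assumes lam_add: "lam (a + b) = lam a + lam b"
    and F_borel [measurable]: "F \<in> sets borel"
    and F_vol: "emeasure lborel F = 1"
    and tile: "\<exists>!z. x - lam z \<in> F"
begin

lemma lam_0 [simp]: "lam 0 = 0"
  using lam_add[of 0 0] by simp

lemma lam_minus: "lam (- a) = - lam a"
  using lam_add[of a "- a"] by (simp add: eq_neg_iff_add_eq_0 add.commute)

lemma lam_diff: "lam (a - b) = lam a - lam b"
  using lam_add[of a "- b"] by (simp add: lam_minus)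

text \<open>Translation invariance moves the summand of z to the tile F + \<open>lam z\<close>, and
  the tiles partition the space. Bounds on the number of lattice points in translates of E thus
  become bounds on its volume, in both directions.\<close>

lemma unfolding_formula:
  assumes [measurable]: "E \<in> sets borel"
  shows "(\<integral>\<^sup>+x. indicator F x * (\<integral>\<^sup>+z. indicator E (lam z + x) \<partial>count_space UNIV) \<partial>lborel) = emeasure lborel E"
proof -
  have "(\<integral>\<^sup>+x. indicator F x * (\<integral>\<^sup>+z. indicator E (lam z + x) \<partial>count_space UNIV) \<partial>lborel)
      = (\<integral>\<^sup>+x. (\<integral>\<^sup>+z. indicator F x * indicator E (lam z + x) \<partial>count_space UNIV) \<partial>lborel)"
    by (simp add: nn_integral_cmult)
  also have "\<dots> = (\<integral>\<^sup>+z. (\<integral>\<^sup>+x. indicator F x * indicator E (lam z + x) \<partial>lborel) \<partial>count_space UNIV)"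
    by (rule nn_integral_count_space_nn_integral) auto
  also have "\<dots> = (\<integral>\<^sup>+z. (\<integral>\<^sup>+x. indicator F (x - lam z) * indicator E x \<partial>lborel) \<partial>count_space UNIV)"
  proof (rule nn_integral_cong)
    fix z
    have m: "(\<lambda>x. indicator F (x - lam z) * indicator E x :: ennreal) \<in> borel_measurable borel"
      by measurable
    show "(\<integral>\<^sup>+x. indicator F x * indicator E (lam z + x) \<partial>lborel)
        = (\<integral>\<^sup>+x. indicator F (x - lam z) * indicator E x \<partial>lborel)"
      using nn_integral_lborel_translate[OF m, of "lam z"] by simp
  qed
  also have "\<dots> = (\<integral>\<^sup>+x. (\<integral>\<^sup>+z. indicator F (x - lam z) * indicator E x \<partial>count_space UNIV) \<partial>lborel)"
    by (rule nn_integral_count_space_nn_integral[symmetric]) auto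
  also have "\<dots> = (\<integral>\<^sup>+x. indicator E x \<partial>lborel)"
  proof (rule nn_integral_cong)
    fix x
    obtain z0 where z0: "x - lam z0 \<in> F" "\<And>z. x - lam z \<in> F \<Longrightarrow> z = z0"
      using tile[of x] by blast
    have "(\<integral>\<^sup>+z. indicator F (x - lam z) * indicator E x \<partial>count_space UNIV)
      = (\<integral>\<^sup>+z. indicator {z0} z * indicator E x \<partial>count_space UNIV)"
    proof (rule nn_integral_cong)
      fix z
      have "(x - lam z \<in> F) = (z = z0)" using z0 by blast
      then show "indicator F (x - lam z) * indicator E x = indicator {z0} z * (indicator E x :: ennreal)"
        by (simp add: indicator_def)
    qed
    also have "\<dots> = indicator E x"
      by (simp add: nn_integral_multc)
    finally show "(\<integral>\<^sup>+z. indicator F (x - lam z) * indicator E x \<partial>count_space UNIV) = indicator E x" .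
  qed
  finally show ?thesis by simp
qed

text \<open>Blichfeldt's principle: each coset of the lattice meets E at most once, so the inner sum
  in \<open>unfolding_formula\<close> is at most 1.\<close>

lemma volume_le_1:
  assumes E: "E \<in> sets borel" and disj: "\<And>x z. x \<in> E \<Longrightarrow> lam z + x \<in> E \<Longrightarrow> z = 0"
  shows "emeasure lborel E \<le> 1"
proof -
  have "(\<integral>\<^sup>+z. indicator E (lam z + x) \<partial>count_space UNIV) \<le> (1::ennreal)" for x
  proof (cases "\<exists>z. lam z + x \<in> E")
    case True
    then obtain z0 where z0: "lam z0 + x \<in> E" by blast
    have "z = z0" if "lam z + x \<in> E" for z
      using disj[OF z0, of "z - z0"] that by (simp add: lam_diff)
    then have "indicator E (lam z + x) \<le> (indicator {z0} z :: ennreal)" for z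
      unfolding indicator_def by (cases "lam z + x \<in> E") simp_all
    then have "(\<integral>\<^sup>+z. indicator E (lam z + x) \<partial>count_space UNIV)
        \<le> (\<integral>\<^sup>+z. indicator {z0} z \<partial>count_space UNIV :: ennreal)"
      by (intro nn_integral_mono)
    then show ?thesis by simp
  next
    case False
    then have "(\<integral>\<^sup>+z. indicator E (lam z + x) \<partial>count_space UNIV) = (\<integral>\<^sup>+z. 0 \<partial>count_space (UNIV :: (int^'k) set) :: ennreal)"
      by (intro nn_integral_cong) auto
    then show ?thesis by simp
  qed
  then have "(\<integral>\<^sup>+x. indicator F x * (\<integral>\<^sup>+z. indicator E (lam z + x) \<partial>count_space UNIV) \<partial>lborel)
      \<le> (\<integral>\<^sup>+x. indicator F x * 1 \<partial>lborel)"
    by (intro nn_integral_mono mult_left_mono) auto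
  then show ?thesis using unfolding_formula[OF E] by (simp add: F_vol)
qed

text \<open>The opposite use of \<open>unfolding_formula\<close>: here the inner sum is at least N
  for every coset.\<close>

lemma card_le_volume:
  assumes E: "E \<in> sets borel"
    and cov: "\<And>x. \<exists>S. finite S \<and> N \<le> card S \<and> (\<forall>z\<in>S. lam z + x \<in> E)"
  shows "of_nat N \<le> emeasure lborel E"
proof -
  have "of_nat N \<le> (\<integral>\<^sup>+z. indicator E (lam z + x) \<partial>count_space UNIV :: ennreal)" for x
  proof -
    obtain S where S: "finite S" "N \<le> card S" "\<forall>z\<in>S. lam z + x \<in> E" using cov by blast
    have "of_nat N \<le> (of_nat (card S) :: ennreal)" using S by simp
    also have "\<dots> = (\<integral>\<^sup>+z. indicator S z \<partial>count_space UNIV)"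
      using S by simp
    also have "\<dots> \<le> (\<integral>\<^sup>+z. indicator E (lam z + x) \<partial>count_space UNIV)"
      using S by (intro nn_integral_mono) (auto simp: indicator_def)
    finally show ?thesis .
  qed
  then have "(\<integral>\<^sup>+x. indicator F x * of_nat N \<partial>lborel)
     \<le> (\<integral>\<^sup>+x. indicator F x * (\<integral>\<^sup>+z. indicator E (lam z + x) \<partial>count_space UNIV) \<partial>lborel)"
    by (intro nn_integral_mono mult_left_mono) auto
  then show ?thesis using unfolding_formula[OF E] by (simp add: nn_integral_multc F_vol)
qed

definition lattice_dist :: "real^'k \<Rightarrow> real" where "lattice_dist x = infdist x (range lam)"

lemma lattice_dist_translate: "lattice_dist (lam z + x) = lattice_dist x"
proof -
  have "lattice_dist (lam z + x) \<le> lattice_dist x" for x z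
  proof -
    have "lattice_dist (lam z + x) \<le> dist x a" if a: "a \<in> range lam" for a
    proof -
      obtain w where w: "a = lam w" using a by auto
      have "lattice_dist (lam z + x) \<le> dist (lam z + x) (lam (z + w))"
        unfolding lattice_dist_def by (rule infdist_le) auto
      also have "\<dots> = dist x a" by (simp add: lam_add w dist_norm)
      finally show ?thesis .
    qed
    then show ?thesis unfolding lattice_dist_def infdist_notempty[of "range lam", simplified]
      by (intro cINF_greatest) auto
  qed
  from this[of z x] this[of "- z" "lam z + x"] show ?thesis
    by (simp add: lam_minus)
qed

text \<open>If \<open>x\<close> were far from the lattice, then along a path from \<open>0\<close> to \<open>x\<close> there would be points at
  distance \<open>(j + 1/2) d\<close> from it for every \<open>j < k\<close>; the balls of radius \<open>d/2\<close> around them are disjoint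
  modulo the lattice and have total volume greater than \<open>1\<close>.\<close>

lemma covering:
  assumes d: "d > 0" and short: "\<And>z. z \<noteq> 0 \<Longrightarrow> d \<le> norm (lam z)"
    and k: "real k * ((d/2) ^ CARD('k) * measure lborel (ball (0::real^'k) 1)) > 1"
  shows "\<exists>z. dist x (lam z) < d * real k"
proof (rule ccontr)
  assume "\<not> ?thesis"
  then have ge: "\<And>z. dist x (lam z) \<ge> d * real k" by (simp add: not_less)
  have hx: "lattice_dist x \<ge> d * real k"
    unfolding lattice_dist_def infdist_notempty[of "range lam", simplified]
    by (intro cINF_greatest) (use ge in auto)
  have h0: "lattice_dist 0 = 0"
    unfolding lattice_dist_def by (metis infdist_zero lam_0 rangeI)
  have cont: "continuous_on UNIV lattice_dist"
    unfolding lattice_dist_def by (intro continuous_intros)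
  have "\<exists>y. lattice_dist y = d * (real j + 1/2)" if "j < k" for j
  proof -
    have "lattice_dist 0 \<le> d * (real j + 1/2)" using d h0 by simp
    moreover have "d * (real j + 1/2) \<le> lattice_dist x"
    proof -
      have "real j + 1/2 \<le> real k" using that by linarith
      then show ?thesis using hx d by (meson mult_left_mono less_imp_le order_trans)
    qed
    ultimately obtain t where "lattice_dist t = d * (real j + 1/2)"
      using connected_ivt_component[of "lattice_dist ` UNIV" "lattice_dist 0" "lattice_dist x" "1::real" "d * (real j + 1/2)"]
        connected_continuous_image[OF cont] by (auto simp: connected_UNIV)
    then show ?thesis by blast
  qed
  then obtain p where p: "\<And>j. j < k \<Longrightarrow> lattice_dist (p j) = d * (real j + 1/2)" by metis
  define B where "B j = ball (p j) (d/2)" for j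
  \<comment> \<open>\<open>lattice_dist\<close> is 1-Lipschitz, so on \<open>B j\<close> its values
    stay within d / 2 of (j + 1/2) d. These ranges are disjoint for distinct j and invariant under
    the lattice, which separates the balls modulo the lattice.\<close>
  have Bh: "d * real j < lattice_dist y \<and> lattice_dist y < d * (real j + 1)" if "j < k" "y \<in> B j" for j y
  proof -
    have "\<bar>lattice_dist y - lattice_dist (p j)\<bar> \<le> dist y (p j)"
      unfolding lattice_dist_def using infdist_triangle_abs by blast
    then show ?thesis using that p[of j] by (auto simp: B_def dist_commute algebra_simps abs_le_iff)
  qed
  have uniq: "i = j" if "i < k" "j < k" "y \<in> B i" "y' \<in> B j" "lattice_dist y = lattice_dist y'" for i j y y'
  proof (rule ccontr)
    assume "i \<noteq> j"
    then consider "real i + 1 \<le> real j" | "real j + 1 \<le> real i" by linarith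
    then have "d * (real i + 1) \<le> d * real j \<or> d * (real j + 1) \<le> d * real i"
      using d by cases (auto intro: mult_left_mono)
    then show False using Bh[of i y] Bh[of j y'] that by auto
  qed
  define E where "E = (\<Union>j<k. B j)"
  have "emeasure lborel E \<le> 1"
  proof (rule volume_le_1)
    show "E \<in> sets borel" unfolding E_def B_def by auto
    fix y z assume "y \<in> E" "lam z + y \<in> E"
    then obtain i j where ij: "i < k" "y \<in> B i" "j < k" "lam z + y \<in> B j" unfolding E_def by auto
    then have "i = j" using uniq[of i j y "lam z + y"] lattice_dist_translate by simp
    \<comment> \<open>Inside a single ball of radius d / 2 a lattice translation has length less
      than d, and \<open>short\<close> leaves only z = 0.\<close>
    then have "dist y (lam z + y) < d"
      using ij dist_triangle_half_r[of "p i" y d "lam z + y"] by (simp add: B_def)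
    then show "z = 0" using short[of z] by (auto simp: dist_norm)
  qed
  moreover have "emeasure lborel E = (\<Sum>j<k. emeasure lborel (B j))"
  proof -
    have "disjoint_family_on B {..<k}"
      unfolding disjoint_family_on_def using uniq by fastforce
    moreover have "B ` {..<k} \<subseteq> sets lborel" unfolding B_def by auto
    ultimately show ?thesis unfolding E_def
      by (intro sum_emeasure[symmetric]) auto
  qed
  moreover have "emeasure lborel (B j) = ennreal ((d/2) ^ CARD('k) * measure lborel (ball (0::real^'k) 1))" for j
    unfolding B_def using content_ball_conv_unit_ball[of "d/2" "p j"] d
      emeasure_lborel_ball_finite[of "p j" "d/2"]
    by (subst emeasure_eq_ennreal_measure) auto
  ultimately have "ennreal (real k * ((d/2) ^ CARD('k) * measure lborel (ball (0::real^'k) 1))) \<le> 1"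
    using d by (simp add: ennreal_mult' ennreal_of_nat_eq_real_of_nat)
  then show False using k by (simp add: ennreal_le_1)
qed

text \<open>Given x, subtract from S a lattice point within D of x: this puts as many points of the
  coset of x into the box enlarged by D, and \<open>card_le_volume\<close> applies to that
  box.\<close>

lemma count_box:
  assumes cov: "\<And>x. \<exists>z. \<forall>i. \<bar>(x - lam z) $ i\<bar> \<le> D" and D: "D \<ge> 0" and a: "\<And>i. a i \<ge> 0"
    and S: "finite S" "\<And>z i. z \<in> S \<Longrightarrow> \<bar>lam z $ i\<bar> \<le> a i"
  shows "real (card S) \<le> (\<Prod>i\<in>UNIV. 2 * (a i + D))"
proof -
  let ?b = "(\<chi> i. a i + D) :: real^'k"
  have "of_nat (card S) \<le> emeasure lborel (cbox (- ?b) ?b)"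
  proof (rule card_le_volume)
    show "cbox (- ?b) ?b \<in> sets borel" by simp
    fix x
    obtain z0 where z0: "\<And>i. \<bar>(x - lam z0) $ i\<bar> \<le> D" using cov by blast
    let ?S = "(\<lambda>z. z - z0) ` S"
    have "card ?S = card S" by (rule card_image) (auto simp: inj_on_def)
    moreover have "lam z + x \<in> cbox (- ?b) ?b" if zS: "z \<in> ?S" for z
    proof -
      obtain w where w: "w \<in> S" "z = w - z0" using zS by blast
      have "\<bar>(lam z + x) $ i\<bar> \<le> a i + D" for i
      proof -
        have "(lam z + x) $ i = lam w $ i + (x - lam z0) $ i" by (simp add: w lam_diff)
        then show ?thesis using S(2)[OF w(1), of i] z0[of i] by linarith
      qed
      then have "- (a i + D) \<le> (lam z + x) $ i \<and> (lam z + x) $ i \<le> a i + D" for i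
        by (meson abs_le_iff minus_le_iff)
      then show ?thesis by (simp add: mem_box_cart)
    qed
    moreover have "finite ?S" using S(1) by blast
    ultimately show "\<exists>S'. finite S' \<and> card S \<le> card S' \<and> (\<forall>z\<in>S'. lam z + x \<in> cbox (- ?b) ?b)"
      by (metis order_refl)
  qed
  also have "emeasure lborel (cbox (- ?b) ?b) = ennreal (\<Prod>i\<in>UNIV. 2 * (a i + D))"
  proof -
    have "0 \<in> cbox (- ?b) ?b"
    proof -
      have "- (a i + D) \<le> 0 \<and> 0 \<le> a i + D" for i using a[of i] D by linarith
      then show ?thesis unfolding mem_box_cart by simp
    qed
    then have "cbox (- ?b) ?b \<noteq> {}" by blast
    then have "measure lborel (cbox (- ?b) ?b) = (\<Prod>i\<in>UNIV. 2 * (a i + D))"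
      by (subst content_cbox_if_cart) (auto intro!: prod.cong)
    moreover have "emeasure lborel (cbox (- ?b) ?b) \<noteq> top"
      using emeasure_lborel_cbox_finite[of "- ?b" ?b] by (simp add: less_top)
    ultimately show ?thesis
      using emeasure_eq_ennreal_measure[of lborel "cbox (- ?b) ?b"] by metis
  qed
  finally have "ennreal (real (card S)) \<le> ennreal (\<Prod>i\<in>UNIV. 2 * (a i + D))"
    by (simp only: ennreal_of_nat_eq_real_of_nat)
  moreover have "0 \<le> (\<Prod>i\<in>UNIV. 2 * (a i + D))"
    by (intro prod_nonneg) (use a D in \<open>simp add: add_nonneg_nonneg\<close>)
  ultimately show ?thesis by (simp only: ennreal_le_iff)
qed

end

section \<open>Reduction: a compactness criterion\<close>

definition int_mat :: "real^'n^'m \<Rightarrow> bool" where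
  "int_mat B \<longleftrightarrow> (\<forall>i j. B $ i $ j \<in> \<int>)"

lemma Ints_det: "int_mat B \<Longrightarrow> det (B::real^'k^'k) \<in> \<int>"
  unfolding det_def int_mat_def by (intro Ints_sum Ints_mult Ints_prod) auto

text \<open>Since det B' divides M, the columns of M B'^(-1) are integral by Cramer's rule. B' maps
  them to M e_j, which vanishes modulo M, so by \<open>code\<close> B also maps them to multiples of
  M; dividing by M shows that B B'^(-1) is integral.\<close>

lemma int_mat_mult_inverse:
  fixes B B' V :: "real^'k::finite^'k"
  assumes B: "int_mat B" and B': "int_mat B'" and V: "B' ** V = mat 1"
    and M: "M \<noteq> 0" "det B' * of_int e = of_int M"
    and code: "\<And>u::int^'k. (\<forall>i. \<exists>w::int. (B' *v int_vec u) $ i = of_int M * of_int w) \<Longrightarrow>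
        (\<forall>i. \<exists>w::int. (B *v int_vec u) $ i = of_int M * of_int w)"
  shows "int_mat (B ** V)"
  unfolding int_mat_def
proof (intro allI)
  fix i j
  have d: "det B' \<noteq> 0" using M by auto
  define x where "x = (\<chi> k. V $ k $ j * of_int M)"
  have BV: "(\<Sum>k\<in>UNIV. B' $ i $ k * V $ k $ j) = (if i = j then 1 else 0)" for i
    using arg_cong[OF V, of "\<lambda>A. A $ i $ j"] by (simp add: matrix_matrix_mult_def mat_def)
  have Bx: "B' *v x = (\<chi> i. if i = j then of_int M else 0)"
  proof (simp add: vec_eq_iff, intro allI)
    fix i
    have "(B' *v x) $ i = (\<Sum>k\<in>UNIV. B' $ i $ k * V $ k $ j) * of_int M"
      by (simp add: x_def matrix_vector_mult_def sum_distrib_right mult.assoc)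
    then show "(i = j \<longrightarrow> (B' *v x) $ j = of_int M) \<and> (i \<noteq> j \<longrightarrow> (B' *v x) $ i = 0)"
      using BV[of i] by (cases "i = j") auto
  qed
  have "x $ k \<in> \<int>" for k
  proof -
    let ?D = "det (\<chi> i l. if l = k then (if i = j then 1 else 0) else B' $ i $ l) :: real"
    let ?b = "(\<chi> i. if i = j then of_int M else 0) :: real^'k"
    have "?D \<in> \<int>" by (rule Ints_det) (use B' in \<open>auto simp: int_mat_def\<close>)
    then obtain n where n: "?D = of_int n" by (auto elim: Ints_cases)
    have "x = (\<chi> k. det (\<chi> i l. if l = k then ?b $ i else B' $ i $ l) / det B')"
      using cramer[OF d, of x ?b] Bx by simp
    then have "x $ k = det (\<chi> i l. if l = k then ?b $ i else B' $ i $ l) / det B'"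
      by (metis (no_types, lifting) vec_lambda_beta)
    also have "det (\<chi> i l. if l = k then ?b $ i else B' $ i $ l) = of_int M * ?D"
    proof -
      let ?X = "(\<chi> i l. if l = k then ?b $ i else B' $ i $ l) :: real^'k^'k"
      let ?Y = "(\<chi> i l. if l = k then (if i = j then 1 else 0) else B' $ i $ l) :: real^'k^'k"
      have X: "transpose ?X = (\<chi> l. if l = k then of_int M *s (\<chi> i. if i = j then 1 else 0) else (\<chi> i. B' $ i $ l))"
        by (auto simp: transpose_def vec_eq_iff)
      have Y: "transpose ?Y = (\<chi> l. if l = k then (\<chi> i. if i = j then 1 else 0) else (\<chi> i. B' $ i $ l))"
        by (auto simp: transpose_def vec_eq_iff)
      have "det ?X = det (transpose ?X)" by (simp only: det_transpose)
      also have "\<dots> = of_int M * det (transpose ?Y)"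
        unfolding X Y by (rule det_row_mul)
      also have "\<dots> = of_int M * det ?Y" by (simp only: det_transpose)
      finally show ?thesis .
    qed
    also have "of_int M * ?D / det B' = of_int (e * n)"
      using M d n by (simp add: field_simps)
    finally show ?thesis by simp
  qed
  then have "\<forall>k. \<exists>a. x $ k = of_int a" by (blast elim: Ints_cases)
  then obtain u where "\<And>k. x $ k = of_int (u k)" by metis
  then have u: "x = int_vec (\<chi> k. u k)" by (simp add: vec_eq_iff)
  have "\<exists>w::int. (B' *v int_vec (\<chi> k. u k)) $ i = of_int M * of_int w" for i
    unfolding u[symmetric] Bx by (auto intro: exI[of _ 1] exI[of _ 0])
  then obtain w :: int where w: "(B *v int_vec (\<chi> k. u k)) $ i = of_int M * of_int w"
    using code by blast
  have "(B *v x) $ i = (B ** V) $ i $ j * of_int M"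
    by (simp add: x_def matrix_vector_mult_def matrix_matrix_mult_def sum_distrib_right mult.assoc)
  then have "(B ** V) $ i $ j = of_int w" using w M u by simp
  then show "(B ** V) $ i $ j \<in> \<int>" by simp
qed

text \<open>For a kernel vector x, the row belonging to a coordinate of maximal modulus gives t
  |x_i| <= k D |x_i|, where k is the dimension.\<close>

lemma det_diagonal_dominant:
  fixes W :: "real^'k::finite^'k"
  assumes W: "\<And>i j. \<bar>W $ i $ j - (if i = j then t else 0)\<bar> \<le> D" and t: "t > real CARD('k) * D"
  shows "det W \<noteq> 0"
proof -
  have "x = 0" if x: "W *v x = 0" for x
  proof (rule ccontr)
    assume nz: "x \<noteq> 0"
    obtain i where i: "\<And>j. \<bar>x $ j\<bar> \<le> \<bar>x $ i\<bar>"
    proof -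
      have "Max (range (\<lambda>j. \<bar>x $ j\<bar>)) \<in> range (\<lambda>j. \<bar>x $ j\<bar>)" by (intro Max_in) auto
      then obtain i where "Max (range (\<lambda>j. \<bar>x $ j\<bar>)) = \<bar>x $ i\<bar>" by blast
      moreover have "\<bar>x $ j\<bar> \<le> Max (range (\<lambda>j. \<bar>x $ j\<bar>))" for j by (intro Max_ge) auto
      ultimately show ?thesis using that by metis
    qed
    have xi: "\<bar>x $ i\<bar> > 0"
    proof (rule ccontr)
      assume "\<not> ?thesis"
      then have "x $ j = 0" for j using i[of j] by auto
      then show False using nz by (simp add: vec_eq_iff)
    qed
    have "0 = (\<Sum>j\<in>UNIV. W $ i $ j * x $ j)"
      using arg_cong[OF x, of "\<lambda>v. v $ i"] by (simp add: matrix_vector_mult_def)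
    also have "\<dots> = (\<Sum>j\<in>UNIV. (W $ i $ j - (if i = j then t else 0)) * x $ j) + t * x $ i"
      by (simp add: left_diff_distrib sum_subtractf if_distrib[of "\<lambda>a. a * _"] cong: if_cong)
    finally have "\<bar>t * x $ i\<bar> = \<bar>\<Sum>j\<in>UNIV. (W $ i $ j - (if i = j then t else 0)) * x $ j\<bar>"
      by linarith
    also have "\<dots> \<le> (\<Sum>j\<in>(UNIV::'k set). D * \<bar>x $ i\<bar>)"
    proof (intro order_trans[OF sum_abs] sum_mono)
      fix j
      show "\<bar>(W $ i $ j - (if i = j then t else 0)) * x $ j\<bar> \<le> D * \<bar>x $ i\<bar>"
        unfolding abs_mult by (rule mult_mono[OF W i]) (use order_trans[OF abs_ge_zero W] in auto)
    qed
    also have "\<dots> = real CARD('k) * D * \<bar>x $ i\<bar>" by simp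
    also have "\<dots> < t * \<bar>x $ i\<bar>" using t xi by simp
    also have "\<dots> \<le> \<bar>t * x $ i\<bar>" by (simp add: abs_mult mult_right_mono)
    finally show False by simp
  qed
  then have "inj ((*v) W)"
    by (metis (no_types, lifting) injI matrix_vector_mult_diff_distrib eq_iff_diff_eq_0)
  then show ?thesis
    using det_nz_iff_inj[OF matrix_vector_mul_linear[of W]] by (simp add: matrix_of_matrix_vector_mul)
qed

lemma abs_det_le:
  fixes W :: "real^'k::finite^'k"
  assumes "\<And>i j. \<bar>W $ i $ j\<bar> \<le> b"
  shows "\<bar>det W\<bar> \<le> fact CARD('k) * b ^ CARD('k)"
proof -
  have "\<bar>det W\<bar> \<le> (\<Sum>p\<in>{p. p permutes (UNIV::'k set)}. b ^ CARD('k))"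
    unfolding det_def
  proof (intro order_trans[OF sum_abs] sum_mono)
    fix p
    have "\<bar>of_int (sign p) * (\<Prod>i\<in>UNIV. W $ i $ p i)\<bar> = (\<Prod>i\<in>UNIV. \<bar>W $ i $ p i\<bar>)"
      by (simp add: abs_mult abs_prod sign_def)
    also have "\<dots> \<le> (\<Prod>i\<in>(UNIV::'k set). b)"
      by (intro prod_mono) (use assms in auto)
    finally show "\<bar>of_int (sign p) * (\<Prod>i\<in>UNIV. W $ i $ p i)\<bar> \<le> b ^ CARD('k)" by simp
  qed
  then show ?thesis by (simp add: card_permutations[OF refl])
qed

lemma norm_matrix_le: "norm (A :: real^'n::finite^'m::finite) \<le> (\<Sum>i\<in>UNIV. \<Sum>j\<in>UNIV. \<bar>A $ i $ j\<bar>)"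
proof -
  have "norm A \<le> (\<Sum>i\<in>UNIV. norm (A $ i))" unfolding norm_vec_def by (rule L2_set_le_sum) auto
  also have "\<dots> \<le> (\<Sum>i\<in>UNIV. \<Sum>j\<in>UNIV. \<bar>A $ i $ j\<bar>)" by (intro sum_mono norm_le_l1_cart)
  finally show ?thesis .
qed

lemma matrix_inv_mult:
  fixes A :: "real^'k::finite^'k"
  assumes "det A \<noteq> 0"
  shows "A ** matrix_inv A = mat 1" "matrix_inv A ** A = mat 1"
  using assms someI_ex[of "\<lambda>A'. A ** A' = mat 1 \<and> A' ** A = mat 1"]
  unfolding invertible_det_nz[symmetric] invertible_def matrix_inv_def by auto

text \<open>The matrix whose columns are lattice vectors close to \<open>t e\<^sub>j\<close> spans a sublattice of index at most
  \<open>b\<close>. Only finitely many lattices contain it with such an index, and \<open>code\<close> tells them apart.\<close>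

lemma reduction:
  assumes D: "D \<ge> 0"
  shows "\<exists>C. \<forall>g::real^'k::finite^'k. det g = 1 \<longrightarrow>
    (\<forall>x. \<exists>z. \<forall>i. \<bar>(x - g *v int_vec z) $ i\<bar> \<le> D) \<longrightarrow> (\<exists>h\<in>SL_int. norm (g ** h) \<le> C)"
proof -
  \<comment> \<open>The matrix of lattice vectors within D of the t e_j is invertible because t > k
    D, its entries are at most t + D, so its determinant is at most b in modulus. As an integer it
    divides M, the factorial of the integer part of b.\<close>
  define t where "t = real CARD('k) * D + 1"
  define b where "b = fact CARD('k) * (t + D) ^ CARD('k)"
  define m where "m = nat \<lfloor>b\<rfloor>"
  define M where "M = (fact m :: int)"
  have t0: "t \<ge> 0" using D by (simp add: t_def)
  have Mpos: "M > 0" by (simp add: M_def)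
  define box where "box = {u :: int^'k. \<forall>i. u $ i \<in> {0..<M}}"
  define P where "P B u \<longleftrightarrow> (\<forall>i. \<exists>w::int. (B *v int_vec u) $ i = of_int M * of_int w)" for B :: "real^'k^'k" and u
  \<comment> \<open>For \<open>good\<close> B the integer vectors with \<open>P B u\<close> form the
    lattice M B^(-1) Z^k. It contains M Z^k, so its part in \<open>box\<close> determines it. Equal
    codes therefore give B = h B' with h integral and invertible over the integers, and equal signs
    of the determinants make det h = 1.\<close>
  define code where "code B = ({u \<in> box. P B u}, det B > 0)" for B :: "real^'k^'k"
  have finbox: "finite box"
  proof -
    have "box \<subseteq> vec_lambda ` (UNIV \<rightarrow>\<^sub>E {0..<M})"
    proof
      fix u assume "u \<in> box"
      then have "vec_nth u \<in> UNIV \<rightarrow>\<^sub>E {0..<M}" by (auto simp: box_def)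
      then show "u \<in> vec_lambda ` (UNIV \<rightarrow>\<^sub>E {0..<M})" by (metis image_eqI vec_nth_inverse)
    qed
    then show ?thesis by (rule finite_subset) (simp add: finite_PiE)
  qed
  define good where "good B \<longleftrightarrow> int_mat B \<and> det B \<noteq> 0 \<and> \<bar>det B\<bar> \<le> b" for B :: "real^'k^'k"
  have dvd: "\<exists>e. det B * of_int e = of_int M" if g: "good B" for B
  proof -
    obtain n where n: "det B = of_int n" using g Ints_det[of B] unfolding good_def by (blast elim: Ints_cases)
    have "n \<noteq> 0" "\<bar>n\<bar> \<le> int m" using g n unfolding good_def m_def by (auto simp: le_floor_iff nat_le_iff le_nat_iff)
    then have "nat \<bar>n\<bar> dvd fact m" by (intro dvd_fact) (auto simp: nat_le_iff)
    then have "n dvd M" unfolding M_def by (metis abs_dvd_iff int_dvd_int_iff nat_0_le abs_ge_zero of_nat_fact)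
    then obtain e where "M = n * e" by (elim dvdE)
    then show ?thesis by (intro exI[of _ e]) (simp add: n)
  qed
  have Pcode: "P B u" if g: "good B" "good B'" and c: "code B = code B'" and P': "P B' u" for B B' u
  proof -
    define v :: "int^'k" where "v = (\<chi> i. u $ i mod M)"
    have Pshift: "P B u \<longleftrightarrow> P B v" if "int_mat B" for B
    proof -
      have "\<exists>w::int. (B *v int_vec u) $ i = (B *v int_vec v) $ i + of_int M * of_int w" for i
      proof -
        have "(B *v int_vec u) $ i - (B *v int_vec v) $ i = (\<Sum>j\<in>UNIV. B $ i $ j * of_int (u $ j - u $ j mod M))"
          by (simp add: matrix_vector_mult_def v_def sum_subtractf right_diff_distrib)
        also have "\<dots> = of_int M * (\<Sum>j\<in>UNIV. B $ i $ j * of_int (u $ j div M))"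
          by (simp add: sum_distrib_left minus_mod_eq_mult_div mult_ac)
        finally have "(B *v int_vec u) $ i - (B *v int_vec v) $ i = of_int M * (\<Sum>j\<in>UNIV. B $ i $ j * of_int (u $ j div M))" .
        moreover
        have "(\<Sum>j\<in>UNIV. B $ i $ j * of_int (u $ j div M)) \<in> \<int>"
          using that unfolding int_mat_def by (intro Ints_sum Ints_mult) auto
        then obtain c :: int where "(\<Sum>j\<in>UNIV. B $ i $ j * of_int (u $ j div M)) = of_int c"
          by (blast elim: Ints_cases)
        with calculation have "(B *v int_vec u) $ i = (B *v int_vec v) $ i + of_int M * of_int c"
          by (metis add.commute diff_eq_eq)
        then show ?thesis by blast
      qed
      then obtain w where w: "\<And>i. (B *v int_vec u) $ i = (B *v int_vec v) $ i + of_int M * of_int (w i :: int)"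
        by metis
      have "(\<exists>x::int. (B *v int_vec u) $ i = of_int M * of_int x) \<longleftrightarrow> (\<exists>x::int. (B *v int_vec v) $ i = of_int M * of_int x)" for i
      proof
        assume "\<exists>x::int. (B *v int_vec u) $ i = of_int M * of_int x"
        then obtain x :: int where "(B *v int_vec u) $ i = of_int M * of_int x" ..
        then have "(B *v int_vec v) $ i = of_int M * of_int (x - w i)" using w[of i] by (simp add: algebra_simps)
        then show "\<exists>x::int. (B *v int_vec v) $ i = of_int M * of_int x" by blast
      next
        assume "\<exists>x::int. (B *v int_vec v) $ i = of_int M * of_int x"
        then obtain x :: int where "(B *v int_vec v) $ i = of_int M * of_int x" ..
        then have "(B *v int_vec u) $ i = of_int M * of_int (x + w i)" using w[of i] by (simp add: algebra_simps)
        then show "\<exists>x::int. (B *v int_vec u) $ i = of_int M * of_int x" by blast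
      qed
      then show ?thesis by (simp add: P_def)
    qed
    have "v \<in> box" using Mpos by (simp add: box_def v_def)
    moreover have "P B' v" using Pshift[of B'] g P' by (simp add: good_def)
    ultimately have "v \<in> fst (code B')" by (simp add: code_def)
    then have "P B v" using c unfolding code_def by auto
    then show ?thesis using Pshift[of B] g by (simp add: good_def)
  qed
  define rep where "rep c = (SOME B. good B \<and> code B = c)" for c
  have rep: "good (rep (code B)) \<and> code (rep (code B)) = code B" if "good B" for B
    unfolding rep_def using that by (rule_tac someI[where x = B]) auto
  \<comment> \<open>Bounds the norm of W B'^(-1) for every W with entries at most t + D, where B'
    represents the code c. There are finitely many codes, so the sum of all these values is a
    constant independent of g.\<close>
  define val where "val c = (\<Sum>i\<in>(UNIV::'k set). \<Sum>j\<in>UNIV. \<Sum>k\<in>UNIV. (t + D) * \<bar>matrix_inv (rep c) $ k $ j\<bar>)" for c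
  have fincodes: "finite (code ` Collect good)"
  proof (rule finite_subset)
    show "code ` Collect good \<subseteq> Pow box \<times> UNIV" by (auto simp: code_def)
    show "finite (Pow box \<times> (UNIV::bool set))" using finbox by simp
  qed
  define C where "C = (\<Sum>c\<in>code ` Collect good. val c)"
  have val0: "val c \<ge> 0" for c
    unfolding val_def using t0 D by (intro sum_nonneg) auto
  have "\<exists>h\<in>SL_int. norm (g ** h) \<le> C" if dg: "det g = 1" and cov: "\<forall>x. \<exists>z. \<forall>i. \<bar>(x - g *v int_vec z) $ i\<bar> \<le> D"
    for g :: "real^'k^'k"
  proof -
    obtain z where z: "\<And>x i. \<bar>(x - g *v int_vec (z x)) $ i\<bar> \<le> D" using cov by metis
    define B :: "real^'k^'k" where "B = (\<chi> i j. of_int (z (t *\<^sub>R axis j 1) $ i))"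
    define W where "W = g ** B"
    have Wd: "\<bar>W $ i $ j - (if i = j then t else 0)\<bar> \<le> D" for i j
    proof -
      have "W $ i $ j = (g *v int_vec (z (t *\<^sub>R axis j 1))) $ i"
        by (simp add: W_def B_def matrix_matrix_mult_def matrix_vector_mult_def)
      moreover have "(t *\<^sub>R axis j 1) $ i = (if i = j then t else 0)" by (simp add: axis_def)
      ultimately show ?thesis
        using z[of "t *\<^sub>R axis j 1" i] by (simp only: vector_minus_component abs_minus_commute)
    qed
    have Wb: "\<bar>W $ i $ j\<bar> \<le> t + D" for i j
      using Wd[of i j] t0 by (auto split: if_splits)
    have dW: "det W = det B" by (simp add: W_def det_mul dg)
    have gB: "good B"
      unfolding good_def b_def
      using det_diagonal_dominant[OF Wd] abs_det_le[OF Wb] dW by (auto simp: int_mat_def B_def t_def)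
    define B' where "B' = rep (code B)"
    have gB': "good B'" and cB': "code B' = code B" using rep[OF gB] by (auto simp: B'_def)
    define V where "V = matrix_inv B'"
    have V: "B' ** V = mat 1" "V ** B' = mat 1"
      using gB' matrix_inv_mult[of B'] unfolding good_def V_def by auto
    define V2 where "V2 = matrix_inv B"
    have V2: "B ** V2 = mat 1" "V2 ** B = mat 1"
      using gB matrix_inv_mult[of B] unfolding good_def V2_def by auto
    define h where "h = B ** V"
    have ih: "int_mat h"
    proof -
      obtain e where "det B' * of_int e = of_int M" using dvd[OF gB'] ..
      then show ?thesis unfolding h_def
        by (rule int_mat_mult_inverse[rotated 4])
          (use gB gB' V Mpos Pcode[OF gB gB' cB'[symmetric]] in \<open>auto simp: good_def P_def\<close>)
    qed
    have ih': "int_mat (B' ** V2)"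
    proof -
      obtain e where "det B * of_int e = of_int M" using dvd[OF gB] ..
      then show ?thesis
        by (rule int_mat_mult_inverse[rotated 4])
          (use gB gB' V2 Mpos Pcode[OF gB' gB cB'] in \<open>auto simp: good_def P_def\<close>)
    qed
    have "det h = 1"
    proof -
      have 1: "det B' * det V = 1" "det B * det V2 = 1"
        using arg_cong[OF V(1), of det] arg_cong[OF V2(1), of det] by (simp_all add: det_mul det_I)
      obtain p q where p: "det h = of_int p" and q: "det (B' ** V2) = of_int q"
        using Ints_det[OF ih] Ints_det[OF ih'] by (blast elim: Ints_cases)
      have "det h * det (B' ** V2) = (det B' * det V) * (det B * det V2)"
        by (simp add: h_def det_mul)
      also have "\<dots> = 1" by (simp only: 1 mult_1)
      finally have "p * q = 1" using p q by (metis of_int_1 of_int_eq_iff of_int_mult)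
      then have "p = 1 \<or> p = -1" using zmult_eq_1_iff[of p q] by blast
      moreover have "det h > 0"
      proof -
        have "(det B > 0) = (det B' > 0)" using cB' by (simp add: code_def)
        moreover have "det V = 1 / det B'" using 1(1) gB' by (simp add: good_def field_simps)
        then have "det h = det B / det B'" by (simp add: h_def det_mul)
        ultimately show ?thesis
          using gB gB' unfolding good_def by (simp add: zero_less_divide_iff) linarith
      qed
      ultimately show ?thesis using p by auto
    qed
    then have "h \<in> SL_int" using ih by (simp add: SL_int_def SL_def int_mat_def)
    moreover have "norm (g ** h) \<le> C"
    proof -
      \<comment> \<open>g h = (g B) B'^(-1): a matrix with bounded entries times one of finitely
        many inverses.\<close>
      have eq: "g ** h = W ** V" by (simp add: h_def W_def matrix_mul_assoc)
      have "norm (W ** V) \<le> (\<Sum>i\<in>UNIV. \<Sum>j\<in>UNIV. \<bar>(W ** V) $ i $ j\<bar>)" by (rule norm_matrix_le)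
      also have "\<dots> \<le> (\<Sum>i\<in>(UNIV::'k set). \<Sum>j\<in>UNIV. \<Sum>k\<in>UNIV. (t + D) * \<bar>V $ k $ j\<bar>)"
      proof (intro sum_mono)
        fix i j
        have "\<bar>(W ** V) $ i $ j\<bar> \<le> (\<Sum>k\<in>UNIV. \<bar>W $ i $ k * V $ k $ j\<bar>)"
          by (simp add: matrix_matrix_mult_def)
        also have "\<dots> \<le> (\<Sum>k\<in>UNIV. (t + D) * \<bar>V $ k $ j\<bar>)"
          unfolding abs_mult by (intro sum_mono mult_right_mono Wb) auto
        finally show "\<bar>(W ** V) $ i $ j\<bar> \<le> (\<Sum>k\<in>UNIV. (t + D) * \<bar>V $ k $ j\<bar>)" .
      qed
      also have "\<dots> = val (code B)" by (simp add: val_def V_def B'_def)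
      also have "\<dots> \<le> C" unfolding C_def
        by (rule member_le_sum) (use gB fincodes val0 in auto)
      finally show ?thesis by (simp add: eq)
    qed
    ultimately show ?thesis by blast
  qed
  then show ?thesis by blast
qed

section \<open>The space of lattices and weak-\<open>*\<close> limits\<close>

lemma abs_entry_le_norm: "\<bar>(A :: real^'n::finite^'m::finite) $ i $ j\<bar> \<le> norm A"
proof -
  have "\<bar>A $ i $ j\<bar> \<le> norm (A $ i)" by (rule component_le_norm_cart)
  also have "\<dots> \<le> norm A" by (simp add: Finite_Cartesian_Product.norm_nth_le)
  finally show ?thesis .
qed

lemma norm_matrix_mult_le:
  fixes A B :: "real^'k::finite^'k"
  shows "norm (A ** B) \<le> real CARD('k) ^ 3 * norm A * norm B"
proof -
  have "norm (A ** B) \<le> (\<Sum>i\<in>UNIV. \<Sum>j\<in>UNIV. \<bar>(A ** B) $ i $ j\<bar>)" by (rule norm_matrix_le)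
  also have "\<dots> \<le> (\<Sum>i\<in>(UNIV::'k set). \<Sum>j\<in>(UNIV::'k set). real CARD('k) * (norm A * norm B))"
  proof (intro sum_mono)
    fix i j
    have "\<bar>(A ** B) $ i $ j\<bar> \<le> (\<Sum>k\<in>UNIV. \<bar>A $ i $ k\<bar> * \<bar>B $ k $ j\<bar>)"
      by (simp add: matrix_matrix_mult_def abs_mult[symmetric])
    also have "\<dots> \<le> (\<Sum>k\<in>(UNIV::'k set). norm A * norm B)"
      by (intro sum_mono mult_mono abs_entry_le_norm) auto
    finally show "\<bar>(A ** B) $ i $ j\<bar> \<le> real CARD('k) * (norm A * norm B)" by simp
  qed
  also have "\<dots> = real CARD('k) ^ 3 * norm A * norm B" by (simp add: power3_eq_cube)
  finally show ?thesis .
qed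

lemma SL_int_mult: "g \<in> SL_int \<Longrightarrow> h \<in> SL_int \<Longrightarrow> g ** h \<in> SL_int"
  unfolding SL_int_def SL_def
  by (simp add: det_mul) (simp add: matrix_matrix_mult_def Ints_sum Ints_mult)

lemma SL_int_inverse:
  assumes "g \<in> SL_int"
  shows "\<exists>h\<in>SL_int. g ** h = mat 1 \<and> h ** (g::real^'k::finite^'k) = mat 1"
proof -
  have d: "det g = 1" and i: "int_mat g" using assms by (auto simp: SL_int_def SL_def int_mat_def)
  then have V: "g ** matrix_inv g = mat 1" "matrix_inv g ** g = mat 1" using matrix_inv_mult[of g] by auto
  have "int_mat (mat 1 :: real^'k^'k)" by (simp add: int_mat_def mat_def)
  moreover have "\<exists>w::int. (mat 1 *v int_vec u) $ i = of_int 1 * of_int w" for u :: "int^'k" and i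
    by simp
  ultimately have "int_mat (mat 1 ** matrix_inv g)"
    using d by (intro int_mat_mult_inverse[OF _ i V(1), where M = 1 and e = 1]) auto
  then have "int_mat (matrix_inv g)" by simp
  moreover have "det (matrix_inv g) = 1" using arg_cong[OF V(1), of det] d by (simp add: det_mul)
  ultimately show ?thesis using V by (intro bexI[of _ "matrix_inv g"]) (auto simp: SL_int_def SL_def int_mat_def)
qed

lemma mat_1_SL_int: "mat 1 \<in> SL_int"
  unfolding SL_int_def SL_def by simp (simp add: mat_def)

lemma act_SL_int_absorb:
  assumes "h \<in> SL_int"
  shows "act (g ** h) SL_int = act (g::real^'k::finite^'k) SL_int"
proof -
  obtain k where k: "k \<in> SL_int" "h ** k = mat 1" using SL_int_inverse[OF assms] by blast
  show ?thesis unfolding act_def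
  proof (intro equalityI subsetI)
    fix x assume "x \<in> (**) (g ** h) ` SL_int"
    then obtain y where "y \<in> SL_int" "x = g ** (h ** y)" by (auto simp: matrix_mul_assoc)
    then show "x \<in> (**) g ` SL_int" using SL_int_mult[OF assms] by blast
  next
    fix x assume "x \<in> (**) g ` SL_int"
    then obtain y where y: "y \<in> SL_int" "x = g ** y" by blast
    then have "x = (g ** h) ** (k ** y)" by (metis k(2) matrix_mul_assoc matrix_mul_rid)
    then show "x \<in> (**) (g ** h) ` SL_int" using SL_int_mult[OF k(1) y(1)] by blast
  qed
qed

text \<open>The infimum of the norms of the representatives of a coset. It is continuous on the
  space of lattices and its sublevel sets are compact, so a large value means being far out in the
  cusp.\<close>

definition coset_norm :: "(real^'k::finite^'k) set \<Rightarrow> real" where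
  "coset_norm x = infdist 0 x"

lemma coset_norm_act_le: "h \<in> SL_int \<Longrightarrow> coset_norm (act g SL_int) \<le> norm (g ** h)"
  unfolding coset_norm_def act_def using infdist_le[of "g ** h" "(**) g ` SL_int" 0] by (simp add: dist_norm)

lemma coset_norm_act_greatest:
  assumes "\<And>h. h \<in> SL_int \<Longrightarrow> c \<le> norm (g ** h)"
  shows "c \<le> coset_norm (act g SL_int)"
proof -
  have "act g SL_int \<noteq> {}" using mat_1_SL_int by (auto simp: act_def)
  then show ?thesis unfolding coset_norm_def
    by (simp add: infdist_notempty) (intro cINF_greatest, auto simp: act_def dist_norm assms)
qed

lemma coset_norm_act_less:
  assumes "coset_norm (act g SL_int) < c"
  shows "\<exists>h\<in>SL_int. norm (g ** h) < c"
  using coset_norm_act_greatest[of c g] assms by (meson not_le)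

lemma coset_norm_nonneg: "coset_norm x \<ge> 0"
  unfolding coset_norm_def by (rule infdist_nonneg)

text \<open>From g h - g0 h = (g - g0) g0^(-1) (g0 h), passing from g0 to g changes the norms of all
  g0 h by a relative amount \<open>th g\<close> that does not depend on h. The infima over h
  therefore differ by the same relative amount, and \<open>th g\<close> tends to 0.\<close>

lemma continuous_on_coset_norm: "continuous_on SL (\<lambda>g::real^'k::finite^'k. coset_norm (act g SL_int))"
  unfolding continuous_on_def
proof
  fix g0 :: "real^'k^'k" assume g0: "g0 \<in> SL"
  define H where "H = matrix_inv g0"
  define K where "K = real CARD('k) ^ 3"
  define h0 where "h0 = coset_norm (act g0 SL_int)"
  define th where "th g = K * (K * norm (g - g0) * norm H)" for g
  have K: "K \<ge> 0" by (simp add: K_def)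
  have H: "H ** g0 = mat 1" using g0 matrix_inv_mult[of g0] by (simp add: H_def SL_def)
  have diff: "norm (g ** h - g0 ** h) \<le> th g * norm (g0 ** h)" for g h :: "real^'k^'k"
  proof -
    have "g ** h - g0 ** h = ((g - g0) ** H) ** (g0 ** h)"
    proof -
      have "((g - g0) ** H) ** (g0 ** h) = (g - g0) ** ((H ** g0) ** h)" by (simp add: matrix_mul_assoc)
      moreover have "(g - g0) ** h = g ** h - g0 ** h"
        by (simp add: matrix_matrix_mult_def vec_eq_iff left_diff_distrib sum_subtractf)
      ultimately show ?thesis by (simp add: H)
    qed
    then have "norm (g ** h - g0 ** h) \<le> K * norm ((g - g0) ** H) * norm (g0 ** h)"
      using norm_matrix_mult_le[of "(g - g0) ** H" "g0 ** h"] unfolding K_def by (simp only:)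
    also have "\<dots> \<le> K * (K * norm (g - g0) * norm H) * norm (g0 ** h)"
      using norm_matrix_mult_le[of "g - g0" H] K by (intro mult_right_mono mult_left_mono) (auto simp: K_def)
    finally show ?thesis by (simp add: th_def)
  qed
  have th0: "th g \<ge> 0" for g using K by (simp add: th_def)
  have upper: "coset_norm (act g SL_int) \<le> (1 + th g) * h0" for g
  proof -
    have "coset_norm (act g SL_int) / (1 + th g) \<le> h0" unfolding h0_def
    proof (rule coset_norm_act_greatest)
      fix h :: "real^'k^'k" assume h: "h \<in> SL_int"
      have "norm (g ** h) \<le> norm (g0 ** h) + norm (g ** h - g0 ** h)" by norm
      then have "coset_norm (act g SL_int) \<le> norm (g0 ** h) + th g * norm (g0 ** h)"
        using diff[of g h] coset_norm_act_le[OF h, of g] by linarith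
      then show "coset_norm (act g SL_int) / (1 + th g) \<le> norm (g0 ** h)"
        using th0[of g] by (simp add: field_simps)
    qed
    then show ?thesis using th0[of g] by (simp add: field_simps)
  qed
  have lower: "(1 - th g) * h0 \<le> coset_norm (act g SL_int)" for g
  proof (rule coset_norm_act_greatest)
    fix h :: "real^'k^'k" assume h: "h \<in> SL_int"
    show "(1 - th g) * h0 \<le> norm (g ** h)"
    proof (cases "th g \<le> 1")
      case True
      have "norm (g0 ** h) \<le> norm (g ** h) + norm (g ** h - g0 ** h)" by norm
      then have "(1 - th g) * norm (g0 ** h) \<le> norm (g ** h)" using diff[of g h] by (simp add: algebra_simps)
      moreover have "(1 - th g) * h0 \<le> (1 - th g) * norm (g0 ** h)"
        using True coset_norm_act_le[OF h, of g0] by (intro mult_left_mono) (auto simp: h0_def)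
      ultimately show ?thesis by linarith
    next
      \<comment> \<open>A nonpositive lower bound for a norm holds trivially.\<close>
      case False
      then have "(1 - th g) * h0 \<le> 0" using coset_norm_nonneg[of "act g0 SL_int"] by (intro mult_nonpos_nonneg) (auto simp: h0_def)
      then show ?thesis by (meson norm_ge_zero order_trans)
    qed
  qed
  have tht: "(th \<longlongrightarrow> 0) (at g0 within SL)"
    unfolding th_def by (rule tendsto_eq_intros refl | simp)+
  have up: "((\<lambda>g. (1 + th g) * h0) \<longlongrightarrow> h0) (at g0 within SL)"
    by (rule tendsto_eq_intros tht refl | simp)+
  have low: "((\<lambda>g. (1 - th g) * h0) \<longlongrightarrow> h0) (at g0 within SL)"
    by (rule tendsto_eq_intros tht refl | simp)+
  show "((\<lambda>g. coset_norm (act g SL_int)) \<longlongrightarrow> coset_norm (act g0 SL_int)) (at g0 within SL)"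
    unfolding h0_def[symmetric]
    by (rule tendsto_sandwich[OF _ _ low up]) (intro always_eventually allI lower upper)+
qed

lemma continuous_map_coset_norm: "continuous_map lattice_space euclideanreal (coset_norm :: (real^'k::finite^'k) set \<Rightarrow> real)"
proof -
  have "quotient_map (top_of_set SL) lattice_space (\<lambda>g::real^'k^'k. act g SL_int)"
    unfolding lattice_space_def by (rule quotient_map_quotient_topology)
  moreover have "continuous_map (top_of_set SL) euclideanreal (coset_norm \<circ> (\<lambda>g::real^'k^'k. act g SL_int))"
    using continuous_on_coset_norm by (simp add: o_def)
  ultimately show ?thesis by (metis continuous_compose_quotient_map)
qed

lemma topspace_lattice_space: "topspace lattice_space = (\<lambda>g. act g SL_int) ` SL"
  by (simp add: lattice_space_def topspace_quotient_topology)

text \<open>A closed subset of the image of the compact set of g in \<open>SL\<close> of norm at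
  most c + 1. The slack 1 produces a representative from the infimum without asking whether it is
  attained.\<close>

lemma compactin_coset_norm:
  "compactin lattice_space {x \<in> topspace lattice_space. coset_norm (x :: (real^'k::finite^'k) set) \<le> c}"
proof (rule closed_compactin)
  let ?S = "{g :: real^'k^'k. g \<in> SL \<and> norm g \<le> c + 1}"
  let ?q = "\<lambda>g::real^'k^'k. act g SL_int"
  have "closed (SL :: (real^'k^'k) set)"
  proof -
    have "continuous_on UNIV (det :: real^'k^'k \<Rightarrow> real)"
      unfolding det_def by (intro continuous_intros)
    then have "closed (det -` {1} :: (real^'k^'k) set)"
      by (intro closed_vimage) auto
    moreover have "det -` {1} = (SL :: (real^'k^'k) set)" by (auto simp: SL_def)
    ultimately show ?thesis by simp
  qed
  then have "closed (SL \<inter> cball 0 (c + 1) :: (real^'k^'k) set)" by (intro closed_Int) auto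
  moreover have "?S = SL \<inter> cball 0 (c + 1)" by auto
  moreover have "bounded (SL \<inter> cball 0 (c + 1) :: (real^'k^'k) set)"
    by (rule bounded_subset[OF bounded_cball]) blast
  ultimately have "compact ?S" by (simp only: compact_eq_bounded_closed)
  then have "compactin (top_of_set SL) ?S"
    by (auto simp: compactin_subtopology)
  moreover have "continuous_map (top_of_set SL) lattice_space ?q"
    unfolding lattice_space_def
    by (rule quotient_imp_continuous_map[OF quotient_map_quotient_topology])
  ultimately show "compactin lattice_space (?q ` ?S)" by (rule image_compactin)
  show "{x \<in> topspace lattice_space. coset_norm x \<le> c} \<subseteq> ?q ` ?S"
  proof
    fix x :: "(real^'k^'k) set" assume "x \<in> {x \<in> topspace lattice_space. coset_norm x \<le> c}"
    then obtain g where g: "g \<in> SL" "x = ?q g" and "coset_norm x \<le> c" by (auto simp: topspace_lattice_space)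
    then have "coset_norm (act g SL_int) < c + 1" by simp
    then obtain h where h: "h \<in> SL_int" "norm (g ** h) < c + 1" using coset_norm_act_less by blast
    have "g ** h \<in> SL" using g h by (simp add: SL_def SL_int_def det_mul)
    moreover have "x = ?q (g ** h)" unfolding g(2) act_SL_int_absorb[OF h(1)] ..
    moreover have "norm (g ** h) \<le> c + 1" using h(2) by simp
    ultimately show "x \<in> ?q ` ?S" by blast
  qed
  have "closedin lattice_space {x \<in> topspace lattice_space. coset_norm (x :: (real^'k^'k) set) \<in> {..c}}"
    by (rule closedin_continuous_map_preimage[OF continuous_map_coset_norm]) auto
  then show "closedin lattice_space {x \<in> topspace lattice_space. coset_norm (x :: (real^'k^'k) set) \<le> c}"
    by simp
qed

section \<open>Cutoff functions and the mass of limit measures\<close>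

lemma borel_measurable_borel_on:
  assumes "continuous_map X euclideanreal f"
  shows "f \<in> borel_measurable (borel_on X)"
proof (rule borel_measurableI)
  fix S :: "real set" assume "open S"
  then have "openin X {x \<in> topspace X. f x \<in> S}"
    using assms by (intro openin_continuous_map_preimage[of X euclideanreal]) (auto simp: open_openin[symmetric])
  moreover have "f -` S \<inter> space (borel_on X) = {x \<in> topspace X. f x \<in> S}" by auto
  ultimately show "f -` S \<inter> space (borel_on X) \<in> sets (borel_on X)"
    unfolding sets_borel_on by (simp add: sigma_sets.Basic)
qed

text \<open>A cutoff: 1 up to \<open>coset_norm\<close> c, 0 from c + 1 on, linear in
  between.\<close>

definition bump :: "real \<Rightarrow> (real^'k::finite^'k) set \<Rightarrow> real" where
  "bump c x = max 0 (min 1 (c + 1 - coset_norm x))"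

lemma bump_bounds: "0 \<le> bump c x" "bump c x \<le> 1"
  by (auto simp: bump_def)

lemma continuous_map_bump: "continuous_map lattice_space euclideanreal (bump c)"
  unfolding bump_def by (intro continuous_intros continuous_map_coset_norm continuous_map_real_max continuous_map_real_min continuous_map_diff) auto

lemma bump_compactly_supported: "bump c \<in> compactly_supported (lattice_space :: (real^'k::finite^'k) set topology)"
proof -
  let ?K = "{x \<in> topspace lattice_space. coset_norm (x :: (real^'k^'k) set) \<le> c + 1}"
  have "closedin lattice_space {x \<in> topspace lattice_space. coset_norm (x :: (real^'k^'k) set) \<in> {..c + 1}}"
    by (rule closedin_continuous_map_preimage[OF continuous_map_coset_norm]) auto
  then have cl: "closedin lattice_space ?K" by simp
  have "{x \<in> topspace lattice_space. bump c (x :: (real^'k^'k) set) \<noteq> 0} \<subseteq> ?K"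
    by (auto simp: bump_def max_def min_def split: if_splits)
  then have "lattice_space closure_of {x \<in> topspace lattice_space. bump c (x :: (real^'k^'k) set) \<noteq> 0} \<subseteq> ?K"
    using cl by (rule closure_of_minimal)
  then have "compactin lattice_space (lattice_space closure_of {x \<in> topspace lattice_space. bump c (x :: (real^'k^'k) set) \<noteq> 0})"
    by (rule closed_compactin[OF compactin_coset_norm]) (rule closedin_closure_of)
  then show ?thesis by (simp add: compactly_supported_def continuous_map_bump)
qed

text \<open>\<open>limit_point_of\<close> is tested on the subbasic neighbourhood of mu that belongs
  to the one function f.\<close>

lemma weak_star_limit_close:
  assumes lim: "limit_point_of (weak_star_topology X) nu mu F" and f: "f \<in> compactly_supported X" and e: "e > 0"
  shows "\<exists>\<^sub>F t in F. \<bar>(\<integral>x. f x \<partial>nu t) - (\<integral>x. f x \<partial>mu)\<bar> < e"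
proof -
  let ?P = "product_topology (\<lambda>_. euclideanreal) (compactly_supported X)"
  let ?ev = "\<lambda>mu. \<lambda>f\<in>compactly_supported X. \<integral>x. f x \<partial>mu"
  let ?V = "{h \<in> topspace ?P. h f \<in> ball (\<integral>x. f x \<partial>mu) e}"
  have "openin ?P ?V"
    by (rule openin_continuous_map_preimage[OF continuous_map_product_projection[OF f]]) (auto simp: open_openin[symmetric])
  then have "openin (weak_star_topology X) (?ev -` ?V \<inter> locally_finite_measures X)"
    unfolding weak_star_topology_def openin_pullback_topology by blast
  moreover have "mu \<in> ?ev -` ?V \<inter> locally_finite_measures X"
  proof
    have "mu \<in> topspace (weak_star_topology X)" using lim unfolding limit_point_of_def by (rule conjunct1)
    then show "mu \<in> locally_finite_measures X"
      unfolding weak_star_topology_def topspace_pullback_topology by (rule IntD2)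
    have "?ev mu f \<in> ball (\<integral>x. f x \<partial>mu) e" using f e by simp
    moreover have "?ev mu \<in> topspace ?P" unfolding topspace_product_topology by (simp add: restrict_PiE_iff)
    ultimately show "mu \<in> ?ev -` ?V" by blast
  qed
  moreover have lim': "\<exists>\<^sub>F t in F. nu t \<in> U" if "openin (weak_star_topology X) U" "mu \<in> U" for U
    using lim that unfolding limit_point_of_def by blast
  ultimately have "\<exists>\<^sub>F t in F. nu t \<in> ?ev -` ?V \<inter> locally_finite_measures X"
    by (intro lim')
  then show ?thesis
  proof (rule frequently_elim1)
    fix t assume "nu t \<in> ?ev -` ?V \<inter> locally_finite_measures X"
    then have "?ev (nu t) f \<in> ball (\<integral>x. f x \<partial>mu) e" by blast
    then have "dist (\<integral>x. f x \<partial>mu) (\<integral>x. f x \<partial>nu t) < e" using f by simp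
    then show "\<bar>(\<integral>x. f x \<partial>nu t) - (\<integral>x. f x \<partial>mu)\<bar> < e" by (simp only: dist_real_def abs_minus_commute)
  qed
qed

lemma orbit_average_properties:
  assumes phi: "phi \<in> borel \<rightarrow>\<^sub>M borel_on X" and T: "T > 0"
  shows "prob_space (orbit_average X phi T)" "sets (orbit_average X phi T) = sets (borel_on X)"
proof -
  let ?u = "uniform_measure lborel {0..T}"
  have m: "(\<lambda>t. return (borel_on X) (phi t)) \<in> ?u \<rightarrow>\<^sub>M subprob_algebra (borel_on X)"
    using measurable_compose[OF phi return_measurable]
    by (simp add: measurable_cong_sets[of ?u borel])
  show s: "sets (orbit_average X phi T) = sets (borel_on X)"
    unfolding orbit_average_def by (rule sets_bind[OF sets_kernel[OF m]]) auto
  have sp: "space (orbit_average X phi T) = topspace X"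
    using sets_eq_imp_space_eq[OF s] by simp
  have "phi t \<in> topspace X" for t using measurable_space[OF phi, of t] by simp
  then have "emeasure (return (borel_on X) (phi t)) (topspace X) = 1" for t
    by (subst emeasure_return) (auto simp: sets.top[of "borel_on X", simplified])
  then have "emeasure (orbit_average X phi T) (topspace X) = (\<integral>\<^sup>+t\<in>{0..T}. 1 \<partial>lborel) / ennreal T"
    using emeasure_orbit_average[OF phi T, of "topspace X"] sets.top[of "borel_on X"] by simp
  also have "\<dots> = 1" using T by (simp add: ennreal_divide_self)
  finally show "prob_space (orbit_average X phi T)" by (intro prob_spaceI) (simp add: sp)
qed

text \<open>Against \<open>bump c\<close> every average has integral at most 1 and, by
  \<open>tight\<close>, at least 1 - e for suitable c and all large T. Both bounds pass to mu,
  because an approximation that occurs frequently meets a bound that holds eventually. Letting c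
  grow bounds the mass of mu by 1; the second bound excludes escape of mass.\<close>

lemma prob_space_limit_point:
  fixes phi :: "real \<Rightarrow> (real^'k::finite^'k) set"
  assumes cont: "continuous_map euclideanreal lattice_space phi"
    and tight: "\<And>e. e > 0 \<Longrightarrow> \<exists>c. \<forall>\<^sub>F T in at_top. measure lborel {t \<in> {0..T}. coset_norm (phi t) > c} \<le> e * T"
    and lim: "limit_point_of (weak_star_topology lattice_space) (orbit_average lattice_space phi) mu at_top"
  shows "prob_space mu"
proof -
  let ?X = "lattice_space :: (real^'k^'k) set topology"
  let ?nu = "orbit_average lattice_space phi"
  have phi: "phi \<in> borel \<rightarrow>\<^sub>M borel_on ?X" by (rule measurable_borel_on[OF cont])
  have "mu \<in> locally_finite_measures ?X"
    using lim unfolding limit_point_of_def weak_star_topology_def topspace_pullback_topology by simp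
  then have sets_mu: "sets mu = sets (borel_on ?X)" and fin: "\<And>K. compactin ?X K \<Longrightarrow> emeasure mu K < \<infinity>"
    by (auto simp: locally_finite_measures_def)
  have sp: "space mu = topspace ?X" using sets_eq_imp_space_eq[OF sets_mu] by simp
  have hm: "coset_norm \<in> borel_measurable (borel_on ?X)"
    by (rule borel_measurable_borel_on[OF continuous_map_coset_norm])
  have hm_mu [measurable]: "coset_norm \<in> borel_measurable mu"
    using hm by (simp add: measurable_cong_sets[OF sets_mu refl])
  have bm_mu [measurable]: "bump c \<in> borel_measurable mu" for c
    unfolding bump_def by measurable
  define K where "K c = {x \<in> space mu. coset_norm x \<le> c}" for c
  have Kset [measurable]: "K c \<in> sets mu" for c unfolding K_def by measurable
  have Kfin: "emeasure mu (K c) < \<infinity>" for c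
    unfolding K_def sp by (rule fin[OF compactin_coset_norm])
  have int_bump: "integrable mu (bump c)" for c
  proof (rule Bochner_Integration.integrable_bound)
    show "integrable mu (indicator (K (c + 1)) :: _ \<Rightarrow> real)"
      using Kfin by (simp add: integrable_indicator_iff less_top)
    show "AE x in mu. norm (bump c x) \<le> norm (indicator (K (c + 1)) x :: real)"
      by (rule AE_I2) (auto simp: K_def bump_def indicator_def)
  qed simp
  have nu_le: "(\<integral>x. bump c x \<partial>?nu T) \<le> 1" if "T > 0" for c T
  proof -
    interpret prob_space "?nu T" by (rule orbit_average_properties(1)[OF phi that])
    have m: "bump c \<in> borel_measurable (?nu T)"
      unfolding measurable_cong_sets[OF orbit_average_properties(2)[OF phi that] refl]
      by (rule borel_measurable_borel_on[OF continuous_map_bump])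
    have "integrable (?nu T) (bump c)"
      by (rule integrable_const_bound[of _ 1]) (use m in \<open>auto simp: bump_bounds abs_of_nonneg intro!: AE_I2\<close>)
    then show ?thesis
      by (rule integral_le_const) (auto simp: bump_bounds intro!: AE_I2)
  qed
  have bump_le: "(\<integral>x. bump c x \<partial>mu) \<le> 1" for c
  proof (rule ccontr)
    assume "\<not> ?thesis"
    then have "(\<integral>x. bump c x \<partial>mu) - 1 > 0" by simp
    from weak_star_limit_close[OF lim bump_compactly_supported this]
    have "\<exists>\<^sub>F T in at_top. \<bar>(\<integral>x. bump c x \<partial>?nu T) - (\<integral>x. bump c x \<partial>mu)\<bar> < (\<integral>x. bump c x \<partial>mu) - 1" .
    moreover have "\<forall>\<^sub>F T in at_top. \<not> \<bar>(\<integral>x. bump c x \<partial>?nu T) - (\<integral>x. bump c x \<partial>mu)\<bar> < (\<integral>x. bump c x \<partial>mu) - 1"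
      using eventually_gt_at_top[of 0] by eventually_elim (use nu_le in \<open>smt (verit)\<close>)
    ultimately show False by (simp add: frequently_def)
  qed
  have K_le: "emeasure mu (K c) \<le> 1" for c
  proof -
    have "emeasure mu (K c) = ennreal (\<integral>x. indicator (K c) x \<partial>mu)"
      using Kfin[of c] by (simp add: emeasure_eq_ennreal_measure less_top)
    also have "\<dots> \<le> ennreal (\<integral>x. bump c x \<partial>mu)"
    proof (intro ennreal_leI integral_mono[OF _ int_bump])
      show "integrable mu (indicator (K c) :: _ \<Rightarrow> real)"
        using Kfin by (simp add: integrable_indicator_iff less_top)
    qed (auto simp: K_def bump_def indicator_def)
    also have "\<dots> \<le> 1" using bump_le by simp
    finally show ?thesis .
  qed
  \<comment> \<open>The sets \<open>K n\<close> exhaust the space. So far mu is known only to be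
    locally finite; this bound makes constants integrable.\<close>
  have "emeasure mu (space mu) \<le> 1"
  proof -
    have "space mu = (\<Union>n. K (real n))"
      unfolding K_def using real_arch_simple by blast
    moreover have "incseq (\<lambda>n. K (real n))"
      unfolding incseq_def K_def by (auto intro: order_trans)
    moreover have "range (\<lambda>n. K (real n)) \<subseteq> sets mu" using Kset by blast
    ultimately have "emeasure mu (space mu) = (SUP n. emeasure mu (K (real n)))"
      using SUP_emeasure_incseq[of "\<lambda>n. K (real n)" mu] by simp
    also have "\<dots> \<le> 1" by (rule SUP_least) (rule K_le)
    finally show ?thesis .
  qed
  then interpret finite_measure mu by (intro finite_measureI) (auto simp: top_unique)
  have ge: "measure mu (space mu) \<ge> 1 - e" if e: "e > 0" for e
  proof -
    obtain c where c: "\<forall>\<^sub>F T in at_top. measure lborel {t \<in> {0..T}. coset_norm (phi t) > c} \<le> e * T"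
      using tight[OF e] by blast
    have nu_ge: "(\<integral>x. bump c x \<partial>?nu T) \<ge> 1 - e"
      if T: "T > 0" and b: "measure lborel {t \<in> {0..T}. coset_norm (phi t) > c} \<le> e * T" for T
    proof -
      interpret N: prob_space "?nu T" by (rule orbit_average_properties(1)[OF phi T])
      note sN = orbit_average_properties(2)[OF phi T]
      have m: "bump c \<in> borel_measurable (?nu T)"
        unfolding measurable_cong_sets[OF sN refl]
        by (rule borel_measurable_borel_on[OF continuous_map_bump])
      have ib: "integrable (?nu T) (bump c)"
        by (rule N.integrable_const_bound[of _ 1]) (use m in \<open>auto simp: bump_bounds abs_of_nonneg intro!: AE_I2\<close>)
      have spN: "space (?nu T) = topspace ?X" using sets_eq_imp_space_eq[OF sN] by simp
      let ?G = "{x \<in> topspace ?X. coset_norm x > c}"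
      have G: "?G \<in> sets (borel_on ?X)"
        using measurable_sets[OF hm, of "{c<..}"] by (simp add: vimage_def Int_def conj_commute)
      have hphi [measurable]: "(\<lambda>t. coset_norm (phi t)) \<in> borel_measurable borel"
        using measurable_compose[OF phi hm] .
      have sub: "{t \<in> {0..T}. coset_norm (phi t) > c} \<subseteq> {0..T}" by auto
      have fin: "emeasure lborel {t \<in> {0..T}. coset_norm (phi t) > c} < \<infinity>"
        using emeasure_mono[OF sub, of lborel] T by (simp add: le_less_trans)
      have "emeasure (?nu T) ?G = (\<integral>\<^sup>+t\<in>{0..T}. emeasure (return (borel_on ?X) (phi t)) ?G \<partial>lborel) / ennreal T"
        by (rule emeasure_orbit_average[OF phi T G])
      also have "(\<integral>\<^sup>+t\<in>{0..T}. emeasure (return (borel_on ?X) (phi t)) ?G \<partial>lborel)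
         = (\<integral>\<^sup>+t. indicator {t \<in> {0..T}. coset_norm (phi t) > c} t \<partial>lborel)"
      proof (rule nn_integral_cong)
        fix t
        have "phi t \<in> topspace ?X" using measurable_space[OF phi, of t] by simp
        then show "emeasure (return (borel_on ?X) (phi t)) ?G * indicator {0..T} t = indicator {t \<in> {0..T}. coset_norm (phi t) > c} t"
          using G by (auto simp: emeasure_return indicator_def)
      qed
      also have "\<dots> = emeasure lborel {t \<in> {0..T}. coset_norm (phi t) > c}"
        by (rule nn_integral_indicator) measurable
      also have "\<dots> = ennreal (measure lborel {t \<in> {0..T}. coset_norm (phi t) > c})"
        using fin by (simp add: emeasure_eq_ennreal_measure less_top)
      also have "\<dots> / ennreal T = ennreal (measure lborel {t \<in> {0..T}. coset_norm (phi t) > c} / T)"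
        using T by (simp add: divide_ennreal)
      also have "\<dots> \<le> ennreal e" using b T by (intro ennreal_leI) (simp add: field_simps)
      finally have Ge: "measure (?nu T) ?G \<le> e"
        using that e by (simp add: N.emeasure_eq_measure)
      have "1 - e \<le> measure (?nu T) (space (?nu T) - ?G)"
        using Ge G sN by (subst N.prob_compl) auto
      also have "\<dots> = (\<integral>x. indicator (space (?nu T) - ?G) x \<partial>?nu T)"
        by (simp add: Int_absorb2 Diff_subset)
      also have "\<dots> \<le> (\<integral>x. bump c x \<partial>?nu T)"
      proof (rule integral_mono[OF _ ib])
        have "space (?nu T) - ?G \<in> sets (?nu T)" using G sN by (auto intro: sets.compl_sets)
        then show "integrable (?nu T) (indicator (space (?nu T) - ?G) :: _ \<Rightarrow> real)"
          by (simp add: integrable_indicator_iff N.emeasure_eq_measure)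
      qed (auto simp: spN bump_def indicator_def)
      finally show ?thesis .
    qed
    have "(\<integral>x. bump c x \<partial>mu) \<ge> 1 - e"
    proof (rule ccontr)
      assume "\<not> ?thesis"
      then have "1 - e - (\<integral>x. bump c x \<partial>mu) > 0" by simp
      from weak_star_limit_close[OF lim bump_compactly_supported this]
      have "\<exists>\<^sub>F T in at_top. \<bar>(\<integral>x. bump c x \<partial>?nu T) - (\<integral>x. bump c x \<partial>mu)\<bar> < 1 - e - (\<integral>x. bump c x \<partial>mu)" .
      moreover have "\<forall>\<^sub>F T in at_top. \<not> \<bar>(\<integral>x. bump c x \<partial>?nu T) - (\<integral>x. bump c x \<partial>mu)\<bar> < 1 - e - (\<integral>x. bump c x \<partial>mu)"
        using eventually_gt_at_top[of 0] c by eventually_elim (use nu_ge in \<open>smt (verit)\<close>)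
      ultimately show False by (simp add: frequently_def)
    qed
    also have "(\<integral>x. bump c x \<partial>mu) \<le> (\<integral>x. 1 \<partial>mu)"
      by (rule integral_mono[OF int_bump]) (auto simp: bump_bounds)
    finally show ?thesis by simp
  qed
  have "measure mu (space mu) \<ge> 1"
    by (rule field_le_epsilon) (use ge in \<open>smt (verit)\<close>)
  moreover have "measure mu (space mu) \<le> 1"
    using \<open>emeasure mu (space mu) \<le> 1\<close> by (simp add: emeasure_eq_measure)
  ultimately show ?thesis
    by (intro prob_spaceI) (simp add: emeasure_eq_measure)
qed

section \<open>Counting lattice vectors\<close>

text \<open>Entry i of the vector L z = A q2 + p'. In z, the part p' occupies the indices
  \<open>None\<close> and \<open>Some (Inl k)\<close>, and q2 the indices
  \<open>Some (Inr j)\<close>.\<close>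

definition lin_form :: "real^'m::finite^('d::finite option) \<Rightarrow> int^('d + 'm) option \<Rightarrow> 'd option \<Rightarrow> real" where
  "lin_form A z i = (case i of None \<Rightarrow> of_int (z $ None) | Some k \<Rightarrow> of_int (z $ Some (Inl k)))
     + (\<Sum>j\<in>UNIV. A $ i $ j * of_int (z $ Some (Inr j)))"

text \<open>The first coordinate of u_y z, written as the pairing of (1, y) with L z. As a function
  of y it is affine, and the entries \<open>Some i\<close> of L z are its slopes.\<close>

definition aff_form :: "real^'m::finite^('d::finite option) \<Rightarrow> real^'d \<Rightarrow> int^('d + 'm) option \<Rightarrow> real" where
  "aff_form A y z = lin_form A z None + (\<Sum>i\<in>UNIV. y $ i * lin_form A z (Some i))"

lemma lin_form_diff: "lin_form A (z - w) i = lin_form A z i - lin_form A w i"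
  by (simp add: lin_form_def sum_subtractf right_diff_distrib split: option.split)

lemma lin_form_scale: "lin_form A (\<chi> i. k * z $ i) i = of_int k * lin_form A z i"
  by (simp add: lin_form_def sum_distrib_left algebra_simps split: option.split)

lemma aff_form_scale: "aff_form A y (\<chi> i. k * z $ i) = of_int k * aff_form A y z"
  by (simp add: aff_form_def lin_form_scale sum_distrib_left algebra_simps)

lemma lattice_index_eqI:
  fixes z w :: "int^('d::finite + 'm::finite) option"
  assumes "z $ None = w $ None" "\<And>i. z $ Some (Inl i) = w $ Some (Inl i)" "\<And>j. z $ Some (Inr j) = w $ Some (Inr j)"
  shows "z = w"
  unfolding vec_eq_iff
proof
  fix k show "z $ k = w $ k"
    using assms by (cases k) (auto simp: split_sum_all split: sum.splits, metis old.sum.exhaust)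
qed

text \<open>The Diophantine condition in the form used for counting: it covers all nonzero z,
  including those with q2 = 0, and measures q2 by any bound X >= 1 for its entries, so that it
  applies directly to differences of vectors in a box.\<close>

definition dioph_bound :: "real^'m::finite^('d::finite option) \<Rightarrow> real \<Rightarrow> real \<Rightarrow> bool" where
  "dioph_bound A w c \<longleftrightarrow> (\<forall>z X. z \<noteq> 0 \<longrightarrow> X \<ge> 1 \<longrightarrow> (\<forall>j. \<bar>real_of_int (z $ Some (Inr j))\<bar> \<le> X) \<longrightarrow>
     (\<exists>i. \<bar>lin_form A z i\<bar> \<ge> c * X powr (- w)))"

text \<open>For w above the exponent only finitely many (q, p) violate the inequality with constant
  1, and none of them is an exact zero, so a smaller constant serves them too. Vectors with q = 0
  have a nonzero integer among the entries of L z.\<close>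

lemma dioph_exponent_bound:
  fixes A :: "real^'m::finite^('d::finite option)"
  assumes "dioph_exponent A < ereal (real CARD('d + 'm))"
  shows "\<exists>w c. real CARD('d + 'm) - 1 \<le> w \<and> w < real CARD('d + 'm) \<and> 0 < c \<and> c \<le> 1 \<and> dioph_bound A w c"
proof -
  let ?n = "real CARD('d + 'm)"
  obtain w1 where w1: "dioph_exponent A < ereal w1" "w1 < ?n"
    using assms by (metis ereal_dense2 ereal_less_eq(3) less_ereal.simps(1) less_imp_le)
  \<comment> \<open>Increasing w keeps it above the exponent, and n - 1 is at least the number of
    columns of A, which is what \<open>count_lattice_vectors\<close> asks of w.\<close>
  define w where "w = max w1 (?n - 1)"
  have w: "dioph_exponent A < ereal w" "w < ?n" "?n - 1 \<le> w"
    using w1 unfolding w_def by (auto intro: less_le_trans)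
  have n2: "?n \<ge> 2"
  proof -
    have "CARD('d) \<ge> 1" "CARD('m) \<ge> 1" by (simp_all add: Suc_leI)
    then have "CARD('d) + CARD('m) \<ge> 2" by linarith
    then show ?thesis by simp
  qed
  then have w0: "w > 0" using w by linarith
  define N where "N q p = norm (A *v int_vec q + int_vec p)" for q :: "int^'m" and p :: "int^('d option)"
  define S where "S = {(q :: int^'m, p :: int^('d option)). q \<noteq> 0 \<and> N q p \<le> norm (int_vec q) powr (- w)}"
  have finS: "finite S"
  proof (rule ccontr)
    assume "infinite S"
    then have "ereal w \<le> dioph_exponent A"
      unfolding dioph_exponent_def S_def N_def by (intro Sup_upper) (use w0 in blast)
    then show False using w by simp
  qed
  \<comment> \<open>All multiples of an exact zero would again be solutions, contradicting
    \<open>finS\<close>.\<close>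
  have pos: "N q p > 0" if q: "q \<noteq> 0" for q p
  proof (rule ccontr)
    assume "\<not> ?thesis"
    then have N0: "A *v int_vec q + int_vec p = 0" by (simp add: N_def)
    define f where "f k = ((\<chi> j. int (Suc k) * q $ j) :: int^'m, (\<chi> i. int (Suc k) * p $ i) :: int^('d option))" for k
    have "f k \<in> S" for k
    proof -
      have "int_vec (fst (f k)) = real (Suc k) *\<^sub>R int_vec q" "int_vec (snd (f k)) = real (Suc k) *\<^sub>R int_vec p"
        by (simp_all add: f_def vec_eq_iff)
      then have "A *v int_vec (fst (f k)) + int_vec (snd (f k)) = real (Suc k) *\<^sub>R (A *v int_vec q + int_vec p)"
        by (simp add: matrix_vector_mult_scaleR scaleR_right_distrib)
      then have "N (fst (f k)) (snd (f k)) = 0" using N0 by (simp add: N_def)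
      moreover have "fst (f k) \<noteq> 0" using q by (auto simp: f_def vec_eq_iff)
      ultimately show ?thesis by (simp add: S_def case_prod_unfold)
    qed
    moreover have "inj f"
    proof (rule injI)
      fix a b assume "f a = f b"
      moreover obtain j where "q $ j \<noteq> 0" using q by (auto simp: vec_eq_iff)
      ultimately show "a = b" by (auto simp: f_def vec_eq_iff)
    qed
    ultimately have "infinite S" using finite_subset[of "range f" S] range_inj_infinite[of f] by blast
    then show False using finS by simp
  qed
  have "\<exists>c1. 0 < c1 \<and> c1 \<le> 1 \<and> (\<forall>q p. q \<noteq> 0 \<longrightarrow> N q p \<ge> c1 * norm (int_vec q) powr (- w))"
  proof -
    \<comment> \<open>The element 1 keeps the minimum at most 1, so that it also serves the pairs
      outside S.\<close>
    define R where "R = insert 1 ((\<lambda>(q, p). N q p / norm (int_vec q) powr (- w)) ` S)"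
    have R: "finite R" "R \<noteq> {}" using finS by (auto simp: R_def)
    have nz: "norm (int_vec q) > 0" if "q \<noteq> 0" for q :: "int^'m"
      using that by (auto simp: vec_eq_iff)
    have "\<forall>r\<in>R. r > 0" using pos nz by (auto simp: R_def S_def)
    then have "Min R > 0" using R by simp
    moreover have "Min R \<le> 1" using R by (simp add: R_def)
    moreover have "N q p \<ge> Min R * norm (int_vec q) powr (- w)" if q: "q \<noteq> 0" for q p
    proof (cases "(q, p) \<in> S")
      case True
      then have "Min R \<le> N q p / norm (int_vec q) powr (- w)"
        by (intro Min_le R) (auto simp: R_def)
      then show ?thesis using nz[OF q] by (simp add: field_simps)
    next
      case False
      then have "N q p \<ge> 1 * norm (int_vec q) powr (- w)" using q by (auto simp: S_def)
      moreover have "Min R * norm (int_vec q) powr (- w) \<le> 1 * norm (int_vec q) powr (- w)"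
        using \<open>Min R \<le> 1\<close> by (intro mult_right_mono) auto
      ultimately show ?thesis by linarith
    qed
    ultimately show ?thesis by blast
  qed
  then obtain c1 where c1: "0 < c1" "c1 \<le> 1" "\<And>q p. q \<noteq> 0 \<Longrightarrow> N q p \<ge> c1 * norm (int_vec q) powr (- w)" by blast
  let ?m = "real CARD('m)" and ?d1 = "real CARD('d option)"
  have m1: "?m \<ge> 1" "?d1 \<ge> 1" by (simp_all add: Suc_leI)
  \<comment> \<open>The power of \<open>?m\<close> pays for bounding the norm of q by m X, and
    \<open>?d1\<close> for passing from the norm of L z to one of its d + 1 entries.\<close>
  define c where "c = c1 * ?m powr (- w) / ?d1"
  have mp: "?m powr (- w) \<le> 1" using m1 w0 by (simp add: powr_minus inverse_le_1_iff ge_one_powr_ge_zero)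
  have c: "0 < c" using c1 m1 by (simp add: c_def)
  have "c1 * ?m powr (- w) \<le> 1 * 1" by (rule mult_mono) (use c1 mp in auto)
  then have cle: "c \<le> 1" unfolding c_def using m1 by (simp add: divide_le_eq_1)
  have "\<exists>i. \<bar>lin_form A z i\<bar> \<ge> c * X powr (- w)"
    if z: "z \<noteq> 0" and X: "X \<ge> 1" and zX: "\<forall>j. \<bar>real_of_int (z $ Some (Inr j))\<bar> \<le> X" for z X
  proof -
    define q where "q = (\<chi> j. z $ Some (Inr j))"
    define p where "p = (\<chi> i. case i of None \<Rightarrow> z $ None | Some k \<Rightarrow> z $ Some (Inl k))"
    have lfN: "(A *v int_vec q + int_vec p) $ i = lin_form A z i" for i
      by (simp add: lin_form_def q_def p_def matrix_vector_mult_def split: option.split)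
    have Xp: "X powr (- w) \<le> 1" using X w0 by (simp add: powr_minus inverse_le_1_iff ge_one_powr_ge_zero)
    show ?thesis
    proof (cases "q = 0")
      case True
      then have q0: "z $ Some (Inr j) = 0" for j by (simp add: q_def vec_eq_iff)
      have "p \<noteq> 0"
      proof
        assume "p = 0"
        then have "z $ None = 0" "z $ Some (Inl i) = 0" for i
          unfolding p_def vec_eq_iff by (auto simp: split_option_all)
        then have "z = 0" using q0 by (intro lattice_index_eqI) auto
        then show False using z by simp
      qed
      then obtain i where i: "p $ i \<noteq> 0" by (auto simp: vec_eq_iff)
      have "lin_form A z i = of_int (p $ i)" using lfN[of i] True by simp
      then have "\<bar>lin_form A z i\<bar> \<ge> 1" using i by linarith
      moreover have "c * X powr (- w) \<le> 1 * 1" by (rule mult_mono) (use cle Xp in auto)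
      ultimately show ?thesis by (intro exI[of _ i]) linarith
    next
      case False
      have "norm (int_vec q) \<le> (\<Sum>j\<in>UNIV. \<bar>int_vec q $ j\<bar>)" by (rule norm_le_l1_cart)
      also have "\<dots> \<le> (\<Sum>j\<in>(UNIV::'m set). X)" using zX by (intro sum_mono) (simp add: q_def)
      finally have nq: "norm (int_vec q) \<le> ?m * X" by simp
      have q0: "norm (int_vec q) > 0" using False by (auto simp: vec_eq_iff)
      have "(?m * X) powr (- w) \<le> norm (int_vec q) powr (- w)"
        by (rule powr_mono2') (use w0 q0 nq in auto)
      then have "c1 * (?m * X) powr (- w) \<le> N q p"
        using c1(3)[OF False, of p] c1(1) by (meson mult_left_mono less_imp_le order_trans)
      then have Nge: "?d1 * (c * X powr (- w)) \<le> N q p"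
        using m1 X by (simp add: c_def powr_mult)
      show ?thesis
      proof (rule ccontr)
        assume "\<not> ?thesis"
        then have lt: "\<bar>lin_form A z i\<bar> < c * X powr (- w)" for i by (auto simp: not_le)
        have "N q p \<le> (\<Sum>i\<in>UNIV. \<bar>(A *v int_vec q + int_vec p) $ i\<bar>)" unfolding N_def by (rule norm_le_l1_cart)
        also have "\<dots> < (\<Sum>i\<in>(UNIV::'d option set). c * X powr (- w))"
          unfolding lfN by (intro sum_strict_mono lt) auto
        finally show False using Nge by simp
      qed
    qed
  qed
  then have "dioph_bound A w c" unfolding dioph_bound_def by blast
  then show ?thesis using w c cle by blast
qed

section \<open>Counting by cells on which lattice vectors are separated\<close>

lemma card_vec_set:
  assumes "finite I"
  shows "finite {v :: int^'n::finite. \<forall>j. v $ j \<in> I}" "card {v :: int^'n::finite. \<forall>j. v $ j \<in> I} = card I ^ CARD('n)"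
proof -
  have "bij_betw vec_lambda (UNIV \<rightarrow>\<^sub>E I) {v :: int^'n. \<forall>j. v $ j \<in> I}"
  proof (rule bij_betw_byWitness[where f' = vec_nth])
    show "vec_lambda ` (UNIV \<rightarrow>\<^sub>E I) \<subseteq> {v :: int^'n. \<forall>j. v $ j \<in> I}" by (auto simp: PiE_mem)
    show "vec_nth ` {v :: int^'n. \<forall>j. v $ j \<in> I} \<subseteq> UNIV \<rightarrow>\<^sub>E I" by auto
  qed auto
  then show "finite {v :: int^'n::finite. \<forall>j. v $ j \<in> I}" "card {v :: int^'n::finite. \<forall>j. v $ j \<in> I} = card I ^ CARD('n)"
    using bij_betw_finite bij_betw_same_card assms by (auto simp: card_PiE finite_PiE dest: bij_betw_finite bij_betw_same_card)
qed

text \<open>The lower end is -a - 1 because the floor of a number in [-a, a] may lie below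
  -a.\<close>

lemma card_int_interval_le:
  assumes "a \<ge> 0"
  shows "finite {k::int. - a - 1 \<le> of_int k \<and> of_int k \<le> (a::real)}"
    "real (card {k::int. - a - 1 \<le> of_int k \<and> of_int k \<le> a}) \<le> 2 * a + 2"
proof -
  have eq: "{k::int. - a - 1 \<le> of_int k \<and> of_int k \<le> a} = {\<lceil>- a - 1\<rceil>..\<lfloor>a\<rfloor>}"
    unfolding set_eq_iff mem_Collect_eq atLeastAtMost_iff ceiling_le_iff le_floor_iff by simp
  show "finite {k::int. - a - 1 \<le> of_int k \<and> of_int k \<le> a}" unfolding eq by simp
  show "real (card {k::int. - a - 1 \<le> of_int k \<and> of_int k \<le> a}) \<le> 2 * a + 2"
    unfolding eq using assms by simp linarith
qed

text \<open>Taking floors of the coordinates after division by the cell sizes is injective on V,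
  since by \<open>sep\<close> a cell holds at most one vector; the right-hand side counts the
  cells.\<close>

lemma card_le_cells:
  fixes A :: "real^'m::finite^('d::finite option)"
  assumes X: "X \<ge> 0" "X1 > 0" and r: "rho \<ge> 0" "rho1 > 0"
    and V: "\<And>z j. z \<in> V \<Longrightarrow> \<bar>real_of_int (z $ Some (Inr j))\<bar> \<le> X" "\<And>z i. z \<in> V \<Longrightarrow> \<bar>lin_form A z i\<bar> \<le> rho"
    and sep: "\<And>z w. z \<in> V \<Longrightarrow> w \<in> V \<Longrightarrow> (\<forall>j. \<bar>real_of_int ((z - w) $ Some (Inr j))\<bar> < X1) \<Longrightarrow>
       (\<forall>i. \<bar>lin_form A (z - w) i\<bar> < rho1) \<Longrightarrow> z = w"
  shows "finite V \<and> real (card V) \<le> (2 * (X / X1) + 2) ^ CARD('m) * (2 * (rho / rho1) + 2) ^ CARD('d option)"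
proof -
  define I where "I a = {k::int. - a - 1 \<le> of_int k \<and> of_int k \<le> (a::real)}" for a
  define P where "P = {v :: int^'m. \<forall>j. v $ j \<in> I (X / X1)}"
  define Q where "Q = {v :: int^('d option). \<forall>j. v $ j \<in> I (rho / rho1)}"
  define f where "f z = ((\<chi> j. \<lfloor>real_of_int (z $ Some (Inr j)) / X1\<rfloor>) :: int^'m, (\<chi> i. \<lfloor>lin_form A z i / rho1\<rfloor>) :: int^('d option))" for z
  have finI: "finite (I a)" "real (card (I a)) \<le> 2 * a + 2" if "a \<ge> 0" for a
    using card_int_interval_le[OF that] by (auto simp: I_def)
  have close: "\<bar>a - b\<bar> < e" if "\<lfloor>a / e\<rfloor> = \<lfloor>b / e\<rfloor>" "e > 0" for a b e :: real
  proof -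
    have "\<bar>a / e - b / e\<bar> < 1" using that(1) by linarith
    then show ?thesis using that(2) by (simp add: diff_divide_distrib[symmetric] abs_divide)
  qed
  have inj: "inj_on f V"
  proof (rule inj_onI)
    fix z w assume zw: "z \<in> V" "w \<in> V" "f z = f w"
    have "\<bar>real_of_int (z $ Some (Inr j)) - real_of_int (w $ Some (Inr j))\<bar> < X1" for j
      using zw(3) by (intro close X) (auto simp: f_def vec_eq_iff)
    moreover have "\<bar>lin_form A z i - lin_form A w i\<bar> < rho1" for i
      using zw(3) by (intro close r) (auto simp: f_def vec_eq_iff)
    ultimately show "z = w" using zw by (intro sep) (auto simp: lin_form_diff)
  qed
  have flI: "\<lfloor>x / e\<rfloor> \<in> I (a / e)" if "\<bar>x\<bar> \<le> a" "e > 0" for x e a :: real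
  proof -
    have "- a / e \<le> x / e" "x / e \<le> a / e" by (rule divide_right_mono, use that in linarith, use that in linarith)+
    then show ?thesis unfolding I_def by simp linarith
  qed
  have img: "f ` V \<subseteq> P \<times> Q"
    using V flI X r by (auto simp: f_def P_def Q_def)
  have finPQ: "finite (P \<times> Q)"
    unfolding P_def Q_def by (intro finite_cartesian_product card_vec_set(1) finI) (use X r in auto)
  have "finite V" using inj img finPQ by (metis finite_imageD finite_subset)
  moreover have "card V \<le> card (P \<times> Q)"
    using card_inj_on_le[OF inj img finPQ] .
  moreover have "real (card (P \<times> Q)) \<le> (2 * (X / X1) + 2) ^ CARD('m) * (2 * (rho / rho1) + 2) ^ CARD('d option)"
  proof -
    have "card (P \<times> Q) = card (I (X / X1)) ^ CARD('m) * card (I (rho / rho1)) ^ CARD('d option)"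
      unfolding card_cartesian_product P_def Q_def
      by (subst (1 2) card_vec_set(2)) (use finI X r in auto)
    then have "real (card (P \<times> Q)) = real (card (I (X / X1))) ^ CARD('m) * real (card (I (rho / rho1))) ^ CARD('d option)"
      by (simp only: of_nat_mult of_nat_power)
    also have "\<dots> \<le> (2 * (X / X1) + 2) ^ CARD('m) * (2 * (rho / rho1) + 2) ^ CARD('d option)"
    proof (intro mult_mono power_mono finI(2))
    qed (use X r in auto)
    finally show ?thesis .
  qed
  ultimately show ?thesis by linarith
qed

text \<open>Unit cells always separate: vectors in one cell have the same q2, and then their linear
  parts differ by an integer vector with entries below 1.\<close>

lemma card_lattice_vectors_unit:
  fixes A :: "real^'m::finite^('d::finite option)"
  assumes "X \<ge> 0" "rho \<ge> 0"
    and V: "\<And>z j. z \<in> V \<Longrightarrow> \<bar>real_of_int (z $ Some (Inr j))\<bar> \<le> X" "\<And>z i. z \<in> V \<Longrightarrow> \<bar>lin_form A z i\<bar> \<le> rho"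
  shows "finite V \<and> real (card V) \<le> (2 * (X / 1) + 2) ^ CARD('m) * (2 * (rho / 1) + 2) ^ CARD('d option)"
proof (rule card_le_cells[where A = A])
  fix z w :: "int^('d + 'm) option"
  assume a: "\<forall>j. \<bar>real_of_int ((z - w) $ Some (Inr j))\<bar> < 1" "\<forall>i. \<bar>lin_form A (z - w) i\<bar> < 1"
  have q0: "(z - w) $ Some (Inr j) = 0" for j using a(1)[rule_format, of j] by linarith
  then have "lin_form A (z - w) None = of_int ((z - w) $ None)" "lin_form A (z - w) (Some i) = of_int ((z - w) $ Some (Inl i))" for i
    by (simp_all add: lin_form_def)
  moreover have "\<bar>lin_form A (z - w) None\<bar> < 1" "\<bar>lin_form A (z - w) (Some i)\<bar> < 1" for i using a(2) by auto
  ultimately have "\<bar>real_of_int ((z - w) $ None)\<bar> < 1" "\<bar>real_of_int ((z - w) $ Some (Inl i))\<bar> < 1" for i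
    by metis+
  moreover have "k = 0" if "\<bar>real_of_int k\<bar> < 1" for k using that by linarith
  ultimately have "(z - w) $ None = 0" "(z - w) $ Some (Inl i) = 0" for i
    by blast+
  then have "z - w = 0" using q0 by (intro lattice_index_eqI) auto
  then show "z = w" by simp
qed (use assms in auto)

text \<open>For rho >= 1 unit cells give the second term. For rho between c / 3 and 1 they give X^m,
  which is at most a constant times X^w rho because w >= m. For smaller rho the cells may be longer
  in the direction of q2, and their number (X / X1)^m is at most (X / X1)^w = X^w 3 rho / c.\<close>

lemma count_lattice_vectors:
  fixes A :: "real^'m::finite^('d::finite option)"
  assumes db: "dioph_bound A w c" and w: "w \<ge> real CARD('m)" and c: "0 < c" "c \<le> 1"
  shows "\<exists>C>0. \<forall>X rho V. X \<ge> 1 \<longrightarrow> rho > 0 \<longrightarrow> 0 \<notin> V \<longrightarrow>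
     (\<forall>z\<in>V. (\<forall>j. \<bar>real_of_int (z $ Some (Inr j))\<bar> \<le> X) \<and> (\<forall>i. \<bar>lin_form A z i\<bar> \<le> rho)) \<longrightarrow>
     finite V \<and> real (card V) \<le> C * (X powr w * rho + X ^ CARD('m) * rho ^ (CARD('d) + 1))"
proof -
  let ?m = "CARD('m)" and ?d = "CARD('d)"
  have m1: "real ?m \<ge> 1" by (simp add: Suc_leI)
  then have w1: "w \<ge> 1" using w by linarith
  define C where "C = 4 ^ (?m + ?d + 1) * (3 / c)"
  have C0: "C > 0" using c by (simp add: C_def)
  have Cge: "C \<ge> 4 ^ (?m + ?d + 1)" unfolding C_def using c by (simp add: field_simps)
  have "finite V \<and> real (card V) \<le> C * (X powr w * rho + X ^ ?m * rho ^ (?d + 1))"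
    if X: "X \<ge> 1" and r: "rho > 0" and V0: "0 \<notin> V"
      and V: "\<forall>z\<in>V. (\<forall>j. \<bar>real_of_int (z $ Some (Inr j))\<bar> \<le> X) \<and> (\<forall>i. \<bar>lin_form A z i\<bar> \<le> rho)" for X rho V
  proof -
    have Xw: "X ^ ?m \<le> X powr w"
      using powr_mono[OF w X] X by (simp add: powr_realpow)
    have unit: "finite V \<and> real (card V) \<le> (2 * (X / 1) + 2) ^ ?m * (2 * (rho / 1) + 2) ^ CARD('d option)"
      by (rule card_lattice_vectors_unit[where A = A]) (use X r V in auto)
    have X4: "(2 * (X / 1) + 2) ^ ?m \<le> 4 ^ ?m * X ^ ?m"
      unfolding power_mult_distrib[symmetric] by (rule power_mono) (use X in auto)
    consider "rho \<ge> 1" | "c / 3 < rho" "rho < 1" | "rho \<le> c / 3" by linarith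
    then show ?thesis
    proof cases
      case 1
      have "(2 * (rho / 1) + 2) ^ CARD('d option) \<le> 4 ^ (?d + 1) * rho ^ (?d + 1)"
        unfolding power_mult_distrib[symmetric] card_option Suc_eq_plus1 by (rule power_mono) (use 1 in auto)
      then have "real (card V) \<le> (4 ^ ?m * X ^ ?m) * (4 ^ (?d + 1) * rho ^ (?d + 1))"
        using unit X4 by (intro order_trans[OF conjunct2[OF unit]] mult_mono) (use X r in auto)
      also have "\<dots> = 4 ^ (?m + ?d + 1) * (X ^ ?m * rho ^ (?d + 1))" by (simp add: power_add)
      also have "\<dots> \<le> C * (X powr w * rho + X ^ ?m * rho ^ (?d + 1))"
        using Cge C0 X r by (intro mult_mono) auto
      finally show ?thesis using unit by simp
    next
      case 2
      have "(2 * (rho / 1) + 2) ^ CARD('d option) \<le> 4 ^ (?d + 1)"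
        unfolding card_option Suc_eq_plus1 by (rule power_mono) (use 2 r in auto)
      then have "real (card V) \<le> (4 ^ ?m * X ^ ?m) * (4 ^ (?d + 1))"
        using unit X4 by (intro order_trans[OF conjunct2[OF unit]] mult_mono) (use X r in auto)
      also have "\<dots> = 4 ^ (?m + ?d + 1) * X ^ ?m" by (simp add: power_add)
      also have "\<dots> \<le> 4 ^ (?m + ?d + 1) * (X powr w * (3 / c * rho))"
      proof (intro mult_left_mono)
        have "1 \<le> 3 / c * rho" using 2 c by (simp add: field_simps)
        then have "X ^ ?m * 1 \<le> X powr w * (3 / c * rho)" by (intro mult_mono Xw) auto
        then show "X ^ ?m \<le> X powr w * (3 / c * rho)" by simp
      qed auto
      also have "\<dots> = C * (X powr w * rho)" by (simp add: C_def)
      also have "\<dots> \<le> C * (X powr w * rho + X ^ ?m * rho ^ (?d + 1))"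
        using C0 X r by (intro mult_left_mono) auto
      finally show ?thesis using unit by simp
    next
      case 3
      show ?thesis
      proof (cases "V = {}")
        case True then show ?thesis using C0 X r by simp
      next
        case False
        then obtain z0 where z0: "z0 \<in> V" by blast
        \<comment> \<open>The cell size for which \<open>dioph_bound\<close> forbids two points of \<open>V\<close> in one cell: \<open>c X1\<^sup>-\<^sup>w = 3 rho\<close>.\<close>
        define X1 where "X1 = (c / (3 * rho)) powr (1 / w)"
        have q1: "c / (3 * rho) \<ge> 1" using 3 r by (simp add: field_simps)
        then have X1: "X1 \<ge> 1" unfolding X1_def using w1 by (intro ge_one_powr_ge_zero) auto
        have X1w: "X1 powr w = c / (3 * rho)" unfolding X1_def powr_powr using w1 q1 c r by simp
        \<comment> \<open>As z0 is nonzero, rho cannot be below c X^(-w). This gives X1 <= X: the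
          cells are not longer than the box, and the passage from exponent m to w goes in the right
          direction.\<close>
        have "\<exists>i. \<bar>lin_form A z0 i\<bar> \<ge> c * X powr (- w)"
          using db V V0 z0 X unfolding dioph_bound_def by metis
        then have cr: "c * X powr (- w) \<le> rho" using V z0 by (meson order_trans)
        then have "c / rho \<le> X powr w" using r X by (simp add: powr_minus field_simps)
        moreover have "c / (3 * rho) \<le> c / rho" using c r by (intro divide_left_mono) auto
        ultimately have "X1 powr w \<le> X powr w" unfolding X1w by linarith
        then have XX1: "X1 \<le> X"
          using powr_less_mono2[of w X X1] w1 X by (meson linorder_not_le less_le_trans order_trans zero_less_one zero_le_one)
        have fc: "finite V \<and> real (card V) \<le> (2 * (X / X1) + 2) ^ ?m * (2 * (rho / (3 * rho)) + 2) ^ CARD('d option)"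
        proof (rule card_le_cells[where A = A])
          fix z u assume zu: "z \<in> V" "u \<in> V"
            and a: "\<forall>j. \<bar>real_of_int ((z - u) $ Some (Inr j))\<bar> < X1"
          show "z = u"
          proof (rule ccontr)
            assume "z \<noteq> u"
            then have "\<exists>i. \<bar>lin_form A (z - u) i\<bar> \<ge> c * X1 powr (- w)"
              using db X1 a unfolding dioph_bound_def by (metis eq_iff_diff_eq_0 less_imp_le)
            then obtain i where "\<bar>lin_form A (z - u) i\<bar> \<ge> c * X1 powr (- w)" by blast
            moreover have "c * X1 powr (- w) = 3 * rho"
              using c r by (simp add: powr_minus X1w)
            moreover have "\<bar>lin_form A z i\<bar> \<le> rho" "\<bar>lin_form A u i\<bar> \<le> rho" using V zu by auto
            then have "\<bar>lin_form A (z - u) i\<bar> \<le> 2 * rho" unfolding lin_form_diff by linarith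
            ultimately show False using r by linarith
          qed
        qed (use X X1 r V in auto)
        have "2 * (X / X1) + 2 \<le> 4 * (X / X1)" using XX1 X1 by (simp add: field_simps)
        then have "(2 * (X / X1) + 2) ^ ?m \<le> (4 * (X / X1)) ^ ?m"
          using X X1 by (intro power_mono) auto
        also have "\<dots> = 4 ^ ?m * (X / X1) powr real ?m"
          unfolding power_mult_distrib using X X1 by (simp add: powr_realpow)
        also have "\<dots> \<le> 4 ^ ?m * (X / X1) powr w"
          using XX1 X1 w by (intro mult_left_mono powr_mono) auto
        also have "(X / X1) powr w = X powr w * (3 * rho / c)"
          using X X1 by (simp add: powr_divide X1w)
        finally have 1: "(2 * (X / X1) + 2) ^ ?m \<le> 4 ^ ?m * (X powr w * (3 * rho / c))" .
        have 2: "(2 * (rho / (3 * rho)) + 2) ^ CARD('d option) \<le> (4::real) ^ (?d + 1)"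
          unfolding card_option Suc_eq_plus1 by (rule power_mono) (use r in auto)
        have "real (card V) \<le> (4 ^ ?m * (X powr w * (3 * rho / c))) * 4 ^ (?d + 1)"
          by (intro order_trans[OF conjunct2[OF fc]] mult_mono 1 2) (use X r c in auto)
        also have "\<dots> = C * (X powr w * rho)" by (simp add: C_def power_add)
        also have "\<dots> \<le> C * (X powr w * rho + X ^ ?m * rho ^ (?d + 1))"
          using C0 X r by (intro mult_left_mono) auto
        finally show ?thesis using fc by simp
      qed
    qed
  qed
  then show ?thesis using C0 by (intro exI[of _ C]) blast
qed

section \<open>First moment bounds\<close>

text \<open>Half-open, so that dyadic cubes and fundamental boxes partition the space without
  overlap.\<close>

definition hobox :: "real^'n::finite \<Rightarrow> ('n \<Rightarrow> real) \<Rightarrow> (real^'n) set" where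
  "hobox a s = {y. \<forall>i. a $ i \<le> y $ i \<and> y $ i < a $ i + s i}"

abbreviation cube :: "real^'n::finite \<Rightarrow> real \<Rightarrow> (real^'n) set" where
  "cube a r \<equiv> hobox a (\<lambda>_. r)"

lemma hobox_borel [measurable, simp]: "hobox a s \<in> sets borel"
proof -
  have "hobox a s = (\<Inter>i. {y. a $ i \<le> y $ i} \<inter> {y. y $ i < a $ i + s i})" by (auto simp: hobox_def)
  also have "\<dots> \<in> sets borel"
    by (intro sets.countable_INT' sets.Int borel_closed borel_open closed_Collect_le open_Collect_less continuous_intros)
      (auto intro: countable_finite)
  finally show ?thesis .
qed

lemma emeasure_hobox:
  assumes "\<And>i. s i \<ge> 0"
  shows "emeasure lborel (hobox a s) = ennreal (\<Prod>i\<in>UNIV. s i)"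
proof -
  let ?b = "a + (\<chi> i. s i)"
  have le: "a \<bullet> v \<le> ?b \<bullet> v" if "v \<in> Basis" for v
    using that assms by (auto simp: Basis_vec_def inner_axis inner_add_left)
  have eq: "emeasure lborel (cbox a ?b) = ennreal (\<Prod>i\<in>UNIV. s i)"
  proof -
    have "cbox a ?b \<noteq> {}" using assms by (auto simp: interval_ne_empty_cart)
    then have "measure lborel (cbox a ?b) = (\<Prod>i\<in>UNIV. s i)" by (simp add: content_cbox_if_cart)
    moreover have "emeasure lborel (cbox a ?b) \<noteq> top"
      using emeasure_lborel_cbox_finite[of a ?b] by (simp add: less_top)
    ultimately show ?thesis using emeasure_eq_ennreal_measure by metis
  qed
  moreover have "emeasure lborel (box a ?b) = emeasure lborel (cbox a ?b)"
    using le by (simp add: emeasure_lborel_box_eq emeasure_lborel_cbox_eq)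
  moreover have "emeasure lborel (hobox a s) \<le> emeasure lborel (cbox a ?b)"
    by (rule emeasure_mono) (auto simp: hobox_def mem_box_cart less_imp_le)
  moreover have "emeasure lborel (box a ?b) \<le> emeasure lborel (hobox a s)"
    by (rule emeasure_mono) (auto simp: hobox_def mem_box_cart less_imp_le)
  ultimately show ?thesis by (metis antisym)
qed

lemma fmeasurable_subset_hobox:
  assumes "E \<in> sets borel" "E \<subseteq> hobox a s" "\<And>i. s i \<ge> 0"
  shows "E \<in> fmeasurable lborel"
proof (rule fmeasurableI2)
  show "hobox a s \<in> fmeasurable lborel" by (rule fmeasurableI) (auto simp: emeasure_hobox[OF assms(3)])
qed (use assms in auto)

lemma emeasure_lborel_vimage_translate:
  fixes E :: "'a::euclidean_space set"
  assumes [measurable]: "E \<in> sets borel"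
  shows "emeasure lborel {x. c + x \<in> E} = emeasure lborel E"
proof -
  have "emeasure lborel {x. c + x \<in> E} = (\<integral>\<^sup>+x. indicator {x. c + x \<in> E} x \<partial>lborel)"
    by (rule nn_integral_indicator[symmetric]) measurable
  also have "\<dots> = (\<integral>\<^sup>+x. indicator E (c + x) \<partial>lborel)" by (rule nn_integral_cong) (simp add: indicator_def)
  also have "\<dots> = (\<integral>\<^sup>+x. indicator E x \<partial>lborel)" by (rule nn_integral_lborel_translate) measurable
  finally show ?thesis by simp
qed

section \<open>The measure of the parameters for which a vector has small first coordinate\<close>

definition slab :: "real^'n::finite \<Rightarrow> real \<Rightarrow> real \<Rightarrow> real^'n \<Rightarrow> real \<Rightarrow> (real^'n) set" where
  "slab a r al be t = {y \<in> cube a r. \<bar>al + (\<Sum>i\<in>UNIV. y $ i * be $ i)\<bar> \<le> t}"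

lemma slab_borel [measurable, simp]: "slab a r al be t \<in> sets borel"
proof -
  have "slab a r al be t = cube a r \<inter> {y. \<bar>al + (\<Sum>i\<in>UNIV. y $ i * be $ i)\<bar> \<le> t}" by (auto simp: slab_def)
  also have "\<dots> \<in> sets borel"
    by (intro sets.Int hobox_borel borel_closed closed_Collect_le continuous_intros)
  finally show ?thesis .
qed

text \<open>Many disjoint translates of the slab along the \<open>k\<close>-th axis fit into a box of twice the volume.\<close>

lemma measure_slab_le:
  fixes be :: "real^'n::finite"
  assumes r: "r > 0" and t: "t > 0" and b: "be $ k \<noteq> 0"
  shows "measure lborel (slab a r al be t) \<le> r ^ CARD('n) * (6 * t / (r * \<bar>be $ k\<bar>))"
proof -
  let ?E = "slab a r al be t"
  \<comment> \<open>A shift by h changes the affine form by 3 t, more than the width 2 t of its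
    range on the slab, so distinct shifts are disjoint. J is chosen so that the shifts j h with j <
    J do not exceed r, which keeps the translates in the box with the k-th side doubled.\<close>
  define h where "h = 3 * t / \<bar>be $ k\<bar>"
  define J where "J = nat \<lfloor>r / h\<rfloor> + 1"
  have h: "h > 0" using t b by (simp add: h_def)
  have J: "real J \<ge> r / h" "real J - 1 \<le> r / h" using r h unfolding J_def by (auto intro: less_imp_le) linarith+
  define E where "E j = {x. (- (real j * h)) *\<^sub>R axis k 1 + x \<in> ?E}" for j
  define s where "s i = (if i = k then 2 * r else r)" for i
  have s0: "s i \<ge> 0" for i using r by (simp add: s_def)
  have Eb: "E j \<in> sets borel" for j unfolding E_def by measurable
  have Eem: "emeasure lborel (E j) = emeasure lborel ?E" for j
    unfolding E_def by (rule emeasure_lborel_vimage_translate) simp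
  have sub: "E j \<subseteq> hobox a s" if "j < J" for j
  proof
    fix x assume x: "x \<in> E j"
    let ?c = "real j * h"
    have c: "0 \<le> ?c" "?c \<le> r"
    proof -
      have "real j \<le> r / h" using that J by linarith
      then show "?c \<le> r" using h by (simp add: field_simps)
    qed (use h in simp)
    have "a $ i \<le> x $ i \<and> x $ i < a $ i + s i" for i
    proof -
      have "a $ i \<le> ((- ?c) *\<^sub>R axis k 1 + x) $ i \<and> ((- ?c) *\<^sub>R axis k 1 + x) $ i < a $ i + r"
        using x by (auto simp: E_def slab_def hobox_def)
      moreover have "((- ?c) *\<^sub>R axis k 1 + x) $ i = (if i = k then x $ i - ?c else x $ i)" by (simp add: axis_def)
      ultimately show ?thesis using c by (auto simp: s_def split: if_splits)
    qed
    then show "x \<in> hobox a s" by (simp add: hobox_def)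
  qed
  have val: "\<bar>al + (\<Sum>i\<in>UNIV. x $ i * be $ i) - real j * h * be $ k\<bar> \<le> t" if "x \<in> E j" for x j
  proof -
    have "(\<Sum>i\<in>UNIV. ((- (real j * h)) *\<^sub>R axis k 1 + x) $ i * be $ i)
        = (\<Sum>i\<in>UNIV. x $ i * be $ i) - (\<Sum>i\<in>UNIV. real j * h * (if i = k then be $ i else 0))"
      unfolding sum_subtractf[symmetric] by (rule sum.cong) (auto simp: axis_def algebra_simps)
    also have "(\<Sum>i\<in>UNIV. real j * h * (if i = k then be $ i else 0)) = real j * h * be $ k"
      by (simp add: sum_distrib_left[symmetric])
    finally have "al + (\<Sum>i\<in>UNIV. ((- (real j * h)) *\<^sub>R axis k 1 + x) $ i * be $ i) = al + (\<Sum>i\<in>UNIV. x $ i * be $ i) - real j * h * be $ k"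
      by simp
    then show ?thesis using that unfolding E_def slab_def mem_Collect_eq by (metis (no_types, lifting))
  qed
  have disj: "disjoint_family_on E {..<J}"
    unfolding disjoint_family_on_def
  proof (intro ballI impI, rule ccontr)
    fix i j assume "i \<noteq> j" "E i \<inter> E j \<noteq> {}"
    then obtain x where x: "x \<in> E i" "x \<in> E j" by blast
    have "\<bar>real i * h * be $ k - real j * h * be $ k\<bar> \<le> 2 * t" using val[OF x(1)] val[OF x(2)] by linarith
    moreover have "\<bar>real i * h * be $ k - real j * h * be $ k\<bar> = \<bar>real i - real j\<bar> * (3 * t)"
    proof -
      have "\<bar>real i * h * be $ k - real j * h * be $ k\<bar> = \<bar>(real i - real j) * (h * be $ k)\<bar>" by (simp add: algebra_simps)
      also have "\<dots> = \<bar>real i - real j\<bar> * \<bar>h * be $ k\<bar>" by (rule abs_mult)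
      also have "\<bar>h * be $ k\<bar> = 3 * t" using t b by (simp add: h_def abs_mult)
      finally show ?thesis .
    qed
    moreover have "\<bar>real i - real j\<bar> \<ge> 1" using \<open>i \<noteq> j\<close> by linarith
    then have "1 * (3 * t) \<le> \<bar>real i - real j\<bar> * (3 * t)" using t by (intro mult_right_mono) auto
    ultimately show False using t by linarith
  qed
  have Esub: "?E \<subseteq> cube a r" by (auto simp: slab_def)
  have fin: "emeasure lborel ?E = ennreal (measure lborel ?E)"
    using fmeasurable_subset_hobox[OF slab_borel Esub] r by (intro emeasure_eq_ennreal_measure) (auto simp: fmeasurable_def)
  have "of_nat J * emeasure lborel ?E = (\<Sum>j<J. emeasure lborel (E j))" by (simp add: Eem)
  also have "\<dots> = emeasure lborel (\<Union>j<J. E j)"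
    by (rule sum_emeasure) (use disj Eb in auto)
  also have "\<dots> \<le> emeasure lborel (hobox a s)"
    by (rule emeasure_mono) (use sub in auto)
  also have "\<dots> = ennreal (2 * r ^ CARD('n))"
  proof -
    have "(\<Prod>i\<in>UNIV. s i) = s k * (\<Prod>i\<in>UNIV - {k}. s i)" by (rule prod.remove) auto
    also have "(\<Prod>i\<in>UNIV - {k}. s i) = (\<Prod>i\<in>UNIV - {k}. r)" by (rule prod.cong) (auto simp: s_def)
    also have "s k * \<dots> = 2 * (\<Prod>i\<in>(UNIV :: 'n set). r)"
      by (subst prod.remove[of UNIV k]) (auto simp: s_def)
    finally show ?thesis using s0 by (simp add: emeasure_hobox)
  qed
  finally have "ennreal (real J * measure lborel ?E) \<le> ennreal (2 * r ^ CARD('n))"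
    unfolding fin by (simp add: ennreal_mult ennreal_of_nat_eq_real_of_nat)
  then have "real J * measure lborel ?E \<le> 2 * r ^ CARD('n)" using r by (simp add: ennreal_le_iff)
  moreover have "(r / h) * measure lborel ?E \<le> real J * measure lborel ?E" by (rule mult_right_mono[OF J(1)]) simp
  ultimately have "(r / h) * measure lborel ?E \<le> 2 * r ^ CARD('n)" by linarith
  then have "measure lborel ?E \<le> 2 * r ^ CARD('n) * (h / r)" using r h by (simp add: field_simps)
  also have "\<dots> = r ^ CARD('n) * (6 * t / (r * \<bar>be $ k\<bar>))" by (simp add: h_def mult_ac)
  finally show ?thesis .
qed

text \<open>The common form of the exceptional sets: \<open>short_cell_set\<close> is one of these
  sets, and \<open>bad_region\<close> is contained in one.\<close>

definition near_set :: "real^'m::finite^('d::finite option) \<Rightarrow> real^'d \<Rightarrow> real \<Rightarrow> real \<Rightarrow> real \<Rightarrow> (real^'d) set" where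
  "near_set A a X t rho = {y \<in> cube a 1. \<exists>z. z \<noteq> 0 \<and> (\<forall>j. \<bar>real_of_int (z $ Some (Inr j))\<bar> \<le> X) \<and>
     \<bar>aff_form A y z\<bar> \<le> t \<and> (\<forall>i. \<bar>lin_form A z (Some i)\<bar> \<le> rho)}"

lemma aff_form_slab: "{y \<in> cube a r. \<bar>aff_form A y z\<bar> \<le> t} = slab a r (lin_form A z None) (\<chi> i. lin_form A z (Some i)) t"
  by (auto simp: aff_form_def slab_def)

lemma near_set_eq: "near_set A a X t rho = (\<Union>z\<in>{z. z \<noteq> 0 \<and> (\<forall>j. \<bar>real_of_int (z $ Some (Inr j))\<bar> \<le> X) \<and>
     (\<forall>i. \<bar>lin_form A z (Some i)\<bar> \<le> rho)}. slab a 1 (lin_form A z None) (\<chi> i. lin_form A z (Some i)) t)"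
  unfolding near_set_def aff_form_slab[symmetric] by auto

lemma near_set_borel: "near_set A a X t rho \<in> sets borel"
  unfolding near_set_eq by (intro sets.countable_UN') auto

text \<open>Take the last e up to I with l <= rho / 2^e. If it is I itself, the lower bound on l in
  the third hypothesis ends the argument.\<close>

lemma exists_dyadic_class:
  assumes l: "0 < l" "l \<le> (rho::real)" "rho \<le> l * 2 ^ I"
  shows "\<exists>e\<le>I. l \<le> rho / 2 ^ e \<and> rho / 2 ^ e \<le> 2 * l"
proof -
  define e where "e = (GREATEST e. e \<le> I \<and> l \<le> rho / 2 ^ e)"
  have e: "e \<le> I \<and> l \<le> rho / 2 ^ e" unfolding e_def
    by (rule GreatestI_nat[where b = I and k = 0]) (use l in auto)
  have "rho / 2 ^ e \<le> 2 * l"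
  proof (cases "e = I")
    case True then show ?thesis using l by (simp add: field_simps)
  next
    case False
    have "\<not> (Suc e \<le> I \<and> l \<le> rho / 2 ^ Suc e)"
      using Greatest_le_nat[of "\<lambda>e. e \<le> I \<and> l \<le> rho / 2 ^ e" "Suc e" I] unfolding e_def by auto
    then have "rho / 2 ^ Suc e < l" using False e by auto
    then show ?thesis by (simp add: field_simps)
  qed
  then show ?thesis using e by blast
qed

lemma exists_max_abs:
  fixes f :: "'d::finite \<Rightarrow> real"
  shows "\<exists>k. \<forall>i. \<bar>f i\<bar> \<le> \<bar>f k\<bar>"
proof -
  have "Max (range (\<lambda>j. \<bar>f j\<bar>)) \<in> range (\<lambda>j. \<bar>f j\<bar>)" by (intro Max_in) auto
  then obtain k where "Max (range (\<lambda>j. \<bar>f j\<bar>)) = \<bar>f k\<bar>" by blast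
  moreover have "\<bar>f j\<bar> \<le> Max (range (\<lambda>j. \<bar>f j\<bar>))" for j by (intro Max_ge) auto
  ultimately show ?thesis by metis
qed

text \<open>On a bounded set of y, the affine form and its slopes control the remaining entry of L
  z, hence all of L z.\<close>

lemma lin_form_None_le:
  fixes A :: "real^'m::finite^('d::finite option)"
  assumes "\<bar>aff_form A y z\<bar> \<le> t" "\<And>i. \<bar>y $ i\<bar> \<le> Y" "\<And>i. \<bar>lin_form A z (Some i)\<bar> \<le> l"
  shows "\<bar>lin_form A z None\<bar> \<le> t + real CARD('d) * (Y * l)"
proof -
  have "\<bar>\<Sum>i\<in>UNIV. y $ i * lin_form A z (Some i)\<bar> \<le> (\<Sum>i\<in>(UNIV::'d set). Y * l)"
    by (intro order_trans[OF sum_abs] sum_mono)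
      (auto simp: abs_mult intro!: mult_mono assms order_trans[OF abs_ge_zero assms(2)])
  then have "\<bar>\<Sum>i\<in>UNIV. y $ i * lin_form A z (Some i)\<bar> \<le> real CARD('d) * (Y * l)" by simp
  then show ?thesis using assms(1) unfolding aff_form_def by linarith
qed

text \<open>Union bound over z, sorted by the dyadic size p of the largest slope. A slab has measure
  at most a constant times t / p, and the count of vectors with linear part of size p, divided by p,
  is X^w + X^m p^d. Each class is bounded by its value at p = rho, whence the factor I + 1. By the
  Diophantine bound slopes are at least c' X^(-w), so I + 1 classes suffice.\<close>

lemma measure_near_set_le:
  fixes A :: "real^'m::finite^('d::finite option)"
  assumes db: "dioph_bound A w c" and w: "w \<ge> real CARD('m)" and c: "0 < c" "c \<le> 1"
    and Y: "\<And>y i. y \<in> cube a 1 \<Longrightarrow> \<bar>y $ i\<bar> \<le> Y" "Y \<ge> 1"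
  shows "\<exists>C>0. \<exists>c'>0. \<forall>X t rho I. X \<ge> 1 \<longrightarrow> t > 0 \<longrightarrow> rho > 0 \<longrightarrow> t \<le> c / 2 * X powr (- w) \<longrightarrow>
     rho \<le> c' * X powr (- w) * 2 ^ I \<longrightarrow>
     measure lborel (near_set A a X t rho) \<le> C * real (I + 1) * t * (X powr w + X ^ CARD('m) * rho ^ CARD('d))"
proof -
  let ?m = "CARD('m)" and ?d = "CARD('d)"
  obtain C where C: "C > 0" and cnt: "\<And>X rho V. X \<ge> 1 \<Longrightarrow> rho > 0 \<Longrightarrow> 0 \<notin> V \<Longrightarrow>
     (\<And>z. z \<in> V \<Longrightarrow> (\<forall>j. \<bar>real_of_int (z $ Some (Inr j))\<bar> \<le> X) \<and> (\<forall>i. \<bar>lin_form A z i\<bar> \<le> rho)) \<Longrightarrow>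
     finite V \<and> real (card V) \<le> C * (X powr w * rho + X ^ ?m * rho ^ (?d + 1))"
    using count_lattice_vectors[OF db w c] by metis
  \<comment> \<open>c' X^(-w) will be a lower bound for the largest slope, and K times the largest
    slope an upper bound for all entries of L z.\<close>
  define c' where "c' = c / (2 * (real ?d * Y + 1))"
  define K where "K = 2 * (real ?d * Y) + 2"
  have dY: "real ?d * Y \<ge> 0" using Y by simp
  have c': "c' > 0" using c dY by (simp add: c'_def)
  have K: "K \<ge> 2" unfolding K_def using dY by linarith
  have "measure lborel (near_set A a X t rho) \<le> 12 * C * K ^ (?d + 1) * real (I + 1) * t * (X powr w + X ^ ?m * rho ^ ?d)"
    if X: "X \<ge> 1" and t: "t > 0" and r: "rho > 0" and tX: "t \<le> c / 2 * X powr (- w)"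
      and I: "rho \<le> c' * X powr (- w) * 2 ^ I" for X t rho I
  proof -
    define S where "S z = slab a 1 (lin_form A z None) (\<chi> i. lin_form A z (Some i)) t" for z
    define V where "V = {z. z \<noteq> 0 \<and> (\<forall>j. \<bar>real_of_int (z $ Some (Inr j))\<bar> \<le> X) \<and> (\<forall>i. \<bar>lin_form A z (Some i)\<bar> \<le> rho) \<and> S z \<noteq> {}}"
    define Ve where "Ve e = {z \<in> V. (\<forall>i. \<bar>lin_form A z (Some i)\<bar> \<le> rho / 2 ^ e) \<and> (\<exists>k. rho / 2 ^ e \<le> 2 * \<bar>lin_form A z (Some k)\<bar>) \<and>
        (\<forall>i. \<bar>lin_form A z i\<bar> \<le> K * (rho / 2 ^ e))}" for e
    have V_cover: "\<exists>e\<le>I. z \<in> Ve e" if z: "z \<in> V" for z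
    proof -
      obtain k where k: "\<And>i. \<bar>lin_form A z (Some i)\<bar> \<le> \<bar>lin_form A z (Some k)\<bar>"
        using exists_max_abs[of "\<lambda>i. lin_form A z (Some i)"] by blast
      define l where "l = \<bar>lin_form A z (Some k)\<bar>"
      obtain y where y: "y \<in> cube a 1" "\<bar>aff_form A y z\<bar> \<le> t"
        using z aff_form_slab[of a 1 A z t] unfolding V_def S_def by auto
      have N: "\<bar>lin_form A z None\<bar> \<le> t + real ?d * (Y * l)"
        by (rule lin_form_None_le[OF y(2)]) (use Y y k in \<open>auto simp: l_def\<close>)
      obtain i where i: "\<bar>lin_form A z i\<bar> \<ge> c * X powr (- w)"
        using db z X unfolding dioph_bound_def V_def by blast
      have l0: "l \<ge> 0" by (simp add: l_def)
      \<comment> \<open>If the entry of L z that is large by \<open>dioph_bound\<close> is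
        \<open>None\<close>, it must be balanced by the slopes, since the affine form at y is at
        most t, half the Diophantine bound.\<close>
      have lc: "c / 2 * X powr (- w) \<le> (real ?d * Y + 1) * l"
      proof (cases i)
        case None
        then have "c / 2 * X powr (- w) \<le> real ?d * (Y * l)" using i N tX by (simp add: algebra_simps)
        then show ?thesis using l0 by (simp add: algebra_simps)
      next
        case (Some j)
        then have "c * X powr (- w) \<le> l" using i k[of j] by (simp add: l_def)
        moreover have "c / 2 * X powr (- w) \<le> c * X powr (- w)" using c by simp
        moreover have "1 * l \<le> (real ?d * Y + 1) * l" using dY l0 by (intro mult_right_mono) auto
        ultimately show ?thesis by linarith
      qed
      then have lc': "c' * X powr (- w) \<le> l"
        unfolding c'_def using dY by (simp add: field_simps)
      moreover have "0 < c' * X powr (- w)" using c' X by simp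
      ultimately have lpos: "0 < l" by linarith
      have "rho \<le> l * 2 ^ I" using I lc' by (meson mult_right_mono order_trans zero_le_power zero_le_numeral)
      moreover have "l \<le> rho" using z by (simp add: V_def l_def)
      ultimately obtain e where e: "e \<le> I" "l \<le> rho / 2 ^ e" "rho / 2 ^ e \<le> 2 * l"
        using exists_dyadic_class[OF lpos] by blast
      have Kl: "\<bar>lin_form A z i\<bar> \<le> K * l" for i
      proof (cases i)
        case None
        have "t \<le> (real ?d * Y + 1) * l" using tX lc by linarith
        then have "t + real ?d * (Y * l) \<le> K * l" using l0 by (simp add: K_def algebra_simps)
        then show ?thesis using N unfolding None by linarith
      next
        case (Some j)
        have "1 * l \<le> K * l" using K l0 by (intro mult_right_mono) auto
        then show ?thesis using k[of j] Some by (simp add: l_def)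
      qed
      have "\<bar>lin_form A z i\<bar> \<le> K * (rho / 2 ^ e)" for i
        using Kl[of i] e(2) K by (meson mult_left_mono order_trans zero_le_numeral)
      moreover have "\<bar>lin_form A z (Some i)\<bar> \<le> rho / 2 ^ e" for i using k[of i] e(2) by (simp add: l_def)
      ultimately have "z \<in> Ve e" using z e by (auto simp: Ve_def l_def)
      then show ?thesis using e by blast
    qed
    have Ve: "finite (Ve e) \<and> real (card (Ve e)) \<le> C * (X powr w * (K * (rho / 2 ^ e)) + X ^ ?m * (K * (rho / 2 ^ e)) ^ (?d + 1))" for e
      by (rule cnt[OF X]) (use r K in \<open>auto simp: Ve_def V_def\<close>)
    have Sm: "S z \<in> fmeasurable lborel" for z
      unfolding S_def by (rule fmeasurable_subset_hobox[OF slab_borel, of _ _ _ _ _ a "\<lambda>_. 1"]) (auto simp: slab_def)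
    have Sle: "measure lborel (S z) \<le> 12 * t / (rho / 2 ^ e)" if z: "z \<in> Ve e" for z e
    proof -
      obtain k where k: "rho / 2 ^ e \<le> 2 * \<bar>lin_form A z (Some k)\<bar>" using z by (auto simp: Ve_def)
      have rp: "rho / 2 ^ e > 0" using r by simp
      have b: "(\<chi> i. lin_form A z (Some i)) $ k \<noteq> 0" using k rp by auto
      have "measure lborel (S z) \<le> 1 ^ ?d * (6 * t / (1 * \<bar>(\<chi> i. lin_form A z (Some i)) $ k\<bar>))"
        unfolding S_def by (rule measure_slab_le[OF _ t b]) simp
      also have "\<dots> = 12 * t / (2 * \<bar>lin_form A z (Some k)\<bar>)" by simp
      also have "\<dots> \<le> 12 * t / (rho / 2 ^ e)" using t by (intro frac_le k rp) auto
      finally show ?thesis .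
    qed
    have cls: "measure lborel (\<Union>z\<in>Ve e. S z) \<le> 12 * C * K ^ (?d + 1) * t * (X powr w + X ^ ?m * rho ^ ?d)" for e
    proof -
      define p where "p = rho / 2 ^ e"
      have p: "0 < p" "p \<le> rho" using r by (auto simp: p_def field_simps)
      have "measure lborel (\<Union>z\<in>Ve e. S z) \<le> (\<Sum>z\<in>Ve e. measure lborel (S z))"
        by (rule measure_UNION_le) (use Ve Sm in \<open>auto simp: fmeasurable_def\<close>)
      also have "\<dots> \<le> (\<Sum>z\<in>Ve e. 12 * t / p)" by (rule sum_mono) (use Sle in \<open>auto simp: p_def\<close>)
      also have "\<dots> = real (card (Ve e)) * (12 * t / p)" by simp
      also have "\<dots> \<le> (C * (X powr w * (K * p) + X ^ ?m * (K * p) ^ (?d + 1))) * (12 * t / p)"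
        using Ve[of e] t p by (intro mult_right_mono) (auto simp: p_def)
      also have "\<dots> = 12 * C * t * (X powr w * K + X ^ ?m * K ^ (?d + 1) * p ^ ?d)"
        using p by (simp add: power_mult_distrib field_simps)
      also have "\<dots> \<le> 12 * C * t * (X powr w * K ^ (?d + 1) + X ^ ?m * K ^ (?d + 1) * rho ^ ?d)"
      proof (intro mult_left_mono add_mono)
        show "K \<le> K ^ (?d + 1)" using power_increasing[of 1 "?d + 1" K] K by simp
        show "p ^ ?d \<le> rho ^ ?d" using p by (intro power_mono) auto
      qed (use C t X K in auto)
      finally show ?thesis by (simp add: algebra_simps)
    qed
    have UVe: "(\<Union>z\<in>Ve e. S z) \<in> fmeasurable lborel" for e
      using Ve Sm by (intro fmeasurable.finite_UN) auto
    have "near_set A a X t rho \<subseteq> (\<Union>e\<in>{..I}. \<Union>z\<in>Ve e. S z)"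
    proof
      fix y assume "y \<in> near_set A a X t rho"
      then obtain z where z: "z \<noteq> 0" "\<forall>j. \<bar>real_of_int (z $ Some (Inr j))\<bar> \<le> X" "\<forall>i. \<bar>lin_form A z (Some i)\<bar> \<le> rho" "y \<in> S z"
        unfolding near_set_eq S_def by blast
      then have "z \<in> V" by (auto simp: V_def)
      then obtain e where "e \<le> I" "z \<in> Ve e" using V_cover by blast
      then show "y \<in> (\<Union>e\<in>{..I}. \<Union>z\<in>Ve e. S z)"
        by (intro UN_I[of e] UN_I[of z]) (use z in auto)
    qed
    then have "measure lborel (near_set A a X t rho) \<le> measure lborel (\<Union>e\<in>{..I}. \<Union>z\<in>Ve e. S z)"
      by (rule measure_mono_fmeasurable) (auto simp: near_set_borel intro!: UVe fmeasurable.finite_UN[of _ "\<lambda>e. \<Union> (S ` Ve e)"])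
    also have "\<dots> \<le> (\<Sum>e\<in>{..I}. measure lborel (\<Union>z\<in>Ve e. S z))"
      by (rule measure_UNION_le) (use UVe in \<open>auto simp: fmeasurable_def\<close>)
    also have "\<dots> \<le> (\<Sum>e\<in>{..I}. 12 * C * K ^ (?d + 1) * t * (X powr w + X ^ ?m * rho ^ ?d))"
      by (intro sum_mono cls)
    also have "\<dots> = 12 * C * K ^ (?d + 1) * real (I + 1) * t * (X powr w + X ^ ?m * rho ^ ?d)" by simp
    finally show ?thesis .
  qed
  moreover have "12 * C * K ^ (?d + 1) > 0" using C K by simp
  ultimately show ?thesis using c' by blast
qed

section \<open>The local estimate\<close>

text \<open>The vector a_t u_y z for S = e^(t/(n+1)), except that the coordinates
  \<open>Inl i\<close> carry the slopes of the affine form instead of the entries of z. This is a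
  fixed unipotent change of coordinates commuting with the scaling; it makes the slopes visible to
  the count by volume.\<close>

definition renorm :: "real^'m::finite^('d::finite option) \<Rightarrow> real \<Rightarrow> real^'d \<Rightarrow> int^('d + 'm) option \<Rightarrow> real^('d + 'm) option" where
  "renorm A S y z = (\<chi> k. case k of None \<Rightarrow> S ^ CARD('d + 'm) * aff_form A y z
     | Some (Inl i) \<Rightarrow> lin_form A z (Some i) / S | Some (Inr j) \<Rightarrow> real_of_int (z $ Some (Inr j)) / S)"

lemma lin_form_add: "lin_form A (z + w) i = lin_form A z i + lin_form A w i"
  by (simp add: lin_form_def sum.distrib distrib_left split: option.split)

lemma renorm_nth [simp]:
  "renorm A S y z $ None = S ^ CARD('d + 'm) * aff_form A y z"
  "renorm A S y z $ Some (Inl i) = lin_form A z (Some i) / S"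
  "renorm A S y z $ Some (Inr j) = real_of_int (z $ Some (Inr j)) / S"
  for A :: "real^'m::finite^('d::finite option)"
  by (simp_all add: renorm_def)

lemma all_index_iff: "(\<forall>k. P k) \<longleftrightarrow> P None \<and> (\<forall>i. P (Some (Inl i))) \<and> (\<forall>j. P (Some (Inr j)))"
  by (simp add: split_option_all split_sum_all)

lemma UNIV_index: "(UNIV :: ('d + 'm) option set) = insert None (range (\<lambda>i. Some (Inl i)) \<union> range (\<lambda>j. Some (Inr j)))"
  unfolding set_eq_iff by (subst all_index_iff) auto

lemma prod_index:
  fixes f :: "('d::finite + 'm::finite) option \<Rightarrow> real"
  shows "(\<Prod>k\<in>UNIV. f k) = f None * ((\<Prod>i\<in>UNIV. f (Some (Inl i))) * (\<Prod>j\<in>UNIV. f (Some (Inr j))))"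
proof -
  have "(\<Prod>k\<in>UNIV. f k) = f None * (\<Prod>k\<in>range (\<lambda>i. Some (Inl i)) \<union> range (\<lambda>j. Some (Inr j)). f k)"
    unfolding UNIV_index by (rule prod.insert) auto
  also have "(\<Prod>k\<in>range (\<lambda>i. Some (Inl i)) \<union> range (\<lambda>j. Some (Inr j)). f k)
     = (\<Prod>k\<in>range (\<lambda>i. Some (Inl i)). f k) * (\<Prod>k\<in>range (\<lambda>j. Some (Inr j)). f k)"
    by (rule prod.union_disjoint) auto
  finally show ?thesis by (simp add: prod.reindex inj_on_def)
qed

text \<open>The map is triangular, so that a box whose sides are the diagonal entries is a fundamental
  domain; the determinant is not needed.\<close>

lemma tiling_renorm:
  fixes A :: "real^'m::finite^('d::finite option)"
  assumes S: "S > 0"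
  shows "tiling (renorm A S y) (hobox 0 (\<lambda>k. if k = None then S ^ CARD('d + 'm) else 1 / S))"
proof
  show "renorm A S y (a + b) = renorm A S y a + renorm A S y b" for a b
    unfolding vec_eq_iff all_index_iff
    by (simp add: aff_form_def lin_form_add add_divide_distrib sum.distrib distrib_left)
  show "hobox 0 (\<lambda>k. if k = None then S ^ CARD('d + 'm) else 1 / S) \<in> sets borel" by simp
  show "emeasure lborel (hobox 0 (\<lambda>k::('d+'m) option. if k = None then S ^ CARD('d + 'm) else 1 / S)) = 1"
    using S by (subst emeasure_hobox) (auto simp: prod_index power_add[symmetric] power_divide)
  fix x :: "real^('d + 'm) option"
  have fl: "0 \<le> u - of_int k / S \<and> u - of_int k / S < 1 / S \<longleftrightarrow> k = \<lfloor>S * u\<rfloor>" for u k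
  proof -
    have e: "u - of_int k / S = (S * u - of_int k) / S" using S by (simp add: diff_divide_distrib)
    have "0 \<le> u - of_int k / S \<longleftrightarrow> of_int k \<le> S * u" unfolding e using S by (simp add: zero_le_divide_iff)
    moreover have "u - of_int k / S < 1 / S \<longleftrightarrow> S * u < of_int k + 1"
      unfolding e using S by (simp add: divide_less_cancel) linarith
    ultimately show ?thesis by (metis floor_unique of_int_floor_le real_of_int_floor_add_one_gt)
  qed
  have fl2: "0 \<le> u - (of_int k + v) / S \<and> u - (of_int k + v) / S < 1 / S \<longleftrightarrow> k = \<lfloor>S * u - v\<rfloor>" for u v k
    using fl[of "u - v / S" k] S by (simp add: add_divide_distrib algebra_simps)
  have fl3: "0 \<le> u - S ^ CARD('d + 'm) * (of_int k + v) \<and> u - S ^ CARD('d + 'm) * (of_int k + v) < S ^ CARD('d + 'm)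
      \<longleftrightarrow> k = \<lfloor>u / S ^ CARD('d + 'm) - v\<rfloor>" for u v k
  proof -
    have T: "S ^ CARD('d + 'm) > 0" using S by simp
    have "0 \<le> u - S ^ CARD('d + 'm) * (of_int k + v) \<longleftrightarrow> of_int k \<le> u / S ^ CARD('d + 'm) - v"
      using T by (simp add: field_simps del: card_sum)
    moreover have "u - S ^ CARD('d + 'm) * (of_int k + v) < S ^ CARD('d + 'm) \<longleftrightarrow> u / S ^ CARD('d + 'm) - v < of_int k + 1"
      using T by (simp add: field_simps del: card_sum)
    ultimately show ?thesis by (metis floor_unique of_int_floor_le real_of_int_floor_add_one_gt)
  qed
  \<comment> \<open>Solving from the bottom: q from the last coordinates, then p, then p0. Each
    coordinate contains one new integer, which the half-open side of the box determines as a
    floor.\<close>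
  define q where "q j = \<lfloor>S * x $ Some (Inr j)\<rfloor>" for j
  define v where "v i = (\<Sum>j\<in>UNIV. A $ i $ j * of_int (q j))" for i
  define p where "p i = \<lfloor>S * x $ Some (Inl i) - v (Some i)\<rfloor>" for i
  define u where "u = v None + (\<Sum>i\<in>UNIV. y $ i * (of_int (p i) + v (Some i)))"
  define p0 where "p0 = \<lfloor>x $ None / S ^ CARD('d + 'm) - u\<rfloor>"
  have iff: "x - renorm A S y z \<in> hobox 0 (\<lambda>k. if k = None then S ^ CARD('d + 'm) else 1 / S)
      \<longleftrightarrow> z $ None = p0 \<and> (\<forall>i. z $ Some (Inl i) = p i) \<and> (\<forall>j. z $ Some (Inr j) = q j)" for z
  proof -
    have "x - renorm A S y z \<in> hobox 0 (\<lambda>k. if k = None then S ^ CARD('d + 'm) else 1 / S) \<longleftrightarrow>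
       (0 \<le> x $ None - S ^ CARD('d + 'm) * aff_form A y z \<and> x $ None - S ^ CARD('d + 'm) * aff_form A y z < S ^ CARD('d + 'm)) \<and>
       (\<forall>i. 0 \<le> x $ Some (Inl i) - lin_form A z (Some i) / S \<and> x $ Some (Inl i) - lin_form A z (Some i) / S < 1 / S) \<and>
       (\<forall>j. z $ Some (Inr j) = q j)"
      unfolding hobox_def mem_Collect_eq all_index_iff
      by (simp add: fl q_def del: card_sum diff_ge_0_iff_ge)
    also have "\<dots> \<longleftrightarrow> (0 \<le> x $ None - S ^ CARD('d + 'm) * aff_form A y z \<and> x $ None - S ^ CARD('d + 'm) * aff_form A y z < S ^ CARD('d + 'm)) \<and>
       (\<forall>i. z $ Some (Inl i) = p i) \<and> (\<forall>j. z $ Some (Inr j) = q j)"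
    proof -
      have "(\<forall>i. 0 \<le> x $ Some (Inl i) - lin_form A z (Some i) / S \<and> x $ Some (Inl i) - lin_form A z (Some i) / S < 1 / S)
          \<longleftrightarrow> (\<forall>i. z $ Some (Inl i) = p i)" if "\<forall>j. z $ Some (Inr j) = q j"
      proof -
        have "lin_form A z (Some i) = of_int (z $ Some (Inl i)) + v (Some i)" for i
          using that by (simp add: lin_form_def v_def)
        then show ?thesis by (simp only: fl2 p_def)
      qed
      then show ?thesis by blast
    qed
    also have "\<dots> \<longleftrightarrow> z $ None = p0 \<and> (\<forall>i. z $ Some (Inl i) = p i) \<and> (\<forall>j. z $ Some (Inr j) = q j)"
    proof -
      have "(0 \<le> x $ None - S ^ CARD('d + 'm) * aff_form A y z \<and> x $ None - S ^ CARD('d + 'm) * aff_form A y z < S ^ CARD('d + 'm))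
          \<longleftrightarrow> z $ None = p0" if "\<forall>i. z $ Some (Inl i) = p i" "\<forall>j. z $ Some (Inr j) = q j"
      proof -
        have "aff_form A y z = of_int (z $ None) + u"
          using that by (simp add: aff_form_def lin_form_def v_def u_def)
        then show ?thesis by (simp only: fl3 p0_def)
      qed
      then show ?thesis by blast
    qed
    finally show ?thesis .
  qed
  define z0 where "z0 = (\<chi> k. case k of None \<Rightarrow> p0 | Some (Inl i) \<Rightarrow> p i | Some (Inr j) \<Rightarrow> q j)"
  show "\<exists>!z. x - renorm A S y z \<in> hobox 0 (\<lambda>k. if k = None then S ^ CARD('d + 'm) else 1 / S)"
  proof (rule ex1I[of _ z0])
    show "x - renorm A S y z0 \<in> hobox 0 (\<lambda>k. if k = None then S ^ CARD('d + 'm) else 1 / S)"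
      unfolding iff by (simp add: z0_def)
    show "z = z0" if "x - renorm A S y z \<in> hobox 0 (\<lambda>k. if k = None then S ^ CARD('d + 'm) else 1 / S)" for z
      using that unfolding iff by (intro lattice_index_eqI) (auto simp: z0_def)
  qed
qed

text \<open>\<open>covering\<close> with about 1 / b steps of length d, where b is the volume of a
  ball of radius d / 2 in dimension n + 1. As b has order d^(n+1), the radius has order d^(-n). The
  constant depends only on the dimensions, so that the same bound serves \<open>A\<close> and
  \<open>orbit_mat\<close>.\<close>

lemma covering_renorm:
  fixes A :: "real^'m::finite^('d::finite option)"
  shows "\<exists>C>0. \<forall>A :: real^'m^('d option). \<forall>S y d. S > 0 \<longrightarrow> 0 < d \<longrightarrow> d \<le> 1 \<longrightarrow>
     (\<forall>z. z \<noteq> 0 \<longrightarrow> d \<le> norm (renorm A S y z)) \<longrightarrow> (\<forall>x. \<exists>z. \<forall>i. \<bar>(x - renorm A S y z) $ i\<bar> \<le> C / d ^ CARD('d + 'm))"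
proof -
  define n where "n = CARD('d + 'm)"
  define vol where "vol = measure lborel (ball (0 :: real^('d + 'm) option) 1)"
  have vol: "vol > 0" unfolding vol_def by (rule content_ball_pos) simp
  define C where "C = 2 + 2 ^ (n + 1) / vol"
  have "\<exists>z. \<forall>i. \<bar>(x - renorm A S y z) $ i\<bar> \<le> C / d ^ n"
    if S: "S > 0" and d: "0 < d" "d \<le> 1" and short: "\<forall>z. z \<noteq> 0 \<longrightarrow> d \<le> norm (renorm A S y z)"
    for A :: "real^'m^('d option)" and S y d x
  proof -
    interpret tiling "renorm A S y" "hobox 0 (\<lambda>k. if k = None then S ^ CARD('d + 'm) else 1 / S)"
      by (rule tiling_renorm[OF S])
    define b where "b = (d / 2) ^ CARD(('d + 'm) option) * vol"
    have bn: "b = (d / 2) ^ (n + 1) * vol" by (simp add: b_def n_def)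
    have b: "b > 0" using d vol by (simp add: b_def)
    define k where "k = nat \<lfloor>1 / b\<rfloor> + 1"
    have k: "real k > 1 / b" "real k \<le> 1 / b + 1" using b unfolding k_def by (auto intro!: less_imp_le) linarith+
    have "\<exists>z. dist x (renorm A S y z) < d * real k"
    proof (rule covering)
      have "1 < real k * b" using k(1) b by (simp add: field_simps)
      then show "1 < real k * ((d / 2) ^ CARD(('d + 'm) option) * measure lborel (ball (0 :: real^('d + 'm) option) 1))"
        unfolding b_def vol_def .
    qed (use d short in auto)
    then obtain z where z: "norm (x - renorm A S y z) < d * real k" by (auto simp: dist_norm)
    have "d * real k \<le> d * (1 / b + 1)" using d k by (intro mult_left_mono) auto
    also have "\<dots> = 2 ^ (n + 1) / vol / d ^ n + d"
      using d vol by (simp add: bn field_simps power_divide)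
    also have "\<dots> \<le> 2 ^ (n + 1) / vol / d ^ n + 2 / d ^ n"
    proof -
      have "d ^ n \<le> 1" using d by (simp add: power_le_one)
      then have "1 \<le> 1 / d ^ n" using d by simp
      then have "d \<le> 2 * (1 / d ^ n)" using d by linarith
      then show ?thesis by simp
    qed
    also have "\<dots> = C / d ^ n" by (simp add: C_def add_divide_distrib)
    finally have "norm (x - renorm A S y z) \<le> C / d ^ n" using z by linarith
    then have "\<bar>(x - renorm A S y z) $ i\<bar> \<le> C / d ^ n" for i
      using component_le_norm_cart[of "x - renorm A S y z" i] by linarith
    then show ?thesis by blast
  qed
  moreover have "C > 0" using vol by (simp add: C_def add_pos_nonneg)
  ultimately show ?thesis unfolding n_def by blast
qed

section \<open>The mean number of short vectors in a small cube\<close>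

definition short_set :: "real^'m::finite^('d::finite option) \<Rightarrow> real^'d \<Rightarrow> real \<Rightarrow> real \<Rightarrow> real \<Rightarrow> (real^'d) set" where
  "short_set A a r Q e = {y \<in> cube a r. \<exists>z. z \<noteq> 0 \<and> (\<forall>k. \<bar>real_of_int (z $ Some k)\<bar> \<le> e * Q) \<and>
     \<bar>aff_form A y z\<bar> \<le> e / Q ^ CARD('d + 'm)}"

text \<open>With Q = e^(t/(n+1)), vectors of size at most 1 at time t normally have slopes of order
  Q. Here they are smaller by the factor p, which makes the slabs too large for the count by
  volume.\<close>

definition bad_set :: "real^'m::finite^('d::finite option) \<Rightarrow> real^'d \<Rightarrow> real \<Rightarrow> real \<Rightarrow> real \<Rightarrow> (real^'d) set" where
  "bad_set A a r Q p = {y \<in> cube a r. \<exists>z. z \<noteq> 0 \<and> (\<forall>k. \<bar>real_of_int (z $ Some k)\<bar> \<le> Q) \<and>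
     \<bar>aff_form A y z\<bar> \<le> 1 / Q ^ CARD('d + 'm) \<and> (\<forall>i. \<bar>lin_form A z (Some i)\<bar> \<le> Q / p)}"

lemma short_set_borel [simp]:
  fixes A :: "real^'m::finite^('d::finite option)"
  shows "short_set A a r Q e \<in> sets borel"
proof -
  have "short_set A a r Q e = (\<Union>z\<in>{z. z \<noteq> 0 \<and> (\<forall>k. \<bar>real_of_int (z $ Some k)\<bar> \<le> e * Q)}.
      slab a r (lin_form A z None) (\<chi> i. lin_form A z (Some i)) (e / Q ^ CARD('d + 'm)))"
    unfolding short_set_def aff_form_slab[symmetric] by auto
  also have "\<dots> \<in> sets borel" by (intro sets.countable_UN') auto
  finally show ?thesis .
qed

lemma bad_set_borel [simp]:
  fixes A :: "real^'m::finite^('d::finite option)"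
  shows "bad_set A a r Q p \<in> sets borel"
proof -
  have "bad_set A a r Q p = (\<Union>z\<in>{z. z \<noteq> 0 \<and> (\<forall>k. \<bar>real_of_int (z $ Some k)\<bar> \<le> Q) \<and> (\<forall>i. \<bar>lin_form A z (Some i)\<bar> \<le> Q / p)}.
      slab a r (lin_form A z None) (\<chi> i. lin_form A z (Some i)) (1 / Q ^ CARD('d + 'm)))"
    unfolding bad_set_def aff_form_slab[symmetric] by auto
  also have "\<dots> \<in> sets borel" by (intro sets.countable_UN') auto
  finally show ?thesis .
qed

definition entry_bound :: "real^'m::finite^('d::finite option) \<Rightarrow> real" where
  "entry_bound A = 1 + (\<Sum>i\<in>UNIV. \<Sum>j\<in>UNIV. \<bar>A $ i $ j\<bar>)"

lemma entry_bound_ge_1: "entry_bound A \<ge> 1"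
  unfolding entry_bound_def by (simp add: sum_nonneg)

lemma lin_form_Some_le:
  fixes A :: "real^'m::finite^('d::finite option)"
  assumes "\<And>k. \<bar>real_of_int (z $ Some k)\<bar> \<le> Q"
  shows "\<bar>lin_form A z (Some i)\<bar> \<le> entry_bound A * Q"
proof -
  have Q: "Q \<ge> 0" using assms[of undefined] by linarith
  have "\<bar>\<Sum>j\<in>UNIV. A $ Some i $ j * real_of_int (z $ Some (Inr j))\<bar> \<le> (\<Sum>j\<in>UNIV. \<bar>A $ Some i $ j\<bar> * Q)"
    by (intro order_trans[OF sum_abs] sum_mono) (auto simp: abs_mult intro!: mult_left_mono assms)
  also have "\<dots> = (\<Sum>j\<in>UNIV. \<bar>A $ Some i $ j\<bar>) * Q" by (simp add: sum_distrib_right)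
  also have "\<dots> \<le> (\<Sum>i\<in>UNIV. \<Sum>j\<in>UNIV. \<bar>A $ i $ j\<bar>) * Q"
    by (intro mult_right_mono member_le_sum Q) (auto simp: sum_nonneg)
  finally show ?thesis
    using assms[of "Inl i"] unfolding lin_form_def entry_bound_def by (simp add: distrib_right)
qed

lemma sum_UNION_le:
  fixes f :: "'a \<Rightarrow> real"
  assumes "finite I" "\<And>i. i \<in> I \<Longrightarrow> finite (B i)" "\<And>x. 0 \<le> f x"
  shows "sum f (\<Union>i\<in>I. B i) \<le> (\<Sum>i\<in>I. sum f (B i))"
  using assms(1,2)
proof (induction I rule: finite_induct)
  case (insert i I)
  have "sum f (B i \<union> (\<Union>i\<in>I. B i)) + sum f (B i \<inter> (\<Union>i\<in>I. B i)) = sum f (B i) + sum f (\<Union>i\<in>I. B i)"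
    using insert by (intro sum.union_inter) auto
  moreover have "0 \<le> sum f (B i \<inter> (\<Union>i\<in>I. B i))" by (intro sum_nonneg assms(3))
  ultimately show ?case using insert by simp
qed simp

text \<open>Write P = p^2 and let S rho be the size of the largest slope. Across the cube the affine
  form varies by at most d r S rho = d rho / S^n, so a nonempty slab puts z, renormalized at the
  corner, into a box with d + 1 sides of order rho and m sides of order P. As D <= p <= rho,
  \<open>count_box\<close> yields at most about rho^(d+1) P^m vectors. Each slab has measure at most
  about r^d / (P^n rho), and the product r^d (rho / P)^d is summable over dyadic rho <= K P.\<close>

lemma slab_sum_le:
  shows "\<exists>C>0. \<forall>S p a r D V. S > 0 \<longrightarrow> p \<ge> 1 \<longrightarrow> r > 0 \<longrightarrow> r * S ^ (CARD('d + 'm) + 1) = 1 \<longrightarrow> 0 \<le> D \<longrightarrow> D \<le> p \<longrightarrow>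
    (\<forall>x. \<exists>z. \<forall>i. \<bar>(x - renorm (A :: real^'m::finite^('d::finite option)) S a z) $ i\<bar> \<le> D) \<longrightarrow> finite V \<longrightarrow>
    (\<forall>z\<in>V. (\<forall>k. \<bar>real_of_int (z $ Some k)\<bar> \<le> S * p^2) \<and> (\<exists>i. \<bar>lin_form A z (Some i)\<bar> > S * p) \<and>
        slab a r (lin_form A z None) (\<chi> i. lin_form A z (Some i)) (1 / (S * p^2) ^ CARD('d + 'm)) \<noteq> {}) \<longrightarrow>
    (\<Sum>z\<in>V. measure lborel (slab a r (lin_form A z None) (\<chi> i. lin_form A z (Some i)) (1 / (S * p^2) ^ CARD('d + 'm)))) \<le> C * r ^ CARD('d)"
proof -
  define n where "n = CARD('d + 'm)"
  let ?d = "CARD('d)" and ?m = "CARD('m)"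
  have n: "n = ?d + ?m" by (simp add: n_def)
  define K where "K = entry_bound A"
  have K: "K \<ge> 1" using entry_bound_ge_1 by (simp add: K_def)
  define C1 where "C1 = 12 * (2 * (real ?d + 2) * 4 ^ (?d + ?m))"
  have C1: "C1 > 0" by (simp add: C1_def)
  have main: "(\<Sum>z\<in>V. measure lborel (slab a r (lin_form A z None) (\<chi> i. lin_form A z (Some i)) (1 / (S * p^2) ^ n))) \<le> (2 * C1 * K ^ ?d) * r ^ ?d"
    if S: "S > 0" and p: "p \<ge> 1" and r: "r > 0" "r * S ^ (n + 1) = 1" and D: "0 \<le> D" "D \<le> p"
      and cov: "\<forall>x. \<exists>z. \<forall>i. \<bar>(x - renorm A S a z) $ i\<bar> \<le> D" and fV: "finite V"
      and V: "\<forall>z\<in>V. (\<forall>k. \<bar>real_of_int (z $ Some k)\<bar> \<le> S * p^2) \<and> (\<exists>i. \<bar>lin_form A z (Some i)\<bar> > S * p) \<and>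
        slab a r (lin_form A z None) (\<chi> i. lin_form A z (Some i)) (1 / (S * p^2) ^ n) \<noteq> {}"
    for S p a r D V
  proof -
    interpret tiling "renorm A S a" "hobox 0 (\<lambda>k. if k = None then S ^ CARD('d + 'm) else 1 / S)"
      by (rule tiling_renorm[OF S])
    define P where "P = p^2"
    have P: "P \<ge> 1" "p \<le> P" using p unfolding P_def by (auto intro: one_le_power self_le_power)
    define t where "t = 1 / (S * P) ^ n"
    have t: "t > 0" using S P by (simp add: t_def)
    define sl where "sl z = slab a r (lin_form A z None) (\<chi> i. lin_form A z (Some i)) t" for z
    define rho where "rho e = K * P / 2 ^ e" for e :: nat
    \<comment> \<open>I only makes the family of classes finite; the geometric sum at the end is at
      most 2 for every I.\<close>
    obtain I :: nat where I: "K * P \<le> p * 2 ^ I"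
    proof -
      obtain I :: nat where "K * P < 2 ^ I" using real_arch_pow[of 2 "K * P"] by auto
      moreover have "1 * 2 ^ I \<le> p * (2::real) ^ I" using p by (intro mult_right_mono) auto
      ultimately show ?thesis using that[of I] by linarith
    qed
    \<comment> \<open>The slope threshold S p assumed for V makes rho e at least p, hence at least
      D, in every class that occurs; this absorbs the covering radius into the sides of the
      box.\<close>
    define Ve where "Ve e = {z \<in> V. D \<le> rho e \<and> (\<forall>i. \<bar>lin_form A z (Some i)\<bar> \<le> S * rho e) \<and>
       (\<exists>k. S * rho e \<le> 2 * \<bar>lin_form A z (Some k)\<bar>) \<and> \<bar>S ^ n * aff_form A a z\<bar> \<le> (real ?d + 1) * rho e}" for e
    have cover: "\<exists>e\<le>I. z \<in> Ve e" if z: "z \<in> V" for z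
    proof -
      have zk: "\<bar>real_of_int (z $ Some k)\<bar> \<le> S * P" for k using V z by (simp add: P_def)
      obtain k where k: "\<And>i. \<bar>lin_form A z (Some i)\<bar> \<le> \<bar>lin_form A z (Some k)\<bar>"
        using exists_max_abs[of "\<lambda>i. lin_form A z (Some i)"] by blast
      define l where "l = \<bar>lin_form A z (Some k)\<bar> / S"
      have lS: "\<bar>lin_form A z (Some k)\<bar> = S * l" using S by (simp add: l_def)
      obtain i where "\<bar>lin_form A z (Some i)\<bar> > S * p" using V z by blast
      then have "S * p < S * l" using k[of i] lS by linarith
      then have lp: "p < l" using S by simp
      have "\<bar>lin_form A z (Some k)\<bar> \<le> K * (S * P)" unfolding K_def by (rule lin_form_Some_le[OF zk])
      then have "S * l \<le> S * (K * P)" unfolding lS by (simp add: mult_ac)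
      then have lK: "l \<le> K * P" using S by simp
      have l0: "0 < l" using lp p by linarith
      have "K * P \<le> l * 2 ^ I" using I lp by (meson mult_right_mono less_imp_le order_trans zero_le_power zero_le_numeral)
      then obtain e where e: "e \<le> I" "l \<le> rho e" "rho e \<le> 2 * l"
        using exists_dyadic_class[OF l0 lK] unfolding rho_def by blast
      obtain y where y: "y \<in> cube a r" "\<bar>aff_form A y z\<bar> \<le> t"
        using V z aff_form_slab[of a r A z t] unfolding n_def[symmetric] t_def P_def by blast
      \<comment> \<open>The form is small at some y of the cube; moving to the corner costs at most
        r times each slope.\<close>
      have "\<bar>aff_form A a z\<bar> \<le> t + real ?d * (r * (S * l))"
      proof -
        have "aff_form A y z - aff_form A a z = (\<Sum>i\<in>UNIV. (y $ i - a $ i) * lin_form A z (Some i))"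
          by (simp add: aff_form_def sum_subtractf left_diff_distrib)
        moreover have "\<bar>\<Sum>i\<in>UNIV. (y $ i - a $ i) * lin_form A z (Some i)\<bar> \<le> (\<Sum>i\<in>(UNIV::'d set). r * (S * l))"
        proof (intro order_trans[OF sum_abs] sum_mono)
          fix i
          have "a $ i \<le> y $ i" "y $ i < a $ i + r" using y(1) by (auto simp: hobox_def)
          then have "\<bar>y $ i - a $ i\<bar> \<le> r" by linarith
          then show "\<bar>(y $ i - a $ i) * lin_form A z (Some i)\<bar> \<le> r * (S * l)"
            unfolding abs_mult using k[of i] lS r by (intro mult_mono) auto
        qed
        ultimately show ?thesis using y(2) by simp
      qed
      then have "S ^ n * \<bar>aff_form A a z\<bar> \<le> S ^ n * (t + real ?d * (r * (S * l)))" using S by (intro mult_left_mono) auto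
      also have "\<dots> = S ^ n * t + real ?d * ((r * S ^ (n + 1)) * l)" by (simp add: algebra_simps)
      also have "S ^ n * t = 1 / P ^ n" using S by (simp add: t_def power_mult_distrib)
      also have "1 / P ^ n \<le> 1" using P by (simp add: divide_le_eq_1 one_le_power)
      also have "1 + real ?d * ((r * S ^ (n + 1)) * l) \<le> (real ?d + 1) * l"
        unfolding r(2) using lp p by (simp add: algebra_simps)
      also have "\<dots> \<le> (real ?d + 1) * rho e" using e by (intro mult_left_mono) auto
      finally have "S ^ n * \<bar>aff_form A a z\<bar> \<le> (real ?d + 1) * rho e" by simp
      then have "\<bar>S ^ n * aff_form A a z\<bar> \<le> (real ?d + 1) * rho e" using S by (simp add: abs_mult)
      moreover have "\<bar>lin_form A z (Some i)\<bar> \<le> S * rho e" for i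
        using k[of i] e(2) S unfolding lS by (meson mult_left_mono less_imp_le order_trans)
      moreover have "S * rho e \<le> 2 * \<bar>lin_form A z (Some k)\<bar>" unfolding lS using e(3) S by simp
      moreover have "D \<le> rho e" using D lp e by linarith
      ultimately show ?thesis using z e(1) unfolding Ve_def by blast
    qed
    have Ve_sum: "(\<Sum>z\<in>Ve e. measure lborel (sl z)) \<le> C1 * K ^ ?d * r ^ ?d * (1/2) ^ e" for e
    proof (cases "Ve e = {}")
      case True
      have "0 \<le> C1 * K ^ ?d * r ^ ?d * (1/2) ^ e" using C1 K r by (intro mult_nonneg_nonneg) auto
      then show ?thesis using True by simp
    next
      case False
      then have De: "D \<le> rho e" by (auto simp: Ve_def)
      have r0: "rho e > 0" using K P by (simp add: rho_def)
      have fin: "finite (Ve e)" using fV by (simp add: Ve_def)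
      define bd where "bd k = (case k of None \<Rightarrow> (real ?d + 1) * rho e | Some (Inl i) \<Rightarrow> rho e | Some (Inr j) \<Rightarrow> P)" for k :: "('d + 'm) option"
      have "real (card (Ve e)) \<le> (\<Prod>k\<in>UNIV. 2 * (bd k + D))"
      proof (rule count_box[OF _ D(1) _ fin])
        show "\<exists>z. \<forall>i. \<bar>(x - renorm A S a z) $ i\<bar> \<le> D" for x using cov by blast
        show "bd k \<ge> 0" for k using r0 P by (auto simp: bd_def split: option.split sum.split)
        fix z k assume z: "z \<in> Ve e"
        have "\<forall>k. \<bar>renorm A S a z $ k\<bar> \<le> bd k"
          unfolding all_index_iff
        proof (intro conjI allI)
          show "\<bar>renorm A S a z $ None\<bar> \<le> bd None" using z by (simp add: Ve_def bd_def n)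
          show "\<bar>renorm A S a z $ Some (Inl i)\<bar> \<le> bd (Some (Inl i))" for i
            using z S by (simp add: Ve_def bd_def abs_divide field_simps)
          have "\<bar>real_of_int (z $ Some (Inr j))\<bar> \<le> S * P" for j using z V by (simp add: Ve_def P_def)
          then show "\<bar>renorm A S a z $ Some (Inr j)\<bar> \<le> bd (Some (Inr j))" for j
            using S by (simp add: bd_def abs_divide field_simps)
        qed
        then show "\<bar>renorm A S a z $ k\<bar> \<le> bd k" by blast
      qed
      also have "\<dots> = 2 * ((real ?d + 1) * rho e + D) * ((2 * (rho e + D)) ^ ?d * (2 * (P + D)) ^ ?m)"
        unfolding prod_index by (simp add: bd_def)
      also have "\<dots> \<le> 2 * ((real ?d + 2) * rho e) * ((4 * rho e) ^ ?d * (4 * P) ^ ?m)"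
      proof -
        have "2 * ((real ?d + 1) * rho e + D) \<le> 2 * ((real ?d + 2) * rho e)" using De by (simp add: distrib_right)
        moreover have "(2 * (rho e + D)) ^ ?d \<le> (4 * rho e) ^ ?d" using De D r0 by (intro power_mono) auto
        moreover have "(2 * (P + D)) ^ ?m \<le> (4 * P) ^ ?m" using D P by (intro power_mono) auto
        ultimately show ?thesis
          using r0 P D(1) by (intro mult_mono mult_nonneg_nonneg zero_le_power) auto
      qed
      also have "\<dots> = 2 * (real ?d + 2) * 4 ^ (?d + ?m) * (rho e * rho e ^ ?d * P ^ ?m)"
        by (simp add: power_mult_distrib power_add)
      finally have card: "real (card (Ve e)) \<le> 2 * (real ?d + 2) * 4 ^ (?d + ?m) * (rho e * rho e ^ ?d * P ^ ?m)" .
      have sl: "measure lborel (sl z) \<le> r ^ ?d * (12 / (P ^ n * rho e))" if z: "z \<in> Ve e" for z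
      proof -
        obtain k where k: "S * rho e \<le> 2 * \<bar>lin_form A z (Some k)\<bar>" using z by (auto simp: Ve_def)
        have Sr: "S * rho e > 0" using S r0 by simp
        have b: "(\<chi> i. lin_form A z (Some i)) $ k \<noteq> 0" using k Sr by auto
        have "measure lborel (sl z) \<le> r ^ ?d * (6 * t / (r * \<bar>(\<chi> i. lin_form A z (Some i)) $ k\<bar>))"
          unfolding sl_def by (rule measure_slab_le[OF r(1) t b])
        also have "\<dots> = r ^ ?d * (12 * t / (r * (2 * \<bar>lin_form A z (Some k)\<bar>)))" by simp
        also have "\<dots> \<le> r ^ ?d * (12 * t / (r * (S * rho e)))"
          using t r k Sr by (intro mult_left_mono frac_le) auto
        also have "12 * t / (r * (S * rho e)) = 12 / ((r * S ^ (n + 1)) * P ^ n * rho e)"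
          by (simp add: t_def power_mult_distrib mult_ac)
        finally show ?thesis unfolding r(2) by simp
      qed
      have "(\<Sum>z\<in>Ve e. measure lborel (sl z)) \<le> (\<Sum>z\<in>Ve e. r ^ ?d * (12 / (P ^ n * rho e)))"
        by (intro sum_mono sl)
      also have "\<dots> = real (card (Ve e)) * (r ^ ?d * (12 / (P ^ n * rho e)))" by simp
      also have "\<dots> \<le> 2 * (real ?d + 2) * 4 ^ (?d + ?m) * (rho e * rho e ^ ?d * P ^ ?m) * (r ^ ?d * (12 / (P ^ n * rho e)))"
        using r r0 P by (intro mult_right_mono card) auto
      also have "\<dots> = C1 * r ^ ?d * (rho e / P) ^ ?d"
        using r0 P by (simp add: C1_def n power_add power_divide field_simps)
      also have "rho e / P = K * (1/2) ^ e" using P by (simp add: rho_def power_divide)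
      also have "(K * (1/2) ^ e) ^ ?d = K ^ ?d * ((1/2) ^ e) ^ ?d" by (rule power_mult_distrib)
      also have "C1 * r ^ ?d * (K ^ ?d * ((1/2) ^ e) ^ ?d) \<le> C1 * r ^ ?d * (K ^ ?d * (1/2) ^ e)"
      proof -
        have "((1/2) ^ e) ^ ?d \<le> ((1/2::real) ^ e) ^ 1"
          by (rule power_decreasing) (auto simp: Suc_leI power_le_one)
        then show ?thesis using C1 r K by (intro mult_left_mono) auto
      qed
      finally show ?thesis by (simp add: mult_ac)
    qed
    have "V \<subseteq> (\<Union>e\<in>{..I}. Ve e)" using cover by blast
    then have "(\<Sum>z\<in>V. measure lborel (sl z)) \<le> (\<Sum>z\<in>(\<Union>e\<in>{..I}. Ve e). measure lborel (sl z))"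
      using fV by (intro sum_mono2) (auto simp: Ve_def)
    also have "\<dots> \<le> (\<Sum>e\<in>{..I}. \<Sum>z\<in>Ve e. measure lborel (sl z))"
      by (rule sum_UNION_le) (use fV in \<open>auto simp: Ve_def\<close>)
    also have "\<dots> \<le> (\<Sum>e\<in>{..I}. C1 * K ^ ?d * r ^ ?d * (1/2) ^ e)" by (intro sum_mono Ve_sum)
    also have "\<dots> = C1 * K ^ ?d * r ^ ?d * (\<Sum>e\<in>{..I}. (1/2) ^ e)" by (simp add: sum_distrib_left)
    also have "\<dots> \<le> C1 * K ^ ?d * r ^ ?d * 2"
    proof (rule mult_left_mono)
      have "(\<Sum>e\<in>{..I}. (1/2::real) ^ e) = 2 - (1/2) ^ I"
        by (induction I) (auto simp: field_simps)
      then show "(\<Sum>e\<in>{..I}. (1/2::real) ^ e) \<le> 2" by simp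
    qed (use C1 K r in auto)
    finally show ?thesis by (simp add: sl_def t_def P_def mult_ac)
  qed
  show ?thesis
  proof (intro exI[of _ "2 * C1 * K ^ ?d"] conjI allI impI, goal_cases)
    case 1
    show ?case using C1 K by simp
  next
    case (2 S p a r D V)
    show ?case by (rule main[unfolded n_def, OF 2])
  qed
qed

text \<open>A vector of size \<open>e\<close> has \<open>M\<close> multiples of size at most \<open>1\<close>, each of which contributes a slab.\<close>

lemma measure_short_set_le:
  shows "\<exists>C>0. \<forall>S p a r D e M. S > 0 \<longrightarrow> p \<ge> 1 \<longrightarrow> r > 0 \<longrightarrow> r * S ^ (CARD('d + 'm) + 1) = 1 \<longrightarrow> 0 \<le> D \<longrightarrow> D \<le> p \<longrightarrow>
    (\<forall>x. \<exists>z. \<forall>i. \<bar>(x - renorm (A :: real^'m::finite^('d::finite option)) S a z) $ i\<bar> \<le> D) \<longrightarrow>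
    e \<ge> 0 \<longrightarrow> real M * e \<le> 1 \<longrightarrow>
    real M * measure lborel (short_set A a r (S * p^2) e - bad_set A a r (S * p^2) p) \<le> C * r ^ CARD('d)"
proof -
  define n where "n = CARD('d + 'm)"
  obtain C where C: "C > 0" and sum_le: "\<forall>S p a r D V. S > 0 \<longrightarrow> p \<ge> 1 \<longrightarrow> r > 0 \<longrightarrow> r * S ^ (n + 1) = 1 \<longrightarrow> 0 \<le> D \<longrightarrow> D \<le> p \<longrightarrow>
    (\<forall>x. \<exists>z. \<forall>i. \<bar>(x - renorm A S a z) $ i\<bar> \<le> D) \<longrightarrow> finite V \<longrightarrow>
    (\<forall>z\<in>V. (\<forall>k. \<bar>real_of_int (z $ Some k)\<bar> \<le> S * p^2) \<and> (\<exists>i. \<bar>lin_form A z (Some i)\<bar> > S * p) \<and>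
        slab a r (lin_form A z None) (\<chi> i. lin_form A z (Some i)) (1 / (S * p^2) ^ n) \<noteq> {}) \<longrightarrow>
    (\<Sum>z\<in>V. measure lborel (slab a r (lin_form A z None) (\<chi> i. lin_form A z (Some i)) (1 / (S * p^2) ^ n))) \<le> C * r ^ CARD('d)"
    using slab_sum_le[of A] unfolding n_def[symmetric] by (elim exE conjE) (rule that)
  have main: "real M * measure lborel (short_set A a r (S * p^2) e - bad_set A a r (S * p^2) p) \<le> C * r ^ CARD('d)"
    if S: "S > 0" and p: "p \<ge> 1" and r: "r > 0" "r * S ^ (n + 1) = 1" and D: "0 \<le> D" "D \<le> p"
      and cov: "\<forall>x. \<exists>z. \<forall>i. \<bar>(x - renorm A S a z) $ i\<bar> \<le> D" and e: "e \<ge> 0" "real M * e \<le> 1"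
    for S p a r D e M
  proof -
    define Q where "Q = S * p^2"
    have Q: "Q > 0" using S p by (simp add: Q_def)
    have Qp: "Q / p = S * p" using p by (simp add: Q_def power2_eq_square)
    define sl where "sl z = slab a r (lin_form A z None) (\<chi> i. lin_form A z (Some i)) (1 / Q ^ n)" for z
    define V where "V = {z. (\<forall>k. \<bar>real_of_int (z $ Some k)\<bar> \<le> Q) \<and> (\<exists>i. \<bar>lin_form A z (Some i)\<bar> > S * p) \<and> sl z \<noteq> {}}"
    \<comment> \<open>Finiteness comes from the crude unit-cell count: q2 is bounded by assumption,
      the slopes by \<open>lin_form_Some_le\<close>, and the last entry through a point of the
      nonempty slab.\<close>
    have fV: "finite V"
    proof -
      obtain Y where Y: "\<And>i. \<bar>a $ i\<bar> + r \<le> Y"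
        using exists_max_abs[of "\<lambda>i. \<bar>a $ i\<bar> + r"] by (metis abs_ge_self order_trans)
      have b: "\<bar>lin_form A z i\<bar> \<le> 1 / Q ^ n + real CARD('d) * (Y * (entry_bound A * Q)) + entry_bound A * Q" if zV: "z \<in> V" for z i
      proof -
        have zk: "\<And>k. \<bar>real_of_int (z $ Some k)\<bar> \<le> Q" using zV by (auto simp: V_def)
        obtain y where y: "y \<in> cube a r" "\<bar>aff_form A y z\<bar> \<le> 1 / Q ^ n"
          using zV aff_form_slab[of a r A z "1 / Q ^ n"] unfolding V_def sl_def by auto
        have yY: "\<bar>y $ i\<bar> \<le> Y" for i
        proof -
          have "a $ i \<le> y $ i" "y $ i < a $ i + r" using y(1) by (auto simp: hobox_def)
          then show ?thesis using Y[of i] by linarith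
        qed
        have Y0: "0 \<le> Y" using yY[of undefined] by linarith
        have K0: "0 \<le> entry_bound A * Q" using entry_bound_ge_1[of A] Q by simp
        show ?thesis
        proof (cases i)
          case None
          then show ?thesis using lin_form_None_le[OF y(2) yY lin_form_Some_le[OF zk]] K0 by simp
        next
          case (Some j)
          have "0 \<le> 1 / Q ^ n + real CARD('d) * (Y * (entry_bound A * Q))"
            using Q Y0 K0 entry_bound_ge_1[of A] by (intro add_nonneg_nonneg mult_nonneg_nonneg) auto
          then show ?thesis using lin_form_Some_le[OF zk, of A j] Some by simp
        qed
      qed
      show ?thesis
      proof (cases "V = {}")
        case False
        then obtain z0 where "z0 \<in> V" by blast
        then have "0 \<le> 1 / Q ^ n + real CARD('d) * (Y * (entry_bound A * Q)) + entry_bound A * Q"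
          using b[of z0 None] by linarith
        then show ?thesis
          using Q by (intro conjunct1[OF card_lattice_vectors_unit[OF _ _ _ b, of Q]]) (auto simp: V_def)
      qed simp
    qed
    let ?E = "short_set A a r Q e - bad_set A a r Q p"
    have Esub: "?E \<subseteq> cube a r" by (auto simp: short_set_def)
    have Ef: "?E \<in> fmeasurable lborel"
      by (rule fmeasurable_subset_hobox[OF _ Esub]) (use r in auto)
    have slf: "sl z \<in> fmeasurable lborel" for z
      unfolding sl_def by (rule fmeasurable_subset_hobox[OF slab_borel, of _ _ _ _ _ a "\<lambda>_. r"]) (use r in \<open>auto simp: slab_def\<close>)
    \<comment> \<open>Pointwise form of the multiplicity argument; integrating it over y gives the
      claim.\<close>
    have pt: "real M * indicator ?E y \<le> (\<Sum>z\<in>V. indicator (sl z) y :: real)" for y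
    proof (cases "y \<in> ?E")
      case False
      then show ?thesis by (simp add: sum_nonneg)
    next
      case True
      then obtain z where z: "z \<noteq> 0" "\<And>k. \<bar>real_of_int (z $ Some k)\<bar> \<le> e * Q" "\<bar>aff_form A y z\<bar> \<le> e / Q ^ n"
        and y: "y \<in> cube a r" by (auto simp: short_set_def n_def)
      define f where "f j = (\<chi> i. int (Suc j) * z $ i)" for j
      have fj: "f j \<in> V \<and> y \<in> sl (f j)" if j: "j < M" for j
      proof -
        have Sj: "real (Suc j) * e \<le> 1"
        proof -
          have "real (Suc j) * e \<le> real M * e" using j e by (intro mult_right_mono) auto
          then show ?thesis using e by linarith
        qed
        have fz: "f j \<noteq> 0" using z(1) by (auto simp: f_def vec_eq_iff)
        have 1: "\<bar>real_of_int (f j $ Some k)\<bar> \<le> Q" for k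
        proof -
          have "\<bar>real_of_int (f j $ Some k)\<bar> = real (Suc j) * \<bar>real_of_int (z $ Some k)\<bar>"
            by (simp add: f_def abs_mult)
          also have "\<dots> \<le> real (Suc j) * (e * Q)" by (intro mult_left_mono z(2)) auto
          also have "\<dots> = (real (Suc j) * e) * Q" by simp
          also have "\<dots> \<le> 1 * Q" using Sj Q by (intro mult_right_mono) auto
          finally show ?thesis by simp
        qed
        have 2: "\<bar>aff_form A y (f j)\<bar> \<le> 1 / Q ^ n"
        proof -
          have "aff_form A y (f j) = real (Suc j) * aff_form A y z" unfolding f_def aff_form_scale by simp
          then have "\<bar>aff_form A y (f j)\<bar> = real (Suc j) * \<bar>aff_form A y z\<bar>" by (simp only: abs_mult abs_of_nat)
          also have "\<dots> \<le> real (Suc j) * (e / Q ^ n)" by (intro mult_left_mono z(3)) auto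
          also have "\<dots> = (real (Suc j) * e) / Q ^ n" by simp
          also have "\<dots> \<le> 1 / Q ^ n" using Sj Q by (intro divide_right_mono) auto
          finally show ?thesis .
        qed
        \<comment> \<open>A multiple with all slopes at most S p = Q / p would itself witness that y
          lies in the bad set.\<close>
        have 3: "\<exists>i. \<bar>lin_form A (f j) (Some i)\<bar> > S * p"
        proof (rule ccontr)
          assume "\<not> ?thesis"
          then have "\<forall>i. \<bar>lin_form A (f j) (Some i)\<bar> \<le> Q / p" unfolding Qp by (auto simp: not_less)
          then have "y \<in> bad_set A a r Q p" using 1 2 fz y unfolding bad_set_def n_def by blast
          then show False using True by blast
        qed
        have "y \<in> sl (f j)" unfolding sl_def aff_form_slab[symmetric] using y 2 by simp
        then show ?thesis using 1 3 by (auto simp: V_def)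
      qed
      have inj: "inj_on f {..<M}"
      proof (rule inj_onI)
        fix i j assume "f i = f j"
        moreover obtain k where "z $ k \<noteq> 0" using z(1) by (auto simp: vec_eq_iff)
        ultimately show "i = j" by (auto simp: f_def vec_eq_iff)
      qed
      have "real M = (\<Sum>z\<in>f ` {..<M}. 1)" using card_image[OF inj] by simp
      also have "\<dots> = (\<Sum>z\<in>f ` {..<M}. indicator (sl z) y)" by (rule sum.cong) (use fj in auto)
      also have "\<dots> \<le> (\<Sum>z\<in>V. indicator (sl z) y)"
        by (rule sum_mono2) (use fV fj in auto)
      finally show ?thesis using True by simp
    qed
    have intE: "integrable lborel (indicator ?E :: _ \<Rightarrow> real)" using Ef by (simp add: fmeasurable_def)
    have intS: "integrable lborel (indicator (sl z) :: _ \<Rightarrow> real)" for z using slf by (simp add: fmeasurable_def)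
    have "real M * measure lborel ?E = (\<integral>y. real M * indicator ?E y \<partial>lborel)"
      using intE by (subst integral_mult_right_zero) simp
    also have "\<dots> \<le> (\<integral>y. (\<Sum>z\<in>V. indicator (sl z) y) \<partial>lborel)"
      by (rule integral_mono) (use intE intS pt in auto)
    also have "\<dots> = (\<Sum>z\<in>V. measure lborel (sl z))"
      using intS by (subst Bochner_Integration.integral_sum) auto
    also have "\<dots> \<le> C * r ^ CARD('d)"
      unfolding sl_def Q_def by (rule sum_le[rule_format, OF S p r D]) (use cov fV in \<open>auto simp: V_def sl_def Q_def\<close>)
    finally show ?thesis by (simp add: Q_def)
  qed
  show ?thesis
  proof (intro exI[of _ C] conjI allI impI C, goal_cases)
    case (1 S p a r D e M)
    show ?case by (rule main[unfolded n_def, OF 1])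
  qed
qed

section \<open>Exponential moments along dyadic cubes\<close>

definition dyadic_index :: "nat \<Rightarrow> real^'d::finite \<Rightarrow> int^'d" where
  "dyadic_index k y = (\<chi> i. \<lfloor>2 ^ k * y $ i\<rfloor>)"

definition dyadic_corner :: "nat \<Rightarrow> int^'d::finite \<Rightarrow> real^'d" where
  "dyadic_corner k b = (\<chi> i. of_int (b $ i) / 2 ^ k)"

lemma dyadic_index_eq_iff: "dyadic_index k y = b \<longleftrightarrow> y \<in> cube (dyadic_corner k b) (1 / 2 ^ k)"
proof -
  have "\<lfloor>2 ^ k * u\<rfloor> = v \<longleftrightarrow> of_int v / 2 ^ k \<le> u \<and> u < of_int v / 2 ^ k + 1 / 2 ^ k" for u :: real and v
    unfolding floor_eq_iff add_divide_distrib[symmetric] by (simp add: field_simps)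
  then show ?thesis by (simp add: dyadic_index_def dyadic_corner_def vec_eq_iff hobox_def)
qed

lemma dyadic_index_coarsen:
  assumes "dyadic_index k y = dyadic_index k y'" "j \<le> k"
  shows "dyadic_index j y = dyadic_index j y'"
proof -
  have "\<lfloor>2 ^ j * u\<rfloor> = \<lfloor>2 ^ k * u\<rfloor> div 2 ^ (k - j)" for u :: real
  proof -
    have "(2::real) ^ k = 2 ^ j * 2 ^ (k - j)" using assms(2) by (simp add: power_add[symmetric])
    then have "2 ^ j * u = 2 ^ k * u / real_of_int (2 ^ (k - j))" by simp
    then show ?thesis using floor_divide_real_eq_div[of "2 ^ (k - j)" "2 ^ k * u"] by simp
  qed
  then show ?thesis using assms(1) by (simp add: dyadic_index_def vec_eq_iff)
qed

lemma measurable_dyadic_index [measurable]: "dyadic_index k \<in> borel \<rightarrow>\<^sub>M count_space UNIV"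
proof (rule measurable_count_space_eq_countable[THEN iffD2, OF countableI_type], safe)
  fix b
  have "dyadic_index k -` {b} \<inter> space borel = cube (dyadic_corner k b) (1 / 2 ^ k)" using dyadic_index_eq_iff by auto
  then show "dyadic_index k -` {b} \<inter> space borel \<in> sets borel" by simp
qed simp

lemma dyadic_index_set_borel [measurable]: "{y. P (dyadic_index k y)} \<in> sets borel"
proof -
  have "dyadic_index k -` {b. P b} \<inter> space borel \<in> sets borel" by (rule measurable_sets[OF measurable_dyadic_index]) simp
  then show ?thesis by (simp add: vimage_def)
qed

lemma emeasure_dyadic_index: "emeasure lborel {y. dyadic_index k y = (b :: int^'d::finite)} = ennreal (1 / 2 ^ (k * CARD('d)))"
proof -
  have "{y. dyadic_index k y = b} = cube (dyadic_corner k b) (1 / 2 ^ k)" using dyadic_index_eq_iff by auto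
  then show ?thesis by (simp add: emeasure_hobox power_divide power_mult)
qed

lemma nn_integral_dyadic_split:
  fixes f :: "real^'d::finite \<Rightarrow> ennreal"
  assumes [measurable]: "f \<in> borel_measurable borel"
  shows "(\<integral>\<^sup>+y. f y \<partial>lborel) = (\<integral>\<^sup>+b. (\<integral>\<^sup>+y. f y * indicator {y. dyadic_index k y = b} y \<partial>lborel) \<partial>count_space UNIV)"
proof -
  have "(\<integral>\<^sup>+b. (\<integral>\<^sup>+y. f y * indicator {y. dyadic_index k y = b} y \<partial>lborel) \<partial>count_space UNIV)
      = (\<integral>\<^sup>+y. (\<integral>\<^sup>+b. f y * indicator {y. dyadic_index k y = b} y \<partial>count_space UNIV) \<partial>lborel)"
    by (rule nn_integral_count_space_nn_integral[symmetric]) auto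
  also have "\<dots> = (\<integral>\<^sup>+y. f y \<partial>lborel)"
  proof (rule nn_integral_cong)
    fix y
    have "(\<integral>\<^sup>+b. f y * indicator {y. dyadic_index k y = b} y \<partial>count_space UNIV) = (\<integral>\<^sup>+b. f y * indicator {dyadic_index k y} b \<partial>count_space UNIV)"
      by (rule nn_integral_cong) (auto simp: indicator_def)
    then show "(\<integral>\<^sup>+b. f y * indicator {y. dyadic_index k y = b} y \<partial>count_space UNIV) = f y"
      by (simp add: nn_integral_cmult)
  qed
  finally show ?thesis by simp
qed

text \<open>F is constant on the cubes of level k and comes out of the integral over each of them: a
  conditional expectation given the dyadic partition.\<close>

lemma conditional_step:
  fixes F :: "real^'d::finite \<Rightarrow> ennreal"
  assumes [measurable]: "F \<in> borel_measurable borel" "G \<in> sets borel"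
    and F: "\<And>y y'. dyadic_index k y = dyadic_index k y' \<Longrightarrow> F y = F y'"
    and G: "\<And>b. emeasure lborel ({y. dyadic_index k y = b} \<inter> G) \<le> ennreal eta * emeasure lborel {y. dyadic_index k y = b}"
  shows "(\<integral>\<^sup>+y. F y * indicator G y \<partial>lborel) \<le> ennreal eta * (\<integral>\<^sup>+y. F y \<partial>lborel)"
proof -
  have "(\<integral>\<^sup>+y. F y * indicator G y * indicator {y. dyadic_index k y = b} y \<partial>lborel)
     \<le> ennreal eta * (\<integral>\<^sup>+y. F y * indicator {y. dyadic_index k y = b} y \<partial>lborel)" for b
  proof -
    define yb where "yb = dyadic_corner k b"
    have yb: "dyadic_index k yb = b" unfolding dyadic_index_eq_iff yb_def by (simp add: hobox_def)
    have Fb: "F y = F yb" if "dyadic_index k y = b" for y using F[of y yb] yb that by simp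
    have m: "{y. dyadic_index k y = b} \<in> sets borel" by (rule dyadic_index_set_borel)
    have "(\<integral>\<^sup>+y. F y * indicator G y * indicator {y. dyadic_index k y = b} y \<partial>lborel)
       = (\<integral>\<^sup>+y. F yb * indicator ({y. dyadic_index k y = b} \<inter> G) y \<partial>lborel)"
      using Fb by (intro nn_integral_cong) (auto simp: indicator_def)
    also have "\<dots> = F yb * emeasure lborel ({y. dyadic_index k y = b} \<inter> G)"
      using m by (subst nn_integral_cmult_indicator) auto
    also have "\<dots> \<le> F yb * (ennreal eta * emeasure lborel {y. dyadic_index k y = b})" by (intro mult_left_mono G) simp
    also have "\<dots> = ennreal eta * (F yb * emeasure lborel {y. dyadic_index k y = b})" by (simp add: mult_ac)
    also have "F yb * emeasure lborel {y. dyadic_index k y = b} = (\<integral>\<^sup>+y. F yb * indicator {y. dyadic_index k y = b} y \<partial>lborel)"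
      using m by (subst nn_integral_cmult_indicator) auto
    also have "\<dots> = (\<integral>\<^sup>+y. F y * indicator {y. dyadic_index k y = b} y \<partial>lborel)"
      using Fb by (intro nn_integral_cong) (auto simp: indicator_def)
    finally show ?thesis .
  qed
  then have "(\<integral>\<^sup>+b. (\<integral>\<^sup>+y. F y * indicator G y * indicator {y. dyadic_index k y = b} y \<partial>lborel) \<partial>count_space UNIV)
     \<le> (\<integral>\<^sup>+b. ennreal eta * (\<integral>\<^sup>+y. F y * indicator {y. dyadic_index k y = b} y \<partial>lborel) \<partial>count_space UNIV)"
    by (intro nn_integral_mono)
  then show ?thesis
    using nn_integral_dyadic_split[of "\<lambda>y. F y * indicator G y" k] nn_integral_dyadic_split[of F k]
    by (simp add: nn_integral_cmult)
qed

text \<open>2 to the number of hits is the product of the factors 1 +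
  \<open>indicator (G l) y\<close>. The factors with l < L are constant on cubes of level
  \<open>t L\<close>, so \<open>conditional_step\<close> makes the factor of \<open>G L\<close> cost
  at most 1 + eta.\<close>

lemma exponential_moment:
  fixes G :: "nat \<Rightarrow> (real^'d::finite) set"
  assumes t: "mono t" and G: "\<And>l y y'. dyadic_index (t (Suc l)) y = dyadic_index (t (Suc l)) y' \<Longrightarrow> y \<in> G l \<longleftrightarrow> y' \<in> G l"
    and Gb [measurable]: "\<And>l. G l \<in> sets borel"
    and cond: "\<And>l b. emeasure lborel ({y. dyadic_index (t l) y = b} \<inter> G l) \<le> ennreal eta * emeasure lborel {y. dyadic_index (t l) y = b}"
    and eta: "eta \<ge> 0"
  shows "(\<integral>\<^sup>+y. indicator {y. dyadic_index 0 y = c0} y * ennreal (2 ^ card {l. l < L \<and> y \<in> G l}) \<partial>lborel) \<le> ennreal ((1 + eta) ^ L)"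
proof (induction L)
  case 0
  have "{y. dyadic_index 0 y = c0} \<in> sets borel" by (rule dyadic_index_set_borel)
  then show ?case by (simp add: emeasure_dyadic_index)
next
  case (Suc L)
  define F where "F y = indicator {y. dyadic_index 0 y = c0} y * ennreal (2 ^ card {l. l < L \<and> y \<in> G l})" for y :: "real^'d"
  have [measurable]: "{y. dyadic_index 0 y = c0} \<in> sets borel" by (rule dyadic_index_set_borel)
  have cardeq: "real (2 ^ card {l. l < L \<and> y \<in> G l}) = (\<Prod>l<L. 1 + indicator (G l) y)" for L y
  proof (induction L)
    case (Suc L)
    have "{l. l < Suc L \<and> y \<in> G l} = {l. l < L \<and> y \<in> G l} \<union> (if y \<in> G L then {L} else {})"
      by (auto simp: less_Suc_eq)
    then have "card {l. l < Suc L \<and> y \<in> G l} = card {l. l < L \<and> y \<in> G l} + (if y \<in> G L then 1 else 0)" by simp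
    then show ?case using Suc by (auto simp: indicator_def)
  qed simp
  have Fm [measurable]: "F \<in> borel_measurable borel"
  proof -
    have "F y = indicator {y. dyadic_index 0 y = c0} y * ennreal (\<Prod>l<L. 1 + indicator (G l) y)" for y
      unfolding F_def using cardeq[of L y] by simp
    then show ?thesis by (subst measurable_cong) (auto, measurable)
  qed
  have Fc: "F y = F y'" if eq: "dyadic_index (t L) y = dyadic_index (t L) y'" for y y'
  proof -
    have "(y \<in> G l) = (y' \<in> G l)" if "l < L" for l
    proof (rule G)
      show "dyadic_index (t (Suc l)) y = dyadic_index (t (Suc l)) y'"
        by (rule dyadic_index_coarsen[OF eq monoD[OF t]]) (use that in simp)
    qed
    then have "{l. l < L \<and> y \<in> G l} = {l. l < L \<and> y' \<in> G l}" by auto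
    moreover have "dyadic_index 0 y = dyadic_index 0 y'" using dyadic_index_coarsen[OF eq] by simp
    ultimately show ?thesis by (simp add: F_def indicator_def)
  qed
  have "indicator {y. dyadic_index 0 y = c0} y * ennreal (2 ^ card {l. l < Suc L \<and> y \<in> G l}) = F y + F y * indicator (G L) y" for y
  proof -
    have "(2::real) ^ card {l. l < Suc L \<and> y \<in> G l} = 2 ^ card {l. l < L \<and> y \<in> G l} * (1 + indicator (G L) y)"
      using cardeq[of "Suc L" y] cardeq[of L y] by simp
    then have "ennreal (2 ^ card {l. l < Suc L \<and> y \<in> G l}) = ennreal (2 ^ card {l. l < L \<and> y \<in> G l}) * (1 + indicator (G L) y)"
      by (auto simp: indicator_def ennreal_mult'' ennreal_plus[symmetric] simp del: ennreal_plus)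
    then show ?thesis by (simp add: F_def distrib_left mult.assoc)
  qed
  then have "(\<integral>\<^sup>+y. indicator {y. dyadic_index 0 y = c0} y * ennreal (2 ^ card {l. l < Suc L \<and> y \<in> G l}) \<partial>lborel)
     = (\<integral>\<^sup>+y. F y \<partial>lborel) + (\<integral>\<^sup>+y. F y * indicator (G L) y \<partial>lborel)"
    by (simp add: nn_integral_add)
  also have "\<dots> \<le> (\<integral>\<^sup>+y. F y \<partial>lborel) + ennreal eta * (\<integral>\<^sup>+y. F y \<partial>lborel)"
    by (intro add_left_mono conditional_step[OF _ _ Fc cond]) auto
  also have "\<dots> = ennreal (1 + eta) * (\<integral>\<^sup>+y. F y \<partial>lborel)"
    using eta by (simp add: distrib_right ennreal_plus)
  also have "\<dots> \<le> ennreal (1 + eta) * ennreal ((1 + eta) ^ L)"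
    using Suc.IH unfolding F_def by (intro mult_left_mono) auto
  also have "\<dots> = ennreal ((1 + eta) ^ Suc L)" using eta by (simp add: ennreal_mult'')
  finally show ?case .
qed

text \<open>Markov's inequality for the exponential moment.\<close>

lemma many_hits_le:
  fixes G :: "nat \<Rightarrow> (real^'d::finite) set"
  assumes t: "mono t" and G: "\<And>l y y'. dyadic_index (t (Suc l)) y = dyadic_index (t (Suc l)) y' \<Longrightarrow> y \<in> G l \<longleftrightarrow> y' \<in> G l"
    and Gb [measurable]: "\<And>l. G l \<in> sets borel"
    and cond: "\<And>l b. emeasure lborel ({y. dyadic_index (t l) y = b} \<inter> G l) \<le> ennreal eta * emeasure lborel {y. dyadic_index (t l) y = b}"
    and eta: "0 \<le> eta"
  shows "measure lborel {y. dyadic_index 0 y = c0 \<and> theta \<le> real (card {l. l < L \<and> y \<in> G l})} \<le> (1 + eta) ^ L / 2 powr theta"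
    and "{y. dyadic_index 0 y = c0 \<and> theta \<le> real (card {l. l < L \<and> y \<in> G l})} \<in> sets borel"
proof -
  let ?E = "{y. dyadic_index 0 y = c0 \<and> theta \<le> real (card {l. l < L \<and> y \<in> G l})}"
  have eq: "real (card {l. l < L \<and> y \<in> G l}) = (\<Sum>l<L. indicator (G l) y)" for y
  proof -
    have "(\<Sum>l<L. indicator (G l) y) = (\<Sum>l\<in>{l. l < L \<and> y \<in> G l}. 1 :: real)"
      by (rule sum.mono_neutral_cong_right) (auto simp: indicator_def)
    then show ?thesis by simp
  qed
  have m0 [measurable]: "{y. dyadic_index 0 y = c0} \<in> sets borel" by (rule dyadic_index_set_borel)
  have "{y. theta \<le> (\<Sum>l<L. indicator (G l) y :: real)} \<in> sets borel"
    by (rule borel_measurable_le[of _ borel, simplified]) measurable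
  moreover have "?E = {y. dyadic_index 0 y = c0} \<inter> {y. theta \<le> (\<Sum>l<L. indicator (G l) y :: real)}" unfolding eq by auto
  ultimately show Em: "?E \<in> sets borel" using m0 by auto
  have "ennreal (2 powr theta) * emeasure lborel ?E = (\<integral>\<^sup>+y. ennreal (2 powr theta) * indicator ?E y \<partial>lborel)"
    using Em by (simp add: nn_integral_cmult_indicator)
  also have "\<dots> \<le> (\<integral>\<^sup>+y. indicator {y. dyadic_index 0 y = c0} y * ennreal (2 ^ card {l. l < L \<and> y \<in> G l}) \<partial>lborel)"
  proof (rule nn_integral_mono)
    fix y
    have "2 powr theta \<le> 2 ^ card {l. l < L \<and> y \<in> G l}" if "y \<in> ?E"
    proof -
      have "2 powr theta \<le> 2 powr real (card {l. l < L \<and> y \<in> G l})" using that by (intro powr_mono) auto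
      then show ?thesis by (simp add: powr_realpow)
    qed
    then show "ennreal (2 powr theta) * indicator ?E y \<le> indicator {y. dyadic_index 0 y = c0} y * ennreal (2 ^ card {l. l < L \<and> y \<in> G l})"
      by (auto simp: indicator_def intro!: ennreal_leI)
  qed
  also have "\<dots> \<le> ennreal ((1 + eta) ^ L)" by (rule exponential_moment[OF t G Gb cond eta])
  finally have le: "ennreal (2 powr theta) * emeasure lborel ?E \<le> ennreal ((1 + eta) ^ L)" .
  have "emeasure lborel ?E \<le> emeasure lborel {y. dyadic_index 0 y = c0}" by (rule emeasure_mono) auto
  then have "emeasure lborel ?E = ennreal (measure lborel ?E)"
    by (intro emeasure_eq_ennreal_measure) (auto simp: emeasure_dyadic_index top_unique)
  then have "ennreal (2 powr theta * measure lborel ?E) \<le> ennreal ((1 + eta) ^ L)" using le by (simp add: ennreal_mult'')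
  then have "2 powr theta * measure lborel ?E \<le> (1 + eta) ^ L" using eta by (simp add: ennreal_le_iff)
  then show "measure lborel ?E \<le> (1 + eta) ^ L / 2 powr theta" by (simp add: field_simps)
qed

section \<open>Exceptional dyadic cubes\<close>

text \<open>\<open>c0\<close> selects a unit cube. The first moment bounds depend on the size of y,
  so statements for almost every y are proved one unit cube at a time.\<close>

locale dioph_data =
  fixes A :: "real^'m::finite^('d::finite option)" and w c :: real and c0 :: "int^'d"
  assumes db: "dioph_bound A w c" and w: "real CARD('d + 'm) - 1 \<le> w" "w < real CARD('d + 'm)"
    and c: "0 < c" "c \<le> 1"
begin

definition ndim :: nat where "ndim = CARD('d + 'm)"

text \<open>The contraction e^(t/(n+1)) at time t = k ln 2. Its power n + 1 is 2^k, the reciprocal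
  of the side of a cube of level k, which is the relation between r and S in
  \<open>slab_sum_le\<close>.\<close>

definition dilation :: "nat \<Rightarrow> real" where "dilation k = 2 powr (real k / real (ndim + 1))"

text \<open>The square root of \<open>dilation\<close>, used as the parameter p: then S p^2 at level
  s becomes the dilation of level s + R.\<close>

definition half_dilation :: "nat \<Rightarrow> real" where "half_dilation k = 2 powr (real k / (2 * real (ndim + 1)))"

definition a0 :: "real^'d" where "a0 = dyadic_corner 0 c0"

lemma ndim_eq: "ndim = CARD('d) + CARD('m)" by (simp add: ndim_def)

lemma ndim_ge_2: "ndim \<ge> 2"
proof -
  have "CARD('d) \<ge> 1" "CARD('m) \<ge> 1" by (simp_all add: Suc_leI)
  then show ?thesis unfolding ndim_eq by linarith
qed

lemma w_nn: "real ndim - 1 \<le> w" "w < real ndim" using w by (simp_all add: ndim_def)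

lemma w_ge: "w \<ge> real CARD('m)" "w \<ge> 1"
proof -
  have "CARD('d) \<ge> 1" by (simp add: Suc_leI)
  then have "real CARD('m) \<le> real ndim - 1" unfolding ndim_eq by simp
  then show "w \<ge> real CARD('m)" using w_nn by linarith
  show "w \<ge> 1" using w_nn ndim_ge_2 by linarith
qed

lemma dilation_ge_1: "dilation k \<ge> 1" and dilation_pos: "dilation k > 0"
  unfolding dilation_def by (simp_all add: ge_one_powr_ge_zero)

lemma dilation_add: "dilation (k + l) = dilation k * dilation l"
  unfolding dilation_def by (simp add: add_divide_distrib powr_add)

lemma dilation_power: "dilation k ^ (ndim + 1) = 2 ^ k"
proof -
  have "dilation k ^ (ndim + 1) = dilation k powr real (ndim + 1)" using dilation_pos by (simp add: powr_realpow del: of_nat_add of_nat_Suc)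
  also have "\<dots> = 2 powr real k" unfolding dilation_def powr_powr by simp
  finally show ?thesis by (simp add: powr_realpow)
qed

lemma half_dilation_ge_1: "half_dilation k \<ge> 1"
  unfolding half_dilation_def by (simp add: ge_one_powr_ge_zero)

lemma half_dilation_sq: "half_dilation k ^ 2 = dilation k"
proof -
  have "real k / (2 * real (ndim + 1)) = real k / real (ndim + 1) / 2" by simp
  then show ?thesis unfolding half_dilation_def dilation_def power2_eq_square powr_add[symmetric] by (simp only: field_sum_of_halves)
qed

lemma cube_a0: "{y. dyadic_index 0 y = c0} = cube a0 1"
  unfolding dyadic_index_eq_iff a0_def by simp

text \<open>At time k ln 2 some nonzero vector of the orbit lattice has all coordinates at most e in
  modulus.\<close>

definition short :: "nat \<Rightarrow> real \<Rightarrow> real^'d \<Rightarrow> bool" where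
  "short k e y \<longleftrightarrow> (\<exists>z. z \<noteq> 0 \<and> (\<forall>j. \<bar>real_of_int (z $ Some j)\<bar> \<le> e * dilation k) \<and> \<bar>aff_form A y z\<bar> \<le> e / dilation k ^ ndim)"

text \<open>Enlarged to a union of dyadic cubes of level \<open>k\<close>; by \<open>short_of_hit_set\<close> this costs a constant factor.\<close>

definition hit_set :: "nat \<Rightarrow> real \<Rightarrow> (real^'d) set" where
  "hit_set k e = {y. \<exists>y'. dyadic_index k y' = dyadic_index k y \<and> short k e y'}"

definition spread :: real where "spread = 1 + real CARD('d) * entry_bound A"

lemma spread_ge_1: "spread \<ge> 1"
  using entry_bound_ge_1[of A] by (simp add: spread_def)

lemma hit_set_borel [measurable, simp]: "hit_set k e \<in> sets borel"
  using dyadic_index_set_borel[of "\<lambda>b. \<exists>y'. dyadic_index k y' = b \<and> short k e y'" k] by (simp add: hit_set_def)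

lemma aff_form_diff_le:
  assumes "y \<in> cube a r" "y' \<in> cube a r" "\<And>i. \<bar>lin_form A z (Some i)\<bar> \<le> l"
  shows "\<bar>aff_form A y z - aff_form A y' z\<bar> \<le> real CARD('d) * (r * l)"
proof -
  have "aff_form A y z - aff_form A y' z = (\<Sum>i\<in>UNIV. (y $ i - y' $ i) * lin_form A z (Some i))"
    by (simp add: aff_form_def sum_subtractf left_diff_distrib)
  moreover have "\<bar>\<Sum>i\<in>UNIV. (y $ i - y' $ i) * lin_form A z (Some i)\<bar> \<le> (\<Sum>i\<in>(UNIV::'d set). r * l)"
  proof (intro order_trans[OF sum_abs] sum_mono)
    fix i
    have "a $ i \<le> y $ i" "y $ i < a $ i + r" "a $ i \<le> y' $ i" "y' $ i < a $ i + r"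
      using assms(1,2) by (auto simp: hobox_def)
    then have "\<bar>y $ i - y' $ i\<bar> \<le> r" "0 \<le> r" by linarith+
    then show "\<bar>(y $ i - y' $ i) * lin_form A z (Some i)\<bar> \<le> r * l"
      unfolding abs_mult using assms(3)[of i] by (intro mult_mono) auto
  qed
  ultimately show ?thesis by simp
qed

text \<open>A cube of level k has side \<open>dilation k\<close> to the power -(n+1), and the slopes
  of z are at most \<open>entry_bound A\<close> times e \<open>dilation k\<close>. Hence the affine
  form changes across the cube by at most \<open>spread\<close> - 1 times the bound e /
  \<open>dilation k ^ ndim\<close>.\<close>

lemma short_of_hit_set:
  assumes "y \<in> hit_set k e" "e \<ge> 0"
  shows "short k (spread * e) y"
proof -
  obtain y' z where y': "dyadic_index k y' = dyadic_index k y" and z: "z \<noteq> 0" "\<And>j. \<bar>real_of_int (z $ Some j)\<bar> \<le> e * dilation k" "\<bar>aff_form A y' z\<bar> \<le> e / dilation k ^ ndim"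
    using assms(1) by (auto simp: hit_set_def short_def)
  have cubes: "y \<in> cube (dyadic_corner k (dyadic_index k y)) (1 / 2 ^ k)" "y' \<in> cube (dyadic_corner k (dyadic_index k y)) (1 / 2 ^ k)"
    using y' dyadic_index_eq_iff by auto
  have "\<bar>lin_form A z (Some i)\<bar> \<le> entry_bound A * (e * dilation k)" for i by (rule lin_form_Some_le[OF z(2)])
  from aff_form_diff_le[OF cubes this]
  have "\<bar>aff_form A y z - aff_form A y' z\<bar> \<le> real CARD('d) * (1 / 2 ^ k * (entry_bound A * (e * dilation k)))" .
  also have "\<dots> = real CARD('d) * entry_bound A * e / dilation k ^ ndim"
    unfolding dilation_power[symmetric] using dilation_pos[of k] by (simp add: field_simps)
  finally have "\<bar>aff_form A y z\<bar> \<le> e / dilation k ^ ndim + real CARD('d) * entry_bound A * e / dilation k ^ ndim"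
    using z(3) by linarith
  then have f: "\<bar>aff_form A y z\<bar> \<le> spread * e / dilation k ^ ndim" by (simp add: spread_def add_divide_distrib distrib_right)
  have "\<bar>real_of_int (z $ Some j)\<bar> \<le> spread * e * dilation k" for j
  proof -
    have "1 * (e * dilation k) \<le> spread * (e * dilation k)" using spread_ge_1 assms(2) dilation_pos[of k] by (intro mult_right_mono) auto
    then show ?thesis using z(2)[of j] by simp
  qed
  then show ?thesis using z(1) f unfolding short_def by blast
qed

text \<open>The cube b of level s has volume 2^(-s d), so this bounds by eta the conditional
  probability of a hit R levels later.\<close>

definition nice :: "real \<Rightarrow> real \<Rightarrow> nat \<Rightarrow> nat \<Rightarrow> int^'d \<Rightarrow> bool" where
  "nice eta e s R b \<longleftrightarrow> measure lborel ({y. dyadic_index s y = b} \<inter> hit_set (s + R) e) \<le> eta / 2 ^ (s * CARD('d))"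

definition not_nice_set :: "real \<Rightarrow> real \<Rightarrow> nat \<Rightarrow> nat \<Rightarrow> (real^'d) set" where
  "not_nice_set eta e s R = {y. dyadic_index 0 y = c0 \<and> \<not> nice eta e s R (dyadic_index s y)}"

lemma not_nice_set_borel [simp]: "not_nice_set eta e s R \<in> sets borel"
proof -
  have "not_nice_set eta e s R = {y. dyadic_index 0 y = c0} \<inter> {y. \<not> nice eta e s R (dyadic_index s y)}" by (auto simp: not_nice_set_def)
  then show ?thesis using dyadic_index_set_borel[of "\<lambda>b. b = c0" 0] dyadic_index_set_borel[of "\<lambda>b. \<not> nice eta e s R b" s] by auto
qed

definition short_cell_set :: "nat \<Rightarrow> real \<Rightarrow> (real^'d) set" where
  "short_cell_set s del = near_set A a0 (dilation s) ((1 + real CARD('d)) * del / dilation s ^ ndim) (dilation s)"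

definition bad_region :: "nat \<Rightarrow> nat \<Rightarrow> (real^'d) set" where
  "bad_region k R = bad_set A a0 1 (dilation k) (half_dilation R)"

lemma measure_mono_cube:
  assumes "E \<subseteq> F" "F \<subseteq> cube a r" "E \<in> sets borel" "F \<in> sets borel" "r \<ge> 0"
  shows "measure lborel E \<le> measure lborel F"
  by (rule measure_mono_fmeasurable[OF assms(1)]) (use assms fmeasurable_subset_hobox[OF assms(4,2)] in auto)

text \<open>Without vectors shorter than \<open>del\<close> at the corner, the covering radius is at
  most C / del^n, and the hypothesis makes it at most p = \<open>half_dilation R\<close>. So
  \<open>measure_short_set_le\<close> applies from level s to level s + R; only the bad set remains
  uncontrolled. The number e depends on eta but not on s, R or b.\<close>

lemma nice_of_no_short:
  "\<exists>e>0. \<exists>C>0. \<forall>s R b del. del > 0 \<longrightarrow> del \<le> 1 \<longrightarrow> C / del ^ ndim \<le> half_dilation R \<longrightarrow>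
     (\<forall>z. z \<noteq> 0 \<longrightarrow> del \<le> norm (renorm A (dilation s) (dyadic_corner s b) z)) \<longrightarrow>
     measure lborel ({y. dyadic_index s y = b} \<inter> hit_set (s + R) e)
       \<le> eta / 2 / 2 ^ (s * CARD('d)) + measure lborel (bad_set A (dyadic_corner s b) (1 / 2 ^ s) (dilation (s + R)) (half_dilation R))"
  if eta: "eta > 0"
proof -
  obtain C1 where C1: "C1 > 0" and loc: "\<forall>S p a r D e M. S > 0 \<longrightarrow> p \<ge> 1 \<longrightarrow> r > 0 \<longrightarrow> r * S ^ (ndim + 1) = 1 \<longrightarrow> 0 \<le> D \<longrightarrow> D \<le> p \<longrightarrow>
    (\<forall>x. \<exists>z. \<forall>i. \<bar>(x - renorm A S a z) $ i\<bar> \<le> D) \<longrightarrow>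
    e \<ge> 0 \<longrightarrow> real M * e \<le> 1 \<longrightarrow>
    real M * measure lborel (short_set A a r (S * p^2) e - bad_set A a r (S * p^2) p) \<le> C1 * r ^ CARD('d)"
    using measure_short_set_le[of A] unfolding ndim_def[symmetric] by (elim exE conjE) (rule that)
  obtain C where C: "C > 0" and cov: "\<forall>A :: real^'m^('d option). \<forall>S y d. S > 0 \<longrightarrow> 0 < d \<longrightarrow> d \<le> 1 \<longrightarrow>
     (\<forall>z. z \<noteq> 0 \<longrightarrow> d \<le> norm (renorm A S y z)) \<longrightarrow> (\<forall>x. \<exists>z. \<forall>i. \<bar>(x - renorm A S y z) $ i\<bar> \<le> C / d ^ ndim)"
    using covering_renorm[where 'd = 'd and 'm = 'm] unfolding ndim_def[symmetric] by (elim exE conjE) (rule that)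
  \<comment> \<open>M makes C1 / M at most eta / 2, and e is reduced by \<open>spread\<close> to
    allow for the loss in \<open>short_of_hit_set\<close>.\<close>
  define M where "M = nat \<lceil>2 * C1 / eta\<rceil> + 1"
  have M: "real M \<ge> 2 * C1 / eta" "real M \<ge> 1" unfolding M_def by linarith+
  define e where "e = 1 / (spread * real M)"
  have e: "e > 0" using spread_ge_1 M by (simp add: e_def)
  have "measure lborel ({y. dyadic_index s y = b} \<inter> hit_set (s + R) e)
       \<le> eta / 2 / 2 ^ (s * CARD('d)) + measure lborel (bad_set A (dyadic_corner s b) (1 / 2 ^ s) (dilation (s + R)) (half_dilation R))"
    if del: "del > 0" "del \<le> 1" "C / del ^ ndim \<le> half_dilation R" and sh: "\<forall>z. z \<noteq> 0 \<longrightarrow> del \<le> norm (renorm A (dilation s) (dyadic_corner s b) z)"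
    for s R b del
  proof -
    define a where "a = dyadic_corner s b"
    define r :: real where "r = 1 / 2 ^ s"
    define Sh where "Sh = short_set A a r (dilation s * half_dilation R ^ 2) (spread * e)"
    define Bd where "Bd = bad_set A a r (dilation s * half_dilation R ^ 2) (half_dilation R)"
    have r: "r > 0" "r * dilation s ^ (ndim + 1) = 1" unfolding dilation_power by (simp_all add: r_def)
    have scs: "dilation s * half_dilation R ^ 2 = dilation (s + R)" by (simp add: half_dilation_sq dilation_add)
    have "\<forall>x. \<exists>z. \<forall>i. \<bar>(x - renorm A (dilation s) a z) $ i\<bar> \<le> C / del ^ ndim"
      using cov dilation_pos[of s] del sh unfolding a_def by blast
    moreover have "real M * (spread * e) \<le> 1" using M spread_ge_1 by (simp add: e_def)
    moreover have "0 \<le> C / del ^ ndim" using C del by simp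
    moreover have "0 \<le> spread * e" using spread_ge_1 e by simp
    ultimately have "real M * measure lborel (Sh - Bd) \<le> C1 * r ^ CARD('d)"
      using loc[rule_format, OF dilation_pos half_dilation_ge_1 r, of "C / del ^ ndim" R a "spread * e" M] del unfolding Sh_def Bd_def by blast
    moreover have "2 * C1 / eta * measure lborel (Sh - Bd) \<le> real M * measure lborel (Sh - Bd)"
      by (intro mult_right_mono M) simp
    ultimately have "2 * C1 / eta * measure lborel (Sh - Bd) \<le> C1 * r ^ CARD('d)" by linarith
    then have 1: "measure lborel (Sh - Bd) \<le> eta / 2 * r ^ CARD('d)" using C1 eta by (simp add: field_simps)
    have B: "{y. dyadic_index s y = b} = cube a r" unfolding dyadic_index_eq_iff a_def r_def by auto
    have sub: "{y. dyadic_index s y = b} \<inter> hit_set (s + R) e \<subseteq> Sh"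
    proof
      fix y assume y: "y \<in> {y. dyadic_index s y = b} \<inter> hit_set (s + R) e"
      then have "short (s + R) (spread * e) y" using short_of_hit_set e by simp
      then show "y \<in> Sh" using y B unfolding Sh_def scs short_set_def short_def ndim_def by auto
    qed
    have Shc: "Sh \<subseteq> cube a r" and Bdc: "Bd \<subseteq> cube a r" by (auto simp: Sh_def Bd_def short_set_def bad_set_def)
    have "measure lborel ({y. dyadic_index s y = b} \<inter> hit_set (s + R) e) \<le> measure lborel ((Sh - Bd) \<union> Bd)"
      by (rule measure_mono_cube[of _ _ a r]) (use sub Shc Bdc r in \<open>auto simp: B Sh_def Bd_def\<close>)
    also have "\<dots> \<le> measure lborel (Sh - Bd) + measure lborel Bd"
      by (rule measure_Un_le) (auto simp: Sh_def Bd_def)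
    finally show ?thesis using 1 unfolding Bd_def scs by (simp add: r_def a_def power_divide power_mult)
  qed
  then show ?thesis using e C by (intro exI[of _ e] exI[of _ C] conjI allI impI) auto
qed

text \<open>Moving from the corner to any point of the cube changes the affine form by at most d del
  / \<open>dilation s ^ ndim\<close>; this is the origin of the factor 1 + d in
  \<open>short_cell_set\<close>.\<close>

lemma short_cell_set_of_short:
  assumes z: "z \<noteq> 0" "norm (renorm A (dilation s) (dyadic_corner s b) z) < del" and del: "0 < del" "del \<le> 1"
    and y: "dyadic_index s y = b" "dyadic_index 0 y = c0"
  shows "y \<in> short_cell_set s del"
proof -
  have comp: "\<bar>renorm A (dilation s) (dyadic_corner s b) z $ k\<bar> \<le> del" for k
    using component_le_norm_cart[of "renorm A (dilation s) (dyadic_corner s b) z" k] z(2) by linarith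
  have l: "\<bar>lin_form A z (Some i)\<bar> \<le> del * dilation s" for i
    using comp[of "Some (Inl i)"] dilation_pos[of s] by (simp add: abs_divide field_simps)
  have q: "\<bar>real_of_int (z $ Some (Inr j))\<bar> \<le> del * dilation s" for j
    using comp[of "Some (Inr j)"] dilation_pos[of s] by (simp add: abs_divide field_simps)
  have fa: "\<bar>aff_form A (dyadic_corner s b) z\<bar> \<le> del / dilation s ^ ndim"
    using comp[of None] dilation_pos[of s] by (simp add: abs_mult field_simps ndim_eq)
  have "y \<in> cube (dyadic_corner s b) (1 / 2 ^ s)" using y dyadic_index_eq_iff by auto
  moreover have "dyadic_corner s b \<in> cube (dyadic_corner s b) (1 / 2 ^ s)" by (simp add: hobox_def)
  ultimately have "\<bar>aff_form A y z - aff_form A (dyadic_corner s b) z\<bar> \<le> real CARD('d) * (1 / 2 ^ s * (del * dilation s))"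
    using aff_form_diff_le[OF _ _ l] by blast
  also have "\<dots> = real CARD('d) * del / dilation s ^ ndim"
    unfolding dilation_power[symmetric] using dilation_pos[of s] by (simp add: field_simps)
  finally have "\<bar>aff_form A y z\<bar> \<le> (1 + real CARD('d)) * del / dilation s ^ ndim"
    using fa by (simp add: distrib_right add_divide_distrib)
  moreover have "del * dilation s \<le> dilation s" using del dilation_pos[of s] by simp
  then have "\<bar>real_of_int (z $ Some (Inr j))\<bar> \<le> dilation s" "\<bar>lin_form A z (Some i)\<bar> \<le> dilation s" for i j
    using l[of i] q[of j] by linarith+
  moreover have "y \<in> cube a0 1" using y cube_a0 by blast
  ultimately show ?thesis using z(1) unfolding short_cell_set_def near_set_def by blast
qed

text \<open>Two instances of \<open>measure_near_set_le\<close> with X = \<open>dilation s\<close>.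
  For rho = X and t of order del X^(-n) the bound is del (X^(w-n) + 1); for rho = X / p and t =
  X^(-n) it is X^(w-n) + p^(-d). The factor s + 1 counts dyadic classes.\<close>

lemma measure_short_cell_bad:
  "\<exists>C>0. \<exists>s0. \<forall>s\<ge>s0. (\<forall>del. 0 < del \<longrightarrow> del \<le> 1 \<longrightarrow> measure lborel (short_cell_set s del) \<le> C * real (s + 1) * del) \<and>
     (\<forall>R. measure lborel (bad_region s R) \<le> C * real (s + 1) * (dilation s powr (w - real ndim) + 1 / half_dilation R))"
proof -
  obtain k where k: "\<And>i. \<bar>\<bar>a0 $ i\<bar>\<bar> \<le> \<bar>\<bar>a0 $ k\<bar>\<bar>" using exists_max_abs[of "\<lambda>i. \<bar>a0 $ i\<bar>"] by blast
  define Y where "Y = \<bar>a0 $ k\<bar> + 1"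
  have Y: "\<bar>y $ i\<bar> \<le> Y" if "y \<in> cube a0 1" for y i
  proof -
    have "a0 $ i \<le> y $ i" "y $ i < a0 $ i + 1" using that by (auto simp: hobox_def)
    then show ?thesis using k[of i] unfolding Y_def by linarith
  qed
  have Y1: "Y \<ge> 1" by (simp add: Y_def)
  obtain C c' where C: "C > 0" and c': "c' > 0" and near: "\<forall>X t rho I. X \<ge> 1 \<longrightarrow> t > 0 \<longrightarrow> rho > 0 \<longrightarrow> t \<le> c / 2 * X powr (- w) \<longrightarrow>
     rho \<le> c' * X powr (- w) * 2 ^ I \<longrightarrow>
     measure lborel (near_set A a0 X t rho) \<le> C * real (I + 1) * t * (X powr w + X ^ CARD('m) * rho ^ CARD('d))"
  proof -
    have "\<exists>C>0. \<exists>c'>0. \<forall>X t rho I. X \<ge> 1 \<longrightarrow> t > 0 \<longrightarrow> rho > 0 \<longrightarrow> t \<le> c / 2 * X powr (- w) \<longrightarrow>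
       rho \<le> c' * X powr (- w) * 2 ^ I \<longrightarrow>
       measure lborel (near_set A a0 X t rho) \<le> C * real (I + 1) * t * (X powr w + X ^ CARD('m) * rho ^ CARD('d))"
      by (rule measure_near_set_le[OF db w_ge(1) c _ Y1]) (rule Y)
    then show ?thesis by (elim exE conjE) (rule that)
  qed
  obtain i1 :: nat where i1: "1 / c' < 2 ^ i1" using real_arch_pow[of 2 "1 / c'"] by auto
  have i1': "1 \<le> c' * 2 ^ i1" using i1 c' by (simp add: field_simps)
  \<comment> \<open>X^(1+w) <= X^(n+1) = 2^s, so s + i1 halvings lead from X down to the smallest
    possible slope c' X^(-w).\<close>
  have rho_le: "rho \<le> c' * dilation s powr (- w) * 2 ^ (s + i1)" if "rho \<le> dilation s" for s rho
  proof -
    have "dilation s powr (1 + w) \<le> dilation s powr real (ndim + 1)" by (rule powr_mono) (use w_nn dilation_ge_1 in auto)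
    also have "\<dots> = 2 ^ s" using dilation_pos[of s] dilation_power[of s] by (simp add: powr_realpow del: of_nat_add of_nat_Suc)
    finally have "dilation s powr (1 + w) \<le> 2 ^ s" .
    then have "dilation s powr (1 + w) * 1 \<le> 2 ^ s * (c' * 2 ^ i1)" by (intro mult_mono i1') auto
    then have "dilation s powr (- w) * (dilation s powr (1 + w)) \<le> dilation s powr (- w) * (2 ^ s * (c' * 2 ^ i1))"
      by (intro mult_left_mono) auto
    moreover have "dilation s powr (- w) * (dilation s powr (1 + w)) = dilation s" using dilation_pos[of s] by (simp add: powr_add[symmetric])
    ultimately show ?thesis using that by (simp add: power_add mult_ac)
  qed
  \<comment> \<open>u^s = X^(n-w) for X = \<open>dilation s\<close>. Since w < n it is unbounded,
    and from s0 on the bound t <= c/2 X^(-w) holds.\<close>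
  define u where "u = 2 powr ((real ndim - w) / real (ndim + 1))"
  have u: "u > 1" unfolding u_def using w_nn by simp
  obtain s0 where s0: "2 * (1 + real CARD('d)) / c < u ^ s0" using real_arch_pow[OF u] by blast
  have t_le: "t \<le> c / 2 * dilation s powr (- w)" if s: "s \<ge> s0" and t: "t \<le> (1 + real CARD('d)) / dilation s ^ ndim" for s t
  proof -
    have "u ^ s0 \<le> u ^ s" using u s by (intro power_increasing) auto
    also have "u ^ s = u powr real s" using u by (simp add: powr_realpow)
    also have "\<dots> = dilation s powr (real ndim - w)" unfolding u_def dilation_def powr_powr by (simp add: mult.commute)
    finally have "2 * (1 + real CARD('d)) / c \<le> dilation s powr (real ndim - w)" using s0 by linarith
    then have "1 + real CARD('d) \<le> c / 2 * dilation s powr (real ndim - w)" using c by (simp add: field_simps)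
    also have "dilation s powr (real ndim - w) = dilation s ^ ndim * dilation s powr (- w)"
      using dilation_pos[of s] by (simp add: powr_diff powr_minus powr_realpow divide_inverse)
    finally have "(1 + real CARD('d)) / dilation s ^ ndim \<le> c / 2 * dilation s powr (- w)"
      using dilation_pos[of s] by (simp add: field_simps)
    then show ?thesis using t by linarith
  qed
  define C2 where "C2 = 2 * C * (1 + real CARD('d)) * real (i1 + 1)"
  have C2: "C2 > 0" using C by (simp add: C2_def)
  have Ile: "real (s + i1 + 1) \<le> real (i1 + 1) * real (s + 1)" for s
  proof -
    have "(i1 + 1) * (s + 1) = s + i1 + 1 + i1 * s" by (simp add: algebra_simps)
    then show ?thesis unfolding of_nat_mult[symmetric] of_nat_le_iff by linarith
  qed
  have exc: "measure lborel (short_cell_set s del) \<le> C2 * real (s + 1) * del" if s: "s \<ge> s0" and del: "0 < del" "del \<le> 1" for s del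
  proof -
    define X where "X = dilation s"
    have X: "X \<ge> 1" using dilation_ge_1 by (simp add: X_def)
    let ?t = "(1 + real CARD('d)) * del / X ^ ndim"
    have tle: "?t \<le> (1 + real CARD('d)) / X ^ ndim"
      using X del by (intro divide_right_mono mult_left_le) auto
    have "measure lborel (short_cell_set s del) \<le> C * real (s + i1 + 1) * ?t * (X powr w + X ^ CARD('m) * X ^ CARD('d))"
      unfolding short_cell_set_def X_def[symmetric]
    proof (rule near[rule_format])
      show "?t \<le> c / 2 * X powr (- w)" unfolding X_def by (rule t_le[OF s]) (use tle in \<open>simp add: X_def\<close>)
      show "X \<le> c' * X powr (- w) * 2 ^ (s + i1)" unfolding X_def by (rule rho_le) simp
    qed (use X del in auto)
    also have "X ^ CARD('m) * X ^ CARD('d) = X ^ ndim" unfolding ndim_eq power_add by simp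
    also have "C * real (s + i1 + 1) * ?t * (X powr w + X ^ ndim) \<le> C * real (s + i1 + 1) * ?t * (X ^ ndim + X ^ ndim)"
    proof (intro mult_left_mono add_right_mono)
      show "X powr w \<le> X ^ ndim" using powr_mono[of w "real ndim" X] w_nn X by (simp add: powr_realpow)
    qed (use C X del in auto)
    also have "\<dots> = 2 * C * (1 + real CARD('d)) * del * real (s + i1 + 1)" using X by simp
    also have "\<dots> \<le> 2 * C * (1 + real CARD('d)) * del * (real (i1 + 1) * real (s + 1))"
      using C del by (intro mult_left_mono Ile) auto
    finally show ?thesis by (simp add: C2_def mult_ac)
  qed
  have bad: "measure lborel (bad_region s R) \<le> C2 * real (s + 1) * (dilation s powr (w - real ndim) + 1 / half_dilation R)" if s: "s \<ge> s0" for s R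
  proof -
    define X where "X = dilation s"
    define p where "p = half_dilation R"
    have X: "X \<ge> 1" using dilation_ge_1 by (simp add: X_def)
    have p: "p \<ge> 1" using half_dilation_ge_1 by (simp add: p_def)
    let ?N = "near_set A a0 X (1 / X ^ ndim) (X / p)"
    have "X / p \<le> X / 1" using X p by (intro divide_left_mono) auto
    then have Xp: "X / p \<le> X" by simp
    have sub: "bad_region s R \<subseteq> ?N"
    proof
      fix y assume "y \<in> bad_region s R"
      then obtain z where y: "y \<in> cube a0 1" and z: "z \<noteq> 0" "\<And>k. \<bar>real_of_int (z $ Some k)\<bar> \<le> X"
        "\<bar>aff_form A y z\<bar> \<le> 1 / X ^ ndim" "\<And>i. \<bar>lin_form A z (Some i)\<bar> \<le> X / p"
        unfolding bad_region_def bad_set_def X_def p_def ndim_def by auto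
      then show "y \<in> ?N" unfolding near_set_def by (simp, intro exI[of _ z]) simp
    qed
    have "measure lborel (bad_region s R) \<le> measure lborel ?N"
    proof (rule measure_mono_cube[OF sub, of a0 1])
      show "?N \<subseteq> cube a0 1" unfolding near_set_def by blast
    qed (simp_all add: bad_region_def near_set_borel)
    also have "\<dots> \<le> C * real (s + i1 + 1) * (1 / X ^ ndim) * (X powr w + X ^ CARD('m) * (X / p) ^ CARD('d))"
    proof (rule near[rule_format])
      have "1 / X ^ ndim \<le> (1 + real CARD('d)) / X ^ ndim" using X by (intro divide_right_mono) auto
      then show "1 / X ^ ndim \<le> c / 2 * X powr (- w)" unfolding X_def by (rule t_le[OF s])
      show "X / p \<le> c' * X powr (- w) * 2 ^ (s + i1)" using rho_le[of "X / p" s] Xp by (simp add: X_def)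
    qed (use X p in auto)
    also have "\<dots> = C * real (s + i1 + 1) * (X powr w / X ^ ndim + X ^ CARD('m) * (X / p) ^ CARD('d) / X ^ ndim)"
      unfolding add_divide_distrib[symmetric] by simp
    also have "X powr w / X ^ ndim = X powr (w - real ndim)" using X by (simp add: powr_diff powr_realpow)
    also have "X ^ CARD('m) * (X / p) ^ CARD('d) / X ^ ndim = 1 / p ^ CARD('d)"
      using X p unfolding ndim_eq by (simp add: power_add power_divide)
    also have "C * real (s + i1 + 1) * (X powr (w - real ndim) + 1 / p ^ CARD('d))
        \<le> C * (real (i1 + 1) * real (s + 1)) * (X powr (w - real ndim) + 1 / p)"
    proof (intro mult_mono add_mono order_refl)
      have "p ^ 1 \<le> p ^ CARD('d)" using p by (intro power_increasing) (auto simp: Suc_leI)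
      then show "1 / p ^ CARD('d) \<le> 1 / p" using p by (intro divide_left_mono) auto
      show "real (s + i1 + 1) \<le> real (i1 + 1) * real (s + 1)" by (rule Ile)
    qed (use C p in auto)
    also have "\<dots> \<le> C2 * real (s + 1) * (X powr (w - real ndim) + 1 / p)"
    proof -
      have "0 \<le> X powr (w - real ndim) + 1 / p" using p by simp
      moreover have "C * (real (i1 + 1) * real (s + 1)) \<le> C2 * real (s + 1)"
      proof -
        have "C * real (i1 + 1) * 1 \<le> C * real (i1 + 1) * (2 * (1 + real CARD('d)))"
          using C by (intro mult_left_mono) auto
        moreover have "C2 = C * real (i1 + 1) * (2 * (1 + real CARD('d)))" by (simp add: C2_def)
        ultimately have "C * real (i1 + 1) \<le> C2" by linarith
        then have "C * real (i1 + 1) * real (s + 1) \<le> C2 * real (s + 1)" by (rule mult_right_mono) simp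
        then show ?thesis by (simp only: mult.assoc)
      qed
      ultimately show ?thesis by (intro mult_right_mono) auto
    qed
    finally show ?thesis by (simp add: X_def p_def)
  qed
  show ?thesis using C2 exc bad by (intro exI[of _ C2] exI[of _ s0] conjI allI impI) auto
qed

end

section \<open>Borel--Cantelli\<close>

context dioph_data begin

lemma fl0_of_dyadic_index: "dyadic_index s y = dyadic_index s y' \<Longrightarrow> dyadic_index 0 y = dyadic_index 0 y'"
  by (rule dyadic_index_coarsen) auto

lemma short_cell_set_borel [simp]: "short_cell_set s del \<in> sets borel" and bad_region_borel [simp]: "bad_region k R \<in> sets borel"
  by (simp_all add: short_cell_set_def bad_region_def near_set_borel)

lemma short_cell_set_subset: "short_cell_set s del \<subseteq> cube a0 1" and bad_region_subset: "bad_region k R \<subseteq> cube a0 1"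
  unfolding short_cell_set_def near_set_def bad_region_def bad_set_def by blast+

lemma emeasure_subset_a0:
  assumes "E \<subseteq> cube a0 1" "E \<in> sets borel"
  shows "emeasure lborel E = ennreal (measure lborel E)"
  using fmeasurable_subset_hobox[OF assms(2,1)] by (intro emeasure_eq_ennreal_measure) (auto simp: fmeasurable_def)

text \<open>A cube that is not nice has one of two defects. If the lattice at its corner has a
  vector shorter than \<open>del\<close>, the whole cube lies in \<open>short_cell_set\<close>.
  Otherwise hits fill more than eta of it while \<open>loc\<close> explains only eta / 2, so the bad
  set fills at least eta / 2 and the volume of the cube is at most 2 / eta times its bad part. The
  bounds are summed over all cubes of level s.\<close>

lemma measure_not_nice_set_le_short_cell_bad:
  assumes eta: "eta > 0" and del: "0 < del"
    and loc: "\<And>b. (\<forall>z. z \<noteq> 0 \<longrightarrow> del \<le> norm (renorm A (dilation s) (dyadic_corner s b) z)) \<Longrightarrow>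
     measure lborel ({y. dyadic_index s y = b} \<inter> hit_set (s + R) e)
       \<le> eta / 2 / 2 ^ (s * CARD('d)) + measure lborel (bad_set A (dyadic_corner s b) (1 / 2 ^ s) (dilation (s + R)) (half_dilation R))"
    and del1: "del \<le> 1"
  shows "measure lborel (not_nice_set eta e s R) \<le> measure lborel (short_cell_set s del) + 2 / eta * measure lborel (bad_region (s + R) R)"
proof -
  let ?not_nice_set = "not_nice_set eta e s R" and ?E = "short_cell_set s del" and ?B = "bad_region (s + R) R"
  have NNs: "?not_nice_set \<subseteq> cube a0 1" unfolding not_nice_set_def cube_a0[symmetric] by blast
  have flm [measurable]: "{y. dyadic_index s y = b} \<in> sets borel" for b :: "int^'d" by (rule dyadic_index_set_borel)
  have piece: "emeasure lborel ({y. dyadic_index s y = b} \<inter> ?not_nice_set)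
     \<le> emeasure lborel ({y. dyadic_index s y = b} \<inter> ?E) + ennreal (2 / eta) * emeasure lborel ({y. dyadic_index s y = b} \<inter> ?B)" for b
  proof (cases "{y. dyadic_index s y = b} \<inter> ?not_nice_set = {}")
    case True then show ?thesis by simp
  next
    case False
    then obtain y0 where y0: "dyadic_index s y0 = b" "dyadic_index 0 y0 = c0" "\<not> nice eta e s R b" by (auto simp: not_nice_set_def)
    have in0: "dyadic_index 0 y = c0" if "dyadic_index s y = b" for y using fl0_of_dyadic_index[of s y y0] y0 that by simp
    have le: "emeasure lborel ({y. dyadic_index s y = b} \<inter> ?not_nice_set) \<le> emeasure lborel {y. dyadic_index s y = b}"
      by (rule emeasure_mono) (auto simp: flm)
    show ?thesis
    proof (cases "\<exists>z. z \<noteq> 0 \<and> norm (renorm A (dilation s) (dyadic_corner s b) z) < del")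
      case True
      then obtain z where "z \<noteq> 0" "norm (renorm A (dilation s) (dyadic_corner s b) z) < del" by blast
      then have "{y. dyadic_index s y = b} \<subseteq> {y. dyadic_index s y = b} \<inter> ?E" using short_cell_set_of_short[OF _ _ del del1] in0 by blast
      then have "emeasure lborel {y. dyadic_index s y = b} \<le> emeasure lborel ({y. dyadic_index s y = b} \<inter> ?E)"
        by (rule emeasure_mono) (use flm in auto)
      then show ?thesis using le by (meson add_increasing2 order_trans zero_le)
    next
      case False
      define bb where "bb = bad_set A (dyadic_corner s b) (1 / 2 ^ s) (dilation (s + R)) (half_dilation R)"
      have "measure lborel ({y. dyadic_index s y = b} \<inter> hit_set (s + R) e) \<le> eta / 2 / 2 ^ (s * CARD('d)) + measure lborel bb"
        unfolding bb_def by (rule loc) (use False in \<open>auto simp: not_less\<close>)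
      moreover have "measure lborel ({y. dyadic_index s y = b} \<inter> hit_set (s + R) e) > eta / 2 ^ (s * CARD('d))"
        using y0(3) by (simp add: nice_def not_le)
      moreover have "eta / 2 ^ (s * CARD('d)) = eta / 2 / 2 ^ (s * CARD('d)) + eta / 2 / 2 ^ (s * CARD('d))" by simp
      ultimately have "eta / 2 / 2 ^ (s * CARD('d)) \<le> measure lborel bb" by linarith
      then have "1 / 2 ^ (s * CARD('d)) \<le> 2 / eta * measure lborel bb" using eta by (simp add: field_simps)
      then have "ennreal (1 / 2 ^ (s * CARD('d))) \<le> ennreal (2 / eta) * ennreal (measure lborel bb)"
        using eta by (subst ennreal_mult'[symmetric]) (auto intro: ennreal_leI)
      also have "ennreal (measure lborel bb) \<le> emeasure lborel ({y. dyadic_index s y = b} \<inter> ?B)"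
      proof -
        have sub: "bb \<subseteq> {y. dyadic_index s y = b} \<inter> ?B"
        proof
          fix y assume y: "y \<in> bb"
          then have c: "dyadic_index s y = b" unfolding bb_def bad_set_def dyadic_index_eq_iff by blast
          then have "y \<in> cube a0 1" using in0 cube_a0 by blast
          then have "y \<in> ?B" using y unfolding bb_def bad_region_def bad_set_def by blast
          then show "y \<in> {y. dyadic_index s y = b} \<inter> ?B" using c by blast
        qed
        have "bb \<subseteq> cube a0 1" using sub bad_region_subset by blast
        then have "emeasure lborel bb = ennreal (measure lborel bb)"
          by (rule emeasure_subset_a0) (simp add: bb_def)
        moreover have "emeasure lborel bb \<le> emeasure lborel ({y. dyadic_index s y = b} \<inter> ?B)"
          by (rule emeasure_mono[OF sub]) (use flm in auto)
        ultimately show ?thesis by simp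
      qed
      finally have "emeasure lborel {y. dyadic_index s y = b} \<le> ennreal (2 / eta) * emeasure lborel ({y. dyadic_index s y = b} \<inter> ?B)"
        by (simp add: emeasure_dyadic_index mult_left_mono)
      then show ?thesis using le by (meson add_increasing order_trans zero_le)
    qed
  qed
  have split: "emeasure lborel E = (\<integral>\<^sup>+b. emeasure lborel ({y. dyadic_index s y = b} \<inter> E) \<partial>count_space UNIV)"
    if E [measurable]: "E \<in> sets borel" for E :: "(real^'d) set"
  proof -
    have "(\<integral>\<^sup>+y. indicator E y * indicator {y. dyadic_index s y = b} y \<partial>lborel) = emeasure lborel ({y. dyadic_index s y = b} \<inter> E)" for b :: "int^'d"
    proof -
      have "(\<integral>\<^sup>+y. indicator E y * indicator {y. dyadic_index s y = b} y \<partial>lborel) = (\<integral>\<^sup>+y. indicator ({y. dyadic_index s y = b} \<inter> E) y \<partial>lborel)"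
        by (rule nn_integral_cong) (auto simp: indicator_def)
      then show ?thesis by simp
    qed
    moreover have "(\<integral>\<^sup>+y. indicator E y \<partial>lborel) = emeasure lborel E" by simp
    ultimately show ?thesis using nn_integral_dyadic_split[of "indicator E" s] by simp
  qed
  have "emeasure lborel ?not_nice_set \<le> (\<integral>\<^sup>+b. (emeasure lborel ({y. dyadic_index s y = b} \<inter> ?E) + ennreal (2 / eta) * emeasure lborel ({y. dyadic_index s y = b} \<inter> ?B)) \<partial>count_space UNIV)"
    unfolding split[OF not_nice_set_borel] by (rule nn_integral_mono) (rule piece)
  also have "\<dots> = emeasure lborel ?E + ennreal (2 / eta) * emeasure lborel ?B"
    unfolding split[OF short_cell_set_borel] split[OF bad_region_borel] by (simp add: nn_integral_add nn_integral_cmult)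
  finally have "ennreal (measure lborel ?not_nice_set) \<le> ennreal (measure lborel ?E) + ennreal (2 / eta) * ennreal (measure lborel ?B)"
    using emeasure_subset_a0[OF NNs] emeasure_subset_a0[OF short_cell_set_subset] emeasure_subset_a0[OF bad_region_subset] by simp
  also have "\<dots> = ennreal (measure lborel ?E + 2 / eta * measure lborel ?B)"
    using eta by (simp add: ennreal_mult'[symmetric] ennreal_plus[symmetric] del: ennreal_plus)
  finally show ?thesis
    using eta by (subst (asm) ennreal_le_iff) (auto intro!: add_nonneg_nonneg)
qed

lemma measure_not_nice_set_le:
  assumes eta: "eta > 0"
  shows "\<exists>e>0. \<exists>C>0. \<exists>kap>0. \<exists>R0. \<forall>R\<ge>R0. \<forall>s\<ge>R.
     measure lborel (not_nice_set eta e s R) \<le> C * real (s + R + 1) * 2 powr (- (kap * real R))"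
proof -
  obtain e C0 where e: "e > 0" and C0: "C0 > 0" and loc: "\<forall>s R b del. del > 0 \<longrightarrow> del \<le> 1 \<longrightarrow> C0 / del ^ ndim \<le> half_dilation R \<longrightarrow>
     (\<forall>z. z \<noteq> 0 \<longrightarrow> del \<le> norm (renorm A (dilation s) (dyadic_corner s b) z)) \<longrightarrow>
     measure lborel ({y. dyadic_index s y = b} \<inter> hit_set (s + R) e)
       \<le> eta / 2 / 2 ^ (s * CARD('d)) + measure lborel (bad_set A (dyadic_corner s b) (1 / 2 ^ s) (dilation (s + R)) (half_dilation R))"
    using nice_of_no_short[OF eta] by (elim exE conjE) (rule that)
  obtain C1 s0 where C1: "C1 > 0" and EB: "\<forall>s\<ge>s0. (\<forall>del. 0 < del \<longrightarrow> del \<le> 1 \<longrightarrow> measure lborel (short_cell_set s del) \<le> C1 * real (s + 1) * del) \<and>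
     (\<forall>R. measure lborel (bad_region s R) \<le> C1 * real (s + 1) * (dilation s powr (w - real ndim) + 1 / half_dilation R))"
    using measure_short_cell_bad by (elim exE conjE) (rule that)
  have nn0: "real ndim \<ge> 2" using ndim_ge_2 by simp
  \<comment> \<open>The three decay rates in R are k1 from \<open>del\<close>, (n - w) / (n + 1)
    from \<open>dilation\<close> to the power w - n, and 1 / (2 (n + 1)) from
    \<open>half_dilation\<close>; the last is at least k1.\<close>
  define k1 where "k1 = 1 / (2 * real (ndim + 1) * real ndim)"
  define kap where "kap = min k1 ((real ndim - w) / real (ndim + 1))"
  have kap: "kap > 0" "kap \<le> k1" "kap \<le> (real ndim - w) / real (ndim + 1)" "k1 \<le> 1 / (2 * real (ndim + 1))"
  proof -
    show "kap > 0" unfolding kap_def k1_def using nn0 w_nn by simp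
    have "k1 = 1 / (2 * real (ndim + 1)) / real ndim" by (simp add: k1_def)
    also have "\<dots> \<le> 1 / (2 * real (ndim + 1)) / 1" using nn0 by (intro divide_left_mono) auto
    finally show "k1 \<le> 1 / (2 * real (ndim + 1))" by simp
  qed (auto simp: kap_def)
  define u where "u = 2 powr (1 / (2 * real (ndim + 1)))"
  have u: "u > 1" unfolding u_def by simp
  have hpu: "half_dilation R = u ^ R" for R
  proof -
    have "u ^ R = u powr real R" using u by (simp add: powr_realpow)
    then show ?thesis unfolding u_def powr_powr half_dilation_def by simp
  qed
  obtain R1 where R1: "C0 < u ^ R1" using real_arch_pow[OF u] by blast
  define C where "C = C1 * C0 powr (1 / real ndim) + 2 / eta * (C1 * 2)"
  have C: "C > 0" unfolding C_def using C1 C0 eta by (intro add_pos_pos mult_pos_pos) auto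
  have "measure lborel (not_nice_set eta e s R) \<le> C * real (s + R + 1) * 2 powr (- (kap * real R))"
    if R: "R \<ge> max R1 s0" and s: "s \<ge> R" for R s
  proof -
    have "u ^ R1 \<le> u ^ R" using u R by (intro power_increasing) auto
    then have pC: "C0 \<le> half_dilation R" using R1 hpu by simp
    have p0: "half_dilation R > 0" using half_dilation_ge_1[of R] by simp
    \<comment> \<open>The smallest value for which the covering radius C0 / del^n is still at most
      \<open>half_dilation R\<close>.\<close>
    define del where "del = (C0 / half_dilation R) powr (1 / real ndim)"
    have del0: "del > 0" unfolding del_def using C0 p0 by simp
    have del1: "del \<le> 1" unfolding del_def using C0 p0 pC by (intro powr_le1) auto
    have "del ^ ndim = del powr real ndim" using del0 by (simp add: powr_realpow)
    also have "\<dots> = C0 / half_dilation R" unfolding del_def powr_powr using nn0 C0 p0 by simp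
    finally have deln: "C0 / del ^ ndim \<le> half_dilation R" using C0 p0 by simp
    have "measure lborel (not_nice_set eta e s R) \<le> measure lborel (short_cell_set s del) + 2 / eta * measure lborel (bad_region (s + R) R)"
      by (rule measure_not_nice_set_le_short_cell_bad[OF eta del0 _ del1]) (rule loc[rule_format, OF del0 del1 deln], blast)
    also have "measure lborel (short_cell_set s del) \<le> C1 * real (s + 1) * del"
      using EB del0 del1 R s by auto
    also have "\<dots> \<le> C1 * real (s + R + 1) * (C0 powr (1 / real ndim) * 2 powr (- (kap * real R)))"
    proof -
      have "del = C0 powr (1 / real ndim) / half_dilation R powr (1 / real ndim)"
        unfolding del_def using C0 p0 by (simp add: powr_divide)
      also have "half_dilation R powr (1 / real ndim) = 2 powr (k1 * real R)" unfolding half_dilation_def powr_powr k1_def by (simp add: mult_ac)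
      also have "C0 powr (1 / real ndim) / 2 powr (k1 * real R) = C0 powr (1 / real ndim) * 2 powr (- (k1 * real R))"
        by (simp add: powr_minus divide_inverse)
      also have "\<dots> \<le> C0 powr (1 / real ndim) * 2 powr (- (kap * real R))"
        using kap by (intro mult_left_mono powr_mono) (auto intro: mult_right_mono)
      finally have "del \<le> C0 powr (1 / real ndim) * 2 powr (- (kap * real R))" .
      then show ?thesis using C1 del0 by (intro mult_mono) auto
    qed
    also have "measure lborel (bad_region (s + R) R) \<le> C1 * real (s + R + 1) * (dilation (s + R) powr (w - real ndim) + 1 / half_dilation R)"
    proof -
      have "s0 \<le> s + R" using R s by simp
      then show ?thesis using EB by blast
    qed
    also have "\<dots> \<le> C1 * real (s + R + 1) * (2 * 2 powr (- (kap * real R)))"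
    proof -
      have "dilation (s + R) powr (w - real ndim) = 2 powr (- ((real ndim - w) / real (ndim + 1) * real (s + R)))"
      proof -
        have "real (s + R) / real (ndim + 1) * (w - real ndim) = - ((real ndim - w) / real (ndim + 1) * real (s + R))"
          by (metis (no_types, opaque_lifting) minus_diff_eq minus_divide_left mult.commute mult_minus_right times_divide_eq_right)
        then show ?thesis unfolding dilation_def powr_powr by (simp only:)
      qed
      also have "\<dots> \<le> 2 powr (- (kap * real R))"
      proof (rule powr_mono)
        have "kap * real R \<le> (real ndim - w) / real (ndim + 1) * real (s + R)"
          by (rule mult_mono[OF kap(3)]) (use w_nn in auto)
        then show "- ((real ndim - w) / real (ndim + 1) * real (s + R)) \<le> - (kap * real R)" by (simp only: neg_le_iff_le)
      qed simp
      finally have 1: "dilation (s + R) powr (w - real ndim) \<le> 2 powr (- (kap * real R))" .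
      have "1 / half_dilation R = 2 powr (- (1 / (2 * real (ndim + 1)) * real R))" unfolding half_dilation_def by (simp add: powr_minus divide_inverse mult_ac)
      also have "\<dots> \<le> 2 powr (- (kap * real R))"
      proof (rule powr_mono)
        have "kap \<le> 1 / (2 * real (ndim + 1))" using kap(2,4) by linarith
        then have "kap * real R \<le> 1 / (2 * real (ndim + 1)) * real R" by (rule mult_right_mono) simp
        then show "- (1 / (2 * real (ndim + 1)) * real R) \<le> - (kap * real R)" by (simp only: neg_le_iff_le)
      qed simp
      finally have 2: "1 / half_dilation R \<le> 2 powr (- (kap * real R))" .
      show ?thesis using 1 2 C1 by (intro mult_left_mono) auto
    qed
    finally have "measure lborel (not_nice_set eta e s R) \<le> C1 * real (s + R + 1) * (C0 powr (1 / real ndim) * 2 powr (- (kap * real R)))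
       + 2 / eta * (C1 * real (s + R + 1) * (2 * 2 powr (- (kap * real R))))"
      using eta by (simp add: divide_right_mono)
    also have "\<dots> = C * real (s + R + 1) * 2 powr (- (kap * real R))"
      by (simp add: C_def algebra_simps add_divide_distrib)
    finally show ?thesis .
  qed
  then show ?thesis using e C kap(1) by blast
qed

text \<open>Discarding hits in cubes that are not nice makes the conditional bound true in every
  cube: there the intersection is empty.\<close>

definition nice_hits :: "real \<Rightarrow> real \<Rightarrow> nat \<Rightarrow> nat \<Rightarrow> (real^'d) set" where
  "nice_hits eta e s R = {y. y \<in> hit_set (s + R) e \<and> nice eta e s R (dyadic_index s y)}"

lemma nice_hits_borel [simp]: "nice_hits eta e s R \<in> sets borel"
proof -
  have "nice_hits eta e s R = hit_set (s + R) e \<inter> {y. nice eta e s R (dyadic_index s y)}" by (auto simp: nice_hits_def)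
  then show ?thesis using dyadic_index_set_borel[of "\<lambda>b. nice eta e s R b" s] by auto
qed

lemma nice_hits_cong:
  assumes "dyadic_index (s + R) y = dyadic_index (s + R) y'"
  shows "y \<in> nice_hits eta e s R \<longleftrightarrow> y' \<in> nice_hits eta e s R"
proof -
  have "dyadic_index s y = dyadic_index s y'" by (rule dyadic_index_coarsen[OF assms]) simp
  then show ?thesis using assms by (simp add: nice_hits_def hit_set_def)
qed

lemma nice_hits_conditional:
  assumes "eta > 0"
  shows "emeasure lborel ({y. dyadic_index s y = b} \<inter> nice_hits eta e s R) \<le> ennreal eta * emeasure lborel {y. dyadic_index s y = b}"
proof (cases "nice eta e s R b")
  case True
  have eq: "{y. dyadic_index s y = b} \<inter> nice_hits eta e s R = {y. dyadic_index s y = b} \<inter> hit_set (s + R) e" using True by (auto simp: nice_hits_def)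
  have flm: "{y. dyadic_index s y = b} \<in> sets borel" by (rule dyadic_index_set_borel)
  have "emeasure lborel ({y. dyadic_index s y = b} \<inter> hit_set (s + R) e) \<le> emeasure lborel {y. dyadic_index s y = b}"
    by (rule emeasure_mono) (auto simp: flm)
  then have "emeasure lborel ({y. dyadic_index s y = b} \<inter> hit_set (s + R) e) = ennreal (measure lborel ({y. dyadic_index s y = b} \<inter> hit_set (s + R) e))"
    by (intro emeasure_eq_ennreal_measure) (auto simp: emeasure_dyadic_index top_unique)
  also have "\<dots> \<le> ennreal (eta / 2 ^ (s * CARD('d)))" using True by (intro ennreal_leI) (simp add: nice_def)
  also have "\<dots> = ennreal eta * emeasure lborel {y. dyadic_index s y = b}"
    using assms by (simp add: emeasure_dyadic_index ennreal_mult'[symmetric])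
  finally show ?thesis unfolding eq .
next
  case False
  then have "{y. dyadic_index s y = b} \<inter> nice_hits eta e s R = {}" by (auto simp: nice_hits_def)
  then show ?thesis by simp
qed

text \<open>Along the levels j + i (q + l) a hit R = i levels later is decided by the cube of the
  next level, as \<open>many_hits_le\<close> requires. The threshold 3 eta i exceeds the growth of
  the moment, (1 + eta)^i <= 2^(2 eta i), by eta i in the exponent.\<close>

lemma measure_many_hits:
  fixes e :: real
  assumes eta: "eta > 0"
  defines "E \<equiv> \<lambda>(i::nat) (j::nat) (q::nat). {y. dyadic_index 0 y = c0 \<and> 3 * eta * real i \<le> real (card {l. l < i \<and> y \<in> nice_hits eta e (j + i * (q + l)) i})}"
  shows "measure lborel (E i j q) \<le> 2 powr (- (eta * real i))" "E i j q \<in> sets borel"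
proof -
  let ?t = "\<lambda>l. j + i * (q + l)"
  have mt: "mono ?t" by (rule monoI) simp
  have ts: "?t (Suc l) = ?t l + i" for l by (simp add: algebra_simps)
  have Hc: "y \<in> nice_hits eta e (?t l) i \<longleftrightarrow> y' \<in> nice_hits eta e (?t l) i" if "dyadic_index (?t (Suc l)) y = dyadic_index (?t (Suc l)) y'" for l y y'
    using nice_hits_cong that unfolding ts by blast
  show "E i j q \<in> sets borel" unfolding E_def
    by (rule many_hits_le(2)[OF mt Hc nice_hits_borel nice_hits_conditional[OF eta]]) (use eta in auto)
  have "measure lborel (E i j q) \<le> (1 + eta) ^ i / 2 powr (3 * eta * real i)" unfolding E_def
    by (rule many_hits_le(1)[OF mt Hc nice_hits_borel nice_hits_conditional[OF eta]]) (use eta in auto)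
  also have "(1 + eta) ^ i \<le> 2 powr (2 * eta * real i)"
  proof -
    have "1 + eta \<le> exp eta" by simp
    also have "\<dots> \<le> exp (2 * eta * ln 2)"
    proof -
      have "1 \<le> 2 * ln (2::real)" using ln2_ge_two_thirds by simp
      then have "eta * 1 \<le> eta * (2 * ln 2)" using eta by (intro mult_left_mono) auto
      then show ?thesis by simp
    qed
    also have "\<dots> = 2 powr (2 * eta)" by (simp add: powr_def)
    finally have "(1 + eta) ^ i \<le> (2 powr (2 * eta)) ^ i" using eta by (intro power_mono) auto
    also have "\<dots> = (2 powr (2 * eta)) powr real i" by (rule powr_realpow[symmetric]) simp
    finally show ?thesis by (simp add: powr_powr)
  qed
  finally have "measure lborel (E i j q) \<le> 2 powr (2 * eta * real i) / 2 powr (3 * eta * real i)"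
    by (simp add: divide_right_mono)
  also have "\<dots> = 2 powr (- (eta * real i))" by (simp add: powr_diff[symmetric])
  finally show "measure lborel (E i j q) \<le> 2 powr (- (eta * real i))" .
qed

text \<open>The levels below \<open>i\<^sup>2\<close> are split into residue classes modulo \<open>i\<close>, so that consecutive levels
  of a class are \<open>i\<close> apart. Levels below \<open>i q\<close>, a small proportion, are counted trivially.\<close>

lemma AE_few_hits_squares:
  assumes eta: "eta > 0"
  shows "\<exists>e>0. AE y in lborel. dyadic_index 0 y = c0 \<longrightarrow>
     (\<forall>\<^sub>F i in sequentially. real (card {k. k < i * i \<and> y \<in> hit_set k e}) \<le> 4 * eta * (real i)\<^sup>2 + 3 * real i)"
proof -
  obtain e C kap R0 where e: "e > 0" and C: "C > 0" and kap: "kap > 0" and NNle: "\<forall>R\<ge>R0. \<forall>s\<ge>R.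
     measure lborel (not_nice_set eta e s R) \<le> C * real (s + R + 1) * 2 powr (- (kap * real R))"
    using measure_not_nice_set_le[OF eta] by (elim exE conjE) (rule that)
  \<comment> \<open>q i >= 1 ensures that the starting levels s are at least i, the range of
    \<open>measure_not_nice_set_le\<close> with R = i. The levels below i (q i + 1) number at most
    eta i^2 + 3 i.\<close>
  define q where "q i = nat \<lceil>eta * real i\<rceil> + 1" for i
  define E where "E i j = {y. dyadic_index 0 y = c0 \<and> 3 * eta * real i \<le> real (card {l. l < i \<and> y \<in> nice_hits eta e (j + i * (q i + l)) i})}" for i j
  \<comment> \<open>i residue classes and at most i^2 + 1 starting levels: a polynomial number of
    sets, each of measure exponentially small in i up to a polynomial factor.\<close>
  define Z where "Z i = (\<Union>j\<in>{..<i}. E i j) \<union> (\<Union>s\<in>{i..i*i}. not_nice_set eta e s i)" for i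
  have Eb: "E i j \<in> sets borel" and Em: "measure lborel (E i j) \<le> 2 powr (- (eta * real i))" for i j
    unfolding E_def by (rule measure_many_hits[OF eta])+
  have Zb: "Z i \<in> sets borel" for i
    unfolding Z_def by (intro sets.Un sets.finite_UN Eb not_nice_set_borel) auto
  have Zs: "Z i \<subseteq> cube a0 1" for i unfolding Z_def E_def not_nice_set_def cube_a0[symmetric] by blast
  define uu where "uu i = real i * 2 powr (- (eta * real i)) + (real i * real i + 1) * (C * (real i * real i + real i + 1) * 2 powr (- (kap * real i)))" for i
  have Zm: "measure lborel (Z i) \<le> uu i" if "i \<ge> R0" for i
  proof -
    have "measure lborel (Z i) \<le> measure lborel (\<Union>j\<in>{..<i}. E i j) + measure lborel (\<Union>s\<in>{i..i*i}. not_nice_set eta e s i)"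
      unfolding Z_def by (rule measure_Un_le) (use Eb in auto)
    also have "measure lborel (\<Union>j\<in>{..<i}. E i j) \<le> (\<Sum>j\<in>{..<i}. measure lborel (E i j))"
      by (rule measure_UNION_le) (use Eb in auto)
    also have "\<dots> \<le> (\<Sum>j\<in>{..<i}. 2 powr (- (eta * real i)))" by (intro sum_mono Em)
    also have "\<dots> = real i * 2 powr (- (eta * real i))" by simp
    also have "measure lborel (\<Union>s\<in>{i..i*i}. not_nice_set eta e s i) \<le> (\<Sum>s\<in>{i..i*i}. measure lborel (not_nice_set eta e s i))"
      by (rule measure_UNION_le) auto
    also have "\<dots> \<le> (\<Sum>s\<in>{i..i*i}. C * (real i * real i + real i + 1) * 2 powr (- (kap * real i)))"
    proof (rule sum_mono)
      fix s assume s: "s \<in> {i..i*i}"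
      then have "real s \<le> real i * real i" unfolding of_nat_mult[symmetric] of_nat_le_iff by simp
      then have "C * real (s + i + 1) * 2 powr (- (kap * real i)) \<le> C * (real i * real i + real i + 1) * 2 powr (- (kap * real i))"
        using C by (intro mult_right_mono mult_left_mono) auto
      then show "measure lborel (not_nice_set eta e s i) \<le> C * (real i * real i + real i + 1) * 2 powr (- (kap * real i))"
        using NNle that s by (meson atLeastAtMost_iff order_trans)
    qed
    also have "\<dots> = real (card {i..i*i}) * (C * (real i * real i + real i + 1) * 2 powr (- (kap * real i)))" by simp
    also have "\<dots> \<le> (real i * real i + 1) * (C * (real i * real i + real i + 1) * 2 powr (- (kap * real i)))"
    proof (rule mult_right_mono)
      have "card {i..i*i} \<le> i * i + 1" by simp
      then have "real (card {i..i*i}) \<le> real (i * i + 1)" by (simp only: of_nat_le_iff)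
      then show "real (card {i..i*i}) \<le> real i * real i + 1" by simp
    qed (use C in auto)
    finally show ?thesis by (simp add: uu_def)
  qed
  have sq: "summable (\<lambda>n. norm (1 / real n ^ 2))"
    using inverse_power_summable[of 2, where 'a = real] by (simp add: divide_inverse)
  have "(\<lambda>i. real i * 2 powr (- (eta * real i))) \<in> O(\<lambda>n. 1 / real n ^ 2)"
    using eta by real_asymp
  moreover have "(\<lambda>i. (real i * real i + 1) * (C * (real i * real i + real i + 1) * 2 powr (- (kap * real i)))) \<in> O(\<lambda>n. 1 / real n ^ 2)"
    using kap C by real_asymp
  ultimately have "summable uu"
    unfolding uu_def by (intro summable_add summable_comparison_test_bigo[OF sq])
  then have sumZ: "summable (\<lambda>i. measure lborel (Z i))"
    by (rule summable_comparison_test_ev[rotated]) (use Zm in \<open>auto simp: eventually_at_top_linorder\<close>)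
  have "AE y in lborel. eventually (\<lambda>i. y \<in> space lborel - Z i) sequentially"
    by (rule borel_cantelli_AE1) (use Zb sumZ emeasure_subset_a0[OF Zs Zb] in auto)
  then have "AE y in lborel. dyadic_index 0 y = c0 \<longrightarrow>
     (\<forall>\<^sub>F i in sequentially. real (card {k. k < i * i \<and> y \<in> hit_set k e}) \<le> 4 * eta * (real i)\<^sup>2 + 3 * real i)"
  proof (rule AE_mp, intro AE_I2 impI)
    fix y :: "real^'d" assume ev: "eventually (\<lambda>i. y \<in> space lborel - Z i) sequentially" and y0: "dyadic_index 0 y = c0"
    show "\<forall>\<^sub>F i in sequentially. real (card {k. k < i * i \<and> y \<in> hit_set k e}) \<le> 4 * eta * (real i)\<^sup>2 + 3 * real i"
      using ev eventually_ge_at_top[of 1]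
    proof eventually_elim
      case (elim i)
      then have i: "i \<ge> 1" and yZ: "y \<notin> Z i" by auto
      define T where "T j = {l. l < i \<and> y \<in> nice_hits eta e (j + i * (q i + l)) i}" for j
      have Tc: "real (card (T j)) \<le> 3 * eta * real i" if "j < i" for j
      proof -
        have "y \<notin> E i j" using yZ that by (auto simp: Z_def)
        then show ?thesis using y0 by (auto simp: E_def T_def)
      qed
      have fT: "finite (T j)" for j by (simp add: T_def)
      let ?K = "{k. k < i * i \<and> y \<in> hit_set k e}"
      let ?g = "\<lambda>(j, l). j + i * (q i + l) + i"
      have sub: "?K \<subseteq> {..<i * (q i + 1)} \<union> ?g ` (SIGMA j:{..<i}. T j)"
      proof
        fix k assume k: "k \<in> ?K"
        show "k \<in> {..<i * (q i + 1)} \<union> ?g ` (SIGMA j:{..<i}. T j)"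
        proof (cases "k < i * (q i + 1)")
          case False
          define j where "j = k mod i"
          \<comment> \<open>The offset is q i + 1 and not q i because the level k of the hit lies
            one step i beyond the starting level s.\<close>
          define l where "l = k div i - (q i + 1)"
          have dv: "k div i \<ge> q i + 1" using False i by (simp add: less_eq_div_iff_mult_less_eq mult.commute)
          have "k = j + i * (k div i)" by (simp add: j_def)
          also have "k div i = q i + l + 1" using dv by (simp add: l_def)
          finally have keq: "k = j + i * (q i + l) + i" by (simp add: algebra_simps)
          have "k div i < i" using k by (simp add: less_mult_imp_div_less)
          then have li: "l < i" by (simp add: l_def)
          have ji: "j < i" using i by (simp add: j_def)
          define s where "s = j + i * (q i + l)"
          have ks: "k = s + i" using keq by (simp add: s_def)
          have "i * 1 \<le> i * (q i + l)" by (intro mult_le_mono2) (simp add: q_def)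
          then have s1: "i \<le> s" unfolding s_def by linarith
          have s2: "s \<le> i * i" using k ks by simp
          have "y \<notin> not_nice_set eta e s i" using yZ s1 s2 by (auto simp: Z_def)
          then have "nice eta e s i (dyadic_index s y)" using y0 by (simp add: not_nice_set_def)
          then have "y \<in> nice_hits eta e s i" using k ks by (simp add: nice_hits_def)
          then have "l \<in> T j" using li by (simp add: T_def s_def)
          then show ?thesis using ji keq by force
        qed simp
      qed
      have "card ?K \<le> card ({..<i * (q i + 1)} \<union> ?g ` (SIGMA j:{..<i}. T j))"
        by (rule card_mono[OF _ sub]) (use fT in auto)
      also have "\<dots> \<le> card {..<i * (q i + 1)} + card (?g ` (SIGMA j:{..<i}. T j))" by (rule card_Un_le)
      also have "card (?g ` (SIGMA j:{..<i}. T j)) \<le> card (SIGMA j:{..<i}. T j)"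
        by (rule card_image_le) (use fT in auto)
      also have "card (SIGMA j:{..<i}. T j) = (\<Sum>j<i. card (T j))" using fT by simp
      finally have "real (card ?K) \<le> real (i * (q i + 1) + (\<Sum>j<i. card (T j)))" by (simp only: card_lessThan of_nat_le_iff)
      also have "\<dots> = real i * (real (q i) + 1) + (\<Sum>j<i. real (card (T j)))" by (simp add: distrib_left)
      also have "(\<Sum>j<i. real (card (T j))) \<le> (\<Sum>j<i. 3 * eta * real i)" by (intro sum_mono Tc) simp
      also have "(\<Sum>j<i. 3 * eta * real i) = 3 * eta * (real i)\<^sup>2" by (simp add: power2_eq_square)
      also have "real i * (real (q i) + 1) \<le> real i * (eta * real i + 3)"
      proof (intro mult_left_mono)
        have "real (nat \<lceil>eta * real i\<rceil>) \<le> eta * real i + 1" using eta by simp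
        then show "real (q i) + 1 \<le> eta * real i + 3" by (simp add: q_def)
      qed simp
      finally show ?case by (simp add: power2_eq_square algebra_simps)
    qed
  qed
  then show ?thesis using e by blast
qed

lemma AE_few_hits:
  assumes eta: "eta > 0"
  shows "\<exists>e>0. AE y in lborel. dyadic_index 0 y = c0 \<longrightarrow>
     (\<forall>\<^sub>F K in sequentially. real (card {k. k < K \<and> short k e y}) \<le> eta * real K)"
proof -
  \<comment> \<open>20 = 5 * 4: the linear term 3 i raises 4 et to 5 et, and passing from the square
    i^2 back to K costs a factor 4.\<close>
  define et where "et = eta / 20"
  have et: "et > 0" using eta by (simp add: et_def)
  obtain e where e: "e > 0" and ae: "AE y in lborel. dyadic_index 0 y = c0 \<longrightarrow>
     (\<forall>\<^sub>F i in sequentially. real (card {k. k < i * i \<and> y \<in> hit_set k e}) \<le> 4 * et * (real i)\<^sup>2 + 3 * real i)"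
    using AE_few_hits_squares[OF et] by blast
  have "AE y in lborel. dyadic_index 0 y = c0 \<longrightarrow>
     (\<forall>\<^sub>F K in sequentially. real (card {k. k < K \<and> short k e y}) \<le> eta * real K)"
    using ae
  proof (rule AE_mp, intro AE_I2 impI)
    fix y :: "real^'d" assume h: "dyadic_index 0 y = c0 \<longrightarrow> (\<forall>\<^sub>F i in sequentially. real (card {k. k < i * i \<and> y \<in> hit_set k e}) \<le> 4 * et * (real i)\<^sup>2 + 3 * real i)"
      and "dyadic_index 0 y = c0"
    then obtain I where I: "\<And>i. i \<ge> I \<Longrightarrow> real (card {k. k < i * i \<and> y \<in> hit_set k e}) \<le> 4 * et * (real i)\<^sup>2 + 3 * real i"
      by (auto simp: eventually_sequentially)
    define J where "J = max (max I 2) (nat \<lceil>3 / et\<rceil>)"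
    show "\<forall>\<^sub>F K in sequentially. real (card {k. k < K \<and> short k e y}) \<le> eta * real K"
      unfolding eventually_sequentially
    proof (intro exI[of _ "J * J"] allI impI)
      fix K assume K: "J * J \<le> K"
      \<comment> \<open>The squares (i - 1)^2 and i^2 enclose K; for i >= 2 they differ by a factor
        of at most 4.\<close>
      define i where "i = nat \<lfloor>sqrt (real K)\<rfloor> + 1"
      have sq: "sqrt (real K) < real i" "real i - 1 \<le> sqrt (real K)" unfolding i_def by (simp_all, linarith)
      have "real J \<le> sqrt (real K)"
      proof (rule real_le_rsqrt)
        show "(real J)\<^sup>2 \<le> real K" using K unfolding power2_eq_square of_nat_mult[symmetric] of_nat_le_iff .
      qed
      then have iJ: "i \<ge> J" using sq by linarith
      then have i2: "real i \<ge> 2" and iI: "i \<ge> I" and ie: "real i \<ge> 3 / et" unfolding J_def by (auto simp: nat_le_iff ceiling_le_iff)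
      have Kii: "K \<le> i * i"
      proof -
        have "(sqrt (real K))\<^sup>2 \<le> (real i)\<^sup>2" using sq by (intro power_mono) auto
        then have "real K \<le> real (i * i)" by (simp add: power2_eq_square)
        then show ?thesis by (simp only: of_nat_le_iff)
      qed
      have iK: "(real i - 1)\<^sup>2 \<le> real K"
      proof -
        have "(real i - 1)\<^sup>2 \<le> (sqrt (real K))\<^sup>2" using sq i2 by (intro power_mono) auto
        then show ?thesis by simp
      qed
      have "{k. k < K \<and> short k e y} \<subseteq> {k. k < i * i \<and> y \<in> hit_set k e}" using Kii by (auto simp: hit_set_def)
      then have "card {k. k < K \<and> short k e y} \<le> card {k. k < i * i \<and> y \<in> hit_set k e}" by (intro card_mono) auto
      then have "real (card {k. k < K \<and> short k e y}) \<le> 4 * et * (real i)\<^sup>2 + 3 * real i" using I[OF iI] by linarith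
      also have "3 * real i \<le> et * (real i)\<^sup>2"
      proof -
        have "3 \<le> et * real i" using ie et by (simp add: field_simps)
        then have "3 * real i \<le> (et * real i) * real i" by (intro mult_right_mono) auto
        then show ?thesis by (simp add: power2_eq_square)
      qed
      also have "4 * et * (real i)\<^sup>2 + et * (real i)\<^sup>2 = 5 * et * (real i)\<^sup>2" by simp
      also have "\<dots> \<le> 5 * et * (4 * real K)"
      proof (rule mult_left_mono)
        have "real i \<le> 2 * (real i - 1)" using i2 by simp
        then have "(real i)\<^sup>2 \<le> (2 * (real i - 1))\<^sup>2" using i2 by (intro power_mono) auto
        also have "\<dots> = 4 * (real i - 1)\<^sup>2" unfolding power_mult_distrib by simp
        finally show "(real i)\<^sup>2 \<le> 4 * real K" using iK by simp
      qed (use et in simp)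
      also have "\<dots> = eta * real K" by (simp add: et_def)
      finally show "real (card {k. k < K \<and> short k e y}) \<le> eta * real K" by simp
    qed
  qed
  then show ?thesis using e by blast
qed

end

section \<open>The orbit\<close>

lemma affine_param_continuous: "continuous_on UNIV (affine_param A)"
proof -
  have "continuous_on UNIV (\<lambda>x. affine_param A x $ k)" for k
  proof (cases k)
    case (Inl i) then show ?thesis by (simp add: affine_param_def continuous_on_component)
  next
    case (Inr j)
    have "continuous_on UNIV (\<lambda>x. tilde x $ i)" for i
      by (cases i) (auto simp: tilde_def intro!: continuous_intros)
    then have "continuous_on UNIV (\<lambda>x. \<chi> i. tilde x $ i)" by (intro continuous_on_vec_lambda)
    then have "continuous_on UNIV tilde" by (simp add: vec_lambda_eta)
    then show ?thesis by (auto simp: Inr affine_param_def vector_matrix_mult_def intro!: continuous_intros)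
  qed
  then have "continuous_on UNIV (\<lambda>x. \<chi> k. affine_param A x $ k)" by (intro continuous_on_vec_lambda)
  then show ?thesis by (simp add: vec_lambda_eta)
qed

text \<open>The projection to the first d coordinates is a measurable left inverse of the
  parametrization, so a Borel null set of parameters corresponds to a measurable null set of the
  subspace.\<close>

lemma AE_lebesgue_affine:
  fixes A :: "real^'m::finite^('d::finite option)"
  assumes "AE x in lborel. P (affine_param A x)"
  shows "AE u in lebesgue_affine A. P u"
proof -
  let ?f = "affine_param A" and ?S = "affine_subspace A" and ?M = "restrict_space borel (affine_subspace A)"
  let ?g = "\<lambda>u :: real^('d + 'm). (\<chi> i. u $ Inl i) :: real^'d"
  obtain N where N: "{x. \<not> P (?f x)} \<subseteq> N" "N \<in> sets borel" "emeasure lborel N = 0"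
    using assms by (auto elim!: AE_E)
  have gf: "?g (?f x) = x" for x by (simp add: affine_param_def vec_eq_iff)
  have f: "?f \<in> borel \<rightarrow>\<^sub>M ?M"
    by (rule measurable_restrict_space2)
      (auto simp: affine_subspace_def intro: borel_measurable_continuous_onI affine_param_continuous)
  have g: "?g \<in> borel \<rightarrow>\<^sub>M borel"
    by (intro borel_measurable_continuous_onI continuous_on_vec_lambda continuous_intros)
  define N' where "N' = ?S \<inter> ?g -` N"
  have "?g -` N \<inter> space borel \<in> sets borel" by (rule measurable_sets[OF g N(2)])
  then have N'M: "N' \<in> sets ?M" unfolding N'_def sets_restrict_space by auto
  have pre: "?f -` N' = N"
  proof (rule set_eqI)
    fix x
    have "x \<in> ?f -` N' \<longleftrightarrow> ?g (?f x) \<in> N" by (simp add: N'_def affine_subspace_def)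
    then show "x \<in> ?f -` N' \<longleftrightarrow> x \<in> N" unfolding gf .
  qed
  show ?thesis
  proof (rule AE_I)
    show "{u \<in> space (lebesgue_affine A). \<not> P u} \<subseteq> N'"
    proof
      fix u assume "u \<in> {u \<in> space (lebesgue_affine A). \<not> P u}"
      then have "u \<in> ?S" "\<not> P u" by (auto simp: lebesgue_affine_def space_restrict_space)
      then obtain x where "u = ?f x" "x \<in> N" using N(1) by (auto simp: affine_subspace_def)
      then show "u \<in> N'" using pre by auto
    qed
    show "N' \<in> sets (lebesgue_affine A)" using N'M by (simp add: lebesgue_affine_def)
    show "emeasure (lebesgue_affine A) N' = 0"
      unfolding lebesgue_affine_def using f N'M N(3) pre by (subst emeasure_distr) auto
  qed
qed

text \<open>With the rows \<open>Some i\<close> of the matrix set to zero, the lattice map becomes the orbit of \<open>\<int>\<^sup>n\<^sup>+\<^sup>1\<close> itself.\<close>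

definition orbit_mat :: "real^'m::finite^('d::finite option) \<Rightarrow> real^'d \<Rightarrow> real^'m^('d option)" where
  "orbit_mat A y = (\<chi> i j. if i = None then (tilde y v* A) $ j else 0)"

lemma sum_option: "(\<Sum>i\<in>(UNIV :: 'd::finite option set). f i) = (f None :: real) + (\<Sum>i\<in>UNIV. f (Some i))"
  by (simp add: UNIV_option_conv sum.reindex)

lemma sum_sum_type: "(\<Sum>k\<in>(UNIV :: ('d::finite + 'm::finite) set). f k) = (\<Sum>i\<in>UNIV. f (Inl i) :: real) + (\<Sum>j\<in>UNIV. f (Inr j))"
proof -
  have "(\<Sum>k\<in>UNIV <+> UNIV. f k) = (\<Sum>i\<in>(UNIV :: 'd set). f (Inl i)) + (\<Sum>j\<in>(UNIV :: 'm set). f (Inr j))"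
    by (subst sum.Plus) (simp_all add: o_def)
  then show ?thesis by simp
qed

lemma lin_form_orbit_mat:
  "lin_form (orbit_mat A y) z (Some i) = of_int (z $ Some (Inl i))"
  "aff_form (orbit_mat A y) y z = aff_form A y z"
proof -
  show 1: "lin_form (orbit_mat A y) z (Some i) = of_int (z $ Some (Inl i))" for i by (simp add: lin_form_def orbit_mat_def)
  have "(tilde y v* A) $ j = A $ None $ j + (\<Sum>i\<in>UNIV. y $ i * A $ Some i $ j)" for j
    by (simp add: vector_matrix_mult_def sum_option tilde_def mult.commute)
  then have "(\<Sum>j\<in>UNIV. (tilde y v* A) $ j * of_int (z $ Some (Inr j)))
     = (\<Sum>j\<in>UNIV. A $ None $ j * of_int (z $ Some (Inr j))) + (\<Sum>j\<in>UNIV. \<Sum>i\<in>UNIV. y $ i * A $ Some i $ j * of_int (z $ Some (Inr j)))"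
    by (simp add: distrib_right sum.distrib sum_distrib_right)
  also have "(\<Sum>j\<in>UNIV. \<Sum>i\<in>UNIV. y $ i * A $ Some i $ j * of_int (z $ Some (Inr j)))
     = (\<Sum>i\<in>UNIV. y $ i * (\<Sum>j\<in>UNIV. A $ Some i $ j * of_int (z $ Some (Inr j))))"
    by (subst sum.swap) (simp add: sum_distrib_left mult.assoc)
  finally have "(\<Sum>j\<in>UNIV. (tilde y v* A) $ j * of_int (z $ Some (Inr j)))
     = (\<Sum>j\<in>UNIV. A $ None $ j * of_int (z $ Some (Inr j)))
       + (\<Sum>i\<in>UNIV. y $ i * (\<Sum>j\<in>UNIV. A $ Some i $ j * of_int (z $ Some (Inr j))))" .
  then show "aff_form (orbit_mat A y) y z = aff_form A y z"
    unfolding aff_form_def 1 by (simp add: lin_form_def orbit_mat_def distrib_left sum.distrib)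
qed

text \<open>The link between the flow and \<open>renorm\<close>: through it
  \<open>covering_renorm\<close> applies to the orbit itself, with \<open>orbit_mat\<close> in place
  of \<open>A\<close>.\<close>

lemma orbit_renorm:
  fixes A :: "real^'m::finite^('d::finite option)" and t :: real
  defines "S \<equiv> exp (t / (real CARD('d + 'm) + 1))"
  shows "(diag_flow t ** horo (affine_param A y)) *v int_vec z = renorm (orbit_mat A y) S y z"
proof -
  let ?u = "affine_param A y" and ?n = "real CARD('d + 'm)"
  have diag: "(diag_flow t *v v) $ k = (if k = None then exp (?n / (?n + 1) * t) else exp (- (1 / (?n + 1)) * t)) * v $ k"
    for v :: "real^('d + 'm) option" and k
  proof -
    have "(diag_flow t *v v) $ k = (\<Sum>l\<in>UNIV. if k = l then (if k = None then exp (?n / (?n + 1) * t) else exp (- (1 / (?n + 1)) * t)) * v $ l else 0)"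
      unfolding matrix_vector_mult_def diag_flow_def vec_lambda_beta by (intro sum.cong) (auto simp del: card_sum)
    then show ?thesis by (simp del: card_sum)
  qed
  have hS: "(horo ?u *v int_vec z) $ Some k = of_int (z $ Some k)" for k
  proof -
    have "(horo ?u *v int_vec z) $ Some k = (\<Sum>l\<in>UNIV. if Some k = l then of_int (z $ l) else 0)"
      unfolding matrix_vector_mult_def horo_def vec_lambda_beta by (intro sum.cong) auto
    then show ?thesis by simp
  qed
  have hN: "(horo ?u *v int_vec z) $ None = aff_form (orbit_mat A y) y z"
  proof -
    have "(horo ?u *v int_vec z) $ None = of_int (z $ None) + (\<Sum>k\<in>UNIV. ?u $ k * of_int (z $ Some k))"
      unfolding matrix_vector_mult_def horo_def by (simp add: sum_option)
    also have "(\<Sum>k\<in>UNIV. ?u $ k * of_int (z $ Some k)) = (\<Sum>i\<in>UNIV. y $ i * of_int (z $ Some (Inl i)))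
        + (\<Sum>j\<in>UNIV. (tilde y v* A) $ j * of_int (z $ Some (Inr j)))"
      by (simp add: sum_sum_type affine_param_def)
    finally show ?thesis by (simp add: aff_form_def lin_form_def orbit_mat_def)
  qed
  have Sn: "exp (?n / (?n + 1) * t) = S ^ CARD('d + 'm)"
    unfolding S_def exp_of_nat_mult[symmetric] by simp
  have Si: "exp (- (1 / (?n + 1)) * t) = 1 / S"
    unfolding S_def by (simp add: exp_minus inverse_eq_divide)
  have "((diag_flow t ** horo ?u) *v int_vec z) $ k = renorm (orbit_mat A y) S y z $ k" for k
  proof -
    have e: "((diag_flow t ** horo ?u) *v int_vec z) $ k = (if k = None then S ^ CARD('d + 'm) else 1 / S) * (horo ?u *v int_vec z) $ k"
      unfolding matrix_vector_mul_assoc[symmetric] diag Sn Si ..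
    consider "k = None" | i where "k = Some (Inl i)" | j where "k = Some (Inr j)"
      by (metis option.exhaust sum.exhaust)
    then show ?thesis
      unfolding e by cases (simp_all add: hN hS lin_form_orbit_mat(1) del: card_sum)
  qed
  then show ?thesis by (simp add: vec_eq_iff)
qed

context dioph_data begin

text \<open>A quantitative Mahler criterion: without short vectors the covering radius is bounded by
  \<open>covering_renorm\<close>, and then \<open>reduction\<close> finds a representative of
  bounded norm. Continuous time t is compared with the level k = floor (t / ln 2).\<close>

lemma coset_norm_le_of_not_short:
  assumes e: "e > 0"
  shows "\<exists>C. \<forall>t\<ge>0. \<not> short (nat \<lfloor>t / ln 2\<rfloor>) e y \<longrightarrow>
     coset_norm (act (diag_flow t ** horo (affine_param A y)) base_point) \<le> C"
proof -
  \<comment> \<open>Half of e, because within one level the factor S grows to at most 2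
    \<open>dilation k\<close>; the minimum with 1 is for \<open>covering_renorm\<close>.\<close>
  define d where "d = min (e / 2) 1"
  have d: "d > 0" "d \<le> 1" "2 * d \<le> e" using e by (auto simp: d_def)
  obtain C0 where C0: "C0 > 0" and cov: "\<forall>A :: real^'m^('d option). \<forall>S y d. S > 0 \<longrightarrow> 0 < d \<longrightarrow> d \<le> 1 \<longrightarrow>
     (\<forall>z. z \<noteq> 0 \<longrightarrow> d \<le> norm (renorm A S y z)) \<longrightarrow> (\<forall>x. \<exists>z. \<forall>i. \<bar>(x - renorm A S y z) $ i\<bar> \<le> C0 / d ^ ndim)"
    using covering_renorm[where 'd = 'd and 'm = 'm] unfolding ndim_def[symmetric] by (elim exE conjE) (rule that)
  have D0: "C0 / d ^ ndim \<ge> 0" using C0 d by simp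
  obtain C where C: "\<forall>g::real^(('d + 'm) option)^(('d + 'm) option). det g = 1 \<longrightarrow>
    (\<forall>x. \<exists>z. \<forall>i. \<bar>(x - g *v int_vec z) $ i\<bar> \<le> C0 / d ^ ndim) \<longrightarrow> (\<exists>h\<in>SL_int. norm (g ** h) \<le> C)"
    using reduction[OF D0] by (elim exE) (rule that)
  have "coset_norm (act (diag_flow t ** horo (affine_param A y)) base_point) \<le> C"
    if t: "t \<ge> 0" and ns: "\<not> short (nat \<lfloor>t / ln 2\<rfloor>) e y" for t
  proof -
    define k where "k = nat \<lfloor>t / ln 2\<rfloor>"
    define S where "S = exp (t / (real CARD('d + 'm) + 1))"
    have S: "S > 0" by (simp add: S_def)
    have kt: "real k * ln 2 \<le> t" "t \<le> (real k + 1) * ln 2"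
    proof -
      have "t / ln 2 \<ge> 0" using t by simp
      then have "real k \<le> t / ln 2" "t / ln 2 \<le> real k + 1" unfolding k_def by linarith+
      then show "real k * ln 2 \<le> t" "t \<le> (real k + 1) * ln 2" by (simp_all add: field_simps)
    qed
    have sck: "dilation k = exp (real k * ln 2 / (real CARD('d + 'm) + 1))"
      unfolding dilation_def powr_def ndim_def by (simp add: add.commute)
    have S1: "dilation k \<le> S" unfolding sck S_def using kt by (simp add: divide_right_mono del: card_sum)
    have S2: "S \<le> 2 * dilation k"
    proof -
      let ?N = "real CARD('d + 'm) + 1"
      have N1: "?N \<ge> 1" by simp
      have "t / ?N \<le> (real k * ln 2 + ln 2) / ?N" using kt N1 by (intro divide_right_mono) (auto simp: distrib_right)
      also have "\<dots> = real k * ln 2 / ?N + ln 2 / ?N" by (rule add_divide_distrib)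
      also have "ln 2 / ?N \<le> ln 2 / 1" using N1 by (intro divide_left_mono) auto
      finally have "t / ?N \<le> real k * ln 2 / ?N + ln 2" by simp
      then have "S \<le> exp (real k * ln 2 / ?N + ln 2)" unfolding S_def by simp
      also have "\<dots> = 2 * dilation k" unfolding sck exp_add by simp
      finally show ?thesis .
    qed
    let ?g = "diag_flow t ** horo (affine_param A y) :: real^(('d + 'm) option)^(('d + 'm) option)"
    have gl: "?g *v int_vec z = renorm (orbit_mat A y) S y z" for z unfolding S_def by (rule orbit_renorm)
    have "d \<le> norm (renorm (orbit_mat A y) S y z)" if z: "z \<noteq> 0" for z
    proof (rule ccontr)
      assume "\<not> ?thesis"
      then have lt: "\<bar>renorm (orbit_mat A y) S y z $ i\<bar> \<le> d" for i
        using component_le_norm_cart[of "renorm (orbit_mat A y) S y z" i] by linarith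
      have zk: "\<bar>real_of_int (z $ Some l)\<bar> \<le> e * dilation k" for l
      proof -
        have "\<bar>real_of_int (z $ Some l) / S\<bar> \<le> d"
          using lt[of "Some l"] by (cases l) (auto simp: lin_form_orbit_mat(1))
        then have "\<bar>real_of_int (z $ Some l)\<bar> \<le> d * S" using S by (simp add: abs_divide field_simps)
        also have "\<dots> \<le> d * (2 * dilation k)" using d S2 by (intro mult_left_mono) auto
        also have "\<dots> = (2 * d) * dilation k" by simp
        also have "\<dots> \<le> e * dilation k" using d(3) dilation_pos[of k] by (intro mult_right_mono) auto
        finally show ?thesis .
      qed
      have "S ^ ndim * \<bar>aff_form A y z\<bar> \<le> d"
        using lt[of None] S by (simp add: abs_mult lin_form_orbit_mat(2) ndim_def)
      then have "\<bar>aff_form A y z\<bar> \<le> d / S ^ ndim" using S by (simp add: field_simps)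
      also have "\<dots> \<le> e / dilation k ^ ndim"
        using d e S1 dilation_pos[of k] by (intro frac_le power_mono) auto
      finally have "short k e y" using z zk unfolding short_def by blast
      then show False using ns by (simp add: k_def)
    qed
    then have "\<forall>x. \<exists>z. \<forall>i. \<bar>(x - ?g *v int_vec z) $ i\<bar> \<le> C0 / d ^ ndim"
      unfolding gl using cov S d by blast
    moreover have "det ?g = 1" by (simp add: det_mul det_diag_flow det_horo)
    ultimately obtain h where h: "h \<in> SL_int" "norm (?g ** h) \<le> C" using C by blast
    have "act ?g base_point = act ?g SL_int" by (simp add: base_point_def act_def)
    then show ?thesis using coset_norm_act_le[OF h(1), of ?g] h(2) by simp
  qed
  then show ?thesis by blast
qed

text \<open>Times at which \<open>coset_norm\<close> exceeds C lie in intervals of length ln 2 whose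
  level is \<open>short\<close>, and there are few such levels.\<close>

lemma tight_of_few_hits:
  assumes hits: "\<And>eta. eta > 0 \<Longrightarrow> \<exists>e>0. \<forall>\<^sub>F K in sequentially. real (card {k. k < K \<and> short k e y}) \<le> eta * real K"
    and e0: "e0 > 0"
  shows "\<exists>C. \<forall>\<^sub>F T in at_top.
    measure lborel {t \<in> {0..T}. coset_norm (act (diag_flow t ** horo (affine_param A y)) base_point) > C} \<le> e0 * T"
proof -
  let ?h = "\<lambda>t. coset_norm (act (diag_flow t ** horo (affine_param A y)) base_point)"
  obtain e K0 where e: "e > 0" and K0: "\<And>K. K \<ge> K0 \<Longrightarrow> real (card {k. k < K \<and> short k e y}) \<le> e0 / 2 * real K"
    using hits[of "e0 / 2"] e0 by (auto simp: eventually_sequentially)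
  obtain C where C: "\<forall>t\<ge>0. \<not> short (nat \<lfloor>t / ln 2\<rfloor>) e y \<longrightarrow> ?h t \<le> C"
    using coset_norm_le_of_not_short[OF e, of y] by blast
  have hm: "?h \<in> borel_measurable borel"
    using measurable_compose[OF measurable_borel_on[OF continuous_orbit] borel_measurable_borel_on[OF continuous_map_coset_norm]] .
  have "measure lborel {t \<in> {0..T}. ?h t > C} \<le> e0 * T" if T: "T \<ge> max 1 (real K0)" for T
  proof -
    define K where "K = nat \<lfloor>T / ln 2\<rfloor> + 1"
    define B where "B = {k. k < K \<and> short k e y}"
    define J where "J k = {real k * ln 2..(real k + 1) * ln 2}" for k
    have ln2: "0 < ln (2::real)" "ln (2::real) \<le> 1" using ln_2_less_1 by auto
    have Tl: "T / ln 2 \<ge> T" using T ln2 by (simp add: field_simps mult_left_le)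
    have K: "real K > T / ln 2" "real K \<le> T / ln 2 + 1"
      unfolding K_def using Tl T by (linarith, linarith)
    have "K0 \<le> K"
    proof -
      have "real K0 \<le> real K" using K(1) Tl T by linarith
      then show ?thesis by simp
    qed
    then have cB: "real (card B) \<le> e0 / 2 * real K" unfolding B_def by (rule K0)
    have fB: "finite B" by (simp add: B_def)
    have sub: "{t \<in> {0..T}. ?h t > C} \<subseteq> (\<Union>k\<in>B. J k)"
    proof
      fix t assume t: "t \<in> {t \<in> {0..T}. ?h t > C}"
      define k where "k = nat \<lfloor>t / ln 2\<rfloor>"
      have t0: "t / ln 2 \<ge> 0" "t / ln 2 \<le> T / ln 2" using t ln2 by (auto intro: divide_right_mono)
      have "short k e y" using C t unfolding k_def by force
      moreover have "k < K" unfolding k_def K_def using t0 by (meson floor_mono le_imp_less_Suc nat_mono Suc_eq_plus1 order_le_less_trans lessI add.commute less_add_one)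
      moreover have "real k \<le> t / ln 2" "t / ln 2 \<le> real k + 1" unfolding k_def using t0 by linarith+
      then have "t \<in> J k" unfolding J_def using ln2 by (simp add: field_simps)
      ultimately show "t \<in> (\<Union>k\<in>B. J k)" by (auto simp: B_def)
    qed
    have "{t \<in> {0..T}. ?h t > C} = {0..T} \<inter> ?h -` {C<..}" by auto
    also have "\<dots> \<in> sets borel" using measurable_sets[OF hm, of "{C<..}"] by auto
    finally have m: "{t \<in> {0..T}. ?h t > C} \<in> sets lborel" by simp
    have Jf: "J k \<in> fmeasurable lborel" for k
      unfolding J_def by (rule fmeasurableI) (auto simp: emeasure_lborel_Icc_eq)
    have "measure lborel {t \<in> {0..T}. ?h t > C} \<le> measure lborel (\<Union>k\<in>B. J k)"
      by (rule measure_mono_fmeasurable[OF sub m]) (use fB Jf in \<open>auto intro: fmeasurable.finite_UN\<close>)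
    also have "\<dots> \<le> (\<Sum>k\<in>B. measure lborel (J k))"
      by (rule measure_UNION_le) (use fB in \<open>auto simp: J_def\<close>)
    also have "\<dots> = (\<Sum>k\<in>B. ln 2)"
    proof (rule sum.cong)
      fix k
      have "real k * ln 2 \<le> (real k + 1) * ln 2" using ln2 by (intro mult_right_mono) auto
      then show "measure lborel (J k) = ln 2" unfolding J_def by (simp add: distrib_right)
    qed simp
    also have "\<dots> = real (card B) * ln 2" by simp
    also have "\<dots> \<le> (e0 / 2 * real K) * ln 2" using cB ln2 by (intro mult_right_mono) auto
    also have "\<dots> \<le> (e0 / 2 * (T / ln 2 + 1)) * ln 2" using K(2) e0 ln2 by (intro mult_right_mono mult_left_mono) auto
    also have "\<dots> = e0 / 2 * (T + ln 2)" using ln2 by (simp add: field_simps)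
    \<comment> \<open>The last interval may extend beyond T; as ln 2 <= 1 <= T, this at most doubles
      the bound, which is why the hits were bounded with e0 / 2.\<close>
    also have "\<dots> \<le> e0 / 2 * (2 * T)" using ln2 T e0 by (intro mult_left_mono) auto
    finally show ?thesis by simp
  qed
  then show ?thesis unfolding eventually_at_top_linorder by blast
qed

end

theorem theorem1p1:
  fixes A :: "real^'m::finite^('d::finite option)"
  assumes "dioph_exponent A < ereal (real CARD('d + 'm))"
  shows "AE u in lebesgue_affine A. \<forall>\<mu>.
     limit_point_of (weak_star_topology lattice_space)
       (orbit_average lattice_space (\<lambda>t. act (diag_flow t ** horo u) base_point)) \<mu> at_top
     \<longrightarrow> prob_space \<mu>"
proof -
  obtain w c where wc: "real CARD('d + 'm) - 1 \<le> w" "w < real CARD('d + 'm)" "0 < c" "c \<le> 1" "dioph_bound A w c"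
    using dioph_exponent_bound[OF assms] by blast
  interpret dioph_data A w c c0 for c0 :: "int^'d"
    by unfold_locales (rule wc)+
  define P where "P e j c0 \<longleftrightarrow> 0 < e \<and> (AE y in lborel. dyadic_index 0 y = c0 \<longrightarrow>
     (\<forall>\<^sub>F K in sequentially. real (card {k. k < K \<and> short k e y}) \<le> 1 / real (Suc j) * real K))"
    for e :: real and j :: nat and c0 :: "int^'d"
  \<comment> \<open>The choice may depend on j and on the unit cube but not on y. The pairs (c0, j)
    are countable, so the exceptional null sets combine into one.\<close>
  define e where "e j c0 = (SOME e. P e j c0)" for j c0
  have "\<exists>e. P e j c0" for j c0
    unfolding P_def by (rule AE_few_hits) simp
  then have "P (e j c0) j c0" for j c0
    unfolding e_def by (rule someI_ex)
  then have e: "e j c0 > 0"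
    and ae: "AE y in lborel. dyadic_index 0 y = c0 \<longrightarrow>
     (\<forall>\<^sub>F K in sequentially. real (card {k. k < K \<and> short k (e j c0) y}) \<le> 1 / real (Suc j) * real K)" for j c0
    unfolding P_def by blast+
  have "AE y in lborel. \<forall>(c0::int^'d) (j::nat). dyadic_index 0 y = c0 \<longrightarrow>
     (\<forall>\<^sub>F K in sequentially. real (card {k. k < K \<and> short k (e j c0) y}) \<le> 1 / real (Suc j) * real K)"
    unfolding AE_all_countable using ae by blast
  then have "AE y in lborel. \<forall>\<mu>.
     limit_point_of (weak_star_topology lattice_space)
       (orbit_average lattice_space (\<lambda>t. act (diag_flow t ** horo (affine_param A y)) base_point)) \<mu> at_top
     \<longrightarrow> prob_space \<mu>"
  proof (rule AE_mp, intro AE_I2 impI allI)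
    fix y :: "real^'d" and \<mu>
    assume h: "\<forall>(c0::int^'d) (j::nat). dyadic_index 0 y = c0 \<longrightarrow>
       (\<forall>\<^sub>F K in sequentially. real (card {k. k < K \<and> short k (e j c0) y}) \<le> 1 / real (Suc j) * real K)"
      and lim: "limit_point_of (weak_star_topology lattice_space)
       (orbit_average lattice_space (\<lambda>t. act (diag_flow t ** horo (affine_param A y)) base_point)) \<mu> at_top"
    have hits: "\<exists>e>0. \<forall>\<^sub>F K in sequentially. real (card {k. k < K \<and> short k e y}) \<le> eta * real K" if eta: "eta > 0" for eta
    proof -
      \<comment> \<open>The proportions 1 / (j + 1) stand in for all eta > 0.\<close>
      obtain j where j: "inverse (real (Suc j)) < eta" using reals_Archimedean[OF eta] by blast
      have "\<forall>\<^sub>F K in sequentially. real (card {k. k < K \<and> short k (e j (dyadic_index 0 y)) y}) \<le> 1 / real (Suc j) * real K"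
        using h by blast
      then have "\<forall>\<^sub>F K in sequentially. real (card {k. k < K \<and> short k (e j (dyadic_index 0 y)) y}) \<le> eta * real K"
      proof eventually_elim
        case (elim K)
        have "1 / real (Suc j) * real K \<le> eta * real K"
          using j by (intro mult_right_mono) (auto simp: inverse_eq_divide)
        then show ?case using elim by linarith
      qed
      then show ?thesis using e by blast
    qed
    show "prob_space \<mu>"
      by (rule prob_space_limit_point[OF continuous_orbit tight_of_few_hits[OF hits] lim])
  qed
  then show ?thesis by (rule AE_lebesgue_affine)
qed

end
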